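(* Let $x \in \mathbb{R}^d$ be the input of Problem 1 (projection onto $\Delta$-separated $k$-sparse vectors) and let $\gamma \in \mathbb{N}_+$ be the maximal number of bits needed to store any coefficient of the input. There is an implementation of the algorithm LASSP that, for every input, computes a solution to Problem 1. With probability $1 - 1/d$, this implementation runs in time $O(d(\gamma + \log d))$.
   Context: Notation: $[d] = \{1,\dots,d\}$, $\mathrm{supp}(\theta) = \{i : \theta_i \neq 0\}$, $\|\cdot\|$ is the $\ell_2$-norm. For $\Omega \subseteq [d]$ let $\mathrm{sep}(\Omega) = \min_{i \neq j \in \Omega}|i-j|$. Let $\mathbb{M}_\Delta = \{\Omega \subseteq [d] : \mathrm{sep}(\Omega) \ge \Delta\}$ and $\mathbb{M}_{k,\Delta} = \{\Omega \in \mathbb{M}_\Delta : |\Omega| = k\}$. Problem 1: given $x \in \mathbb{R}^d$, find $\hat x \in \arg\min_{x' \in \mathbb{R}^d : \mathrm{supp}(x') \in \mathbb{M}_{k,\Delta}} \|x - x'\|$. Equivalently, with $c_i = x_i^2$, find $\hat S \in \arg\max_{S \in \mathbb{M}_{k,\Delta}} \sum_{i\in S} c_i$ and set $\hat x$ equal to $x$ on $\hat S$ and $0$ elsewhere. Since the coefficients have finite bit precision and the maximizer is invariant under scaling by a positive integer, $c$ is taken to be in $\mathbb{Z}^d$. For $\lambda \in \mathbb{R}$ and $\tilde c \in \mathbb{R}^d$, $\mathrm{ProjLagr}(\lambda,\tilde c) := \arg\max_{S \in \mathbb{M}_\Delta} \left(\sum_{i\in S}\tilde c_i + \lambda(k -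 |S|)\right)$ (the set of maximizers; its optimal value is the corresponding maximum). Algorithm LASSP (input $c \in \mathbb{Z}^d$, $k \in \mathbb{N}_+$): repeat: (1) choose $X \in \mathbb{Z}^d$ with the $X_i$ independent and uniform on $\{0,\dots,d^3-1\}$; (2) set $\tilde c := d^4 c + X$; (3) let $\hat\lambda$ be an integer $\lambda \in \mathbb{Z}$ minimizing the optimal value of $\mathrm{ProjLagr}(\lambda,\tilde c)$, taking the largest such $\lambda$ in case of ties; (4) choose $\hat S \in \mathrm{ProjLagr}(\hat\lambda - \tfrac{1}{d+1}, \tilde c)$; until $|\hat S| = k$; return $\hat S$.
   Formalization: Assumes some Δ-separated set of size k exists; optimality among vectors with support exactly in M_{k,Δ} is claimed only if x is nonzero on the returned set (else no minimizer need exist); otherwise the argmax form and optimality over supports contained in such a set are proved. *)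

theory Defs
  imports "HOL-Probability.Probability"
begin

section \<open>Separated sparsity\<close>

text \<open>Vectors of dimension \<open>d\<close> are functions on \<open>nat\<close>, of which only the entries with index in
  \<open>{1..d}\<close> matter.\<close>

definition supp :: "nat \<Rightarrow> (nat \<Rightarrow> real) \<Rightarrow> nat set" where
  "supp d x = {i \<in> {1..d}. x i \<noteq> 0}"

text \<open>The minimum over no pairs is \<open>\<infinity>\<close>, so sets with at most one element are separated for
  every \<open>\<Delta>\<close>.\<close>

definition sep :: "nat set \<Rightarrow> enat" where
  "sep \<Omega> = (INF (i, j) \<in> {(i, j). i \<in> \<Omega> \<and> j \<in> \<Omega> \<and> i \<noteq> j}. enat (nat \<bar>int i - int j\<bar>))"

definition separated :: "nat \<Rightarrow> nat \<Rightarrow> nat set set" where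
  "separated d \<Delta> = {\<Omega>. \<Omega> \<subseteq> {1..d} \<and> sep \<Omega> \<ge> enat \<Delta>}"

definition sparse_separated :: "nat \<Rightarrow> nat \<Rightarrow> nat \<Rightarrow> nat set set" where
  "sparse_separated d k \<Delta> = {\<Omega> \<in> separated d \<Delta>. card \<Omega> = k}"

definition projection_onto ::
    "nat \<Rightarrow> (nat \<Rightarrow> real) set \<Rightarrow> (nat \<Rightarrow> real) \<Rightarrow> (nat \<Rightarrow> real) \<Rightarrow> bool" where
  "projection_onto d F x xh \<longleftrightarrow> is_arg_min (\<lambda>x'. L2_set (\<lambda>i. x i - x' i) {1..d}) (\<lambda>x'. x' \<in> F) xh"

text \<open>The set of vectors whose support is exactly a member of \<open>sparse_separated d k \<Delta>\<close> is not closed: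
  if \<open>x\<close> has zero entries, the distance to it need not be attained. Its closure
  \<open>sparse_separated_vectors\<close> allows supports contained in such a set; this is the feasible set for
  which minimizing the distance is equivalent to maximizing the sum of \<open>(x i)\<^sup>2\<close> over \<open>S\<close>.\<close>

definition exact_sparse_separated_vectors :: "nat \<Rightarrow> nat \<Rightarrow> nat \<Rightarrow> (nat \<Rightarrow> real) set" where
  "exact_sparse_separated_vectors d k \<Delta> = {x'. supp d x' \<in> sparse_separated d k \<Delta>}"

definition sparse_separated_vectors :: "nat \<Rightarrow> nat \<Rightarrow> nat \<Rightarrow> (nat \<Rightarrow> real) set" where
  "sparse_separated_vectors d k \<Delta> = {x'. \<exists>\<Omega> \<in> sparse_separated d k \<Delta>. supp d x' \<subseteq> \<Omega>}"

definition solves_projection ::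
    "nat \<Rightarrow> nat \<Rightarrow> nat \<Rightarrow> (nat \<Rightarrow> real) \<Rightarrow> nat set \<Rightarrow> (nat \<Rightarrow> real) \<Rightarrow> bool" where
  "solves_projection d k \<Delta> x S xh \<longleftrightarrow>
     is_arg_max (\<lambda>S. \<Sum>i\<in>S. (x i)\<^sup>2) (\<lambda>S. S \<in> sparse_separated d k \<Delta>) S \<and>
     (\<forall>i\<in>{1..d}. xh i = (if i \<in> S then x i else 0)) \<and>
     projection_onto d (sparse_separated_vectors d k \<Delta>) x xh \<and>
     ((\<forall>i\<in>S. x i \<noteq> 0) \<longrightarrow> projection_onto d (exact_sparse_separated_vectors d k \<Delta>) x xh)"

text \<open>Coefficients are stored in fixed-point format, as integer multiples \<open>m i\<close> of a common quantum.\<close>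

definition bit_precision :: "nat \<Rightarrow> (nat \<Rightarrow> int) \<Rightarrow> nat" where
  "bit_precision d m = (MAX i\<in>{1..d}. LEAST b. 1 \<le> b \<and> \<bar>m i\<bar> < 2 ^ b)"


section \<open>The algorithm LASSP\<close>

definition lagr_obj :: "nat \<Rightarrow> real \<Rightarrow> (nat \<Rightarrow> real) \<Rightarrow> nat set \<Rightarrow> real" where
  "lagr_obj k lam ct S = (\<Sum>i\<in>S. ct i) + lam * (real k - real (card S))"

definition ProjLagr :: "nat \<Rightarrow> nat \<Rightarrow> nat \<Rightarrow> real \<Rightarrow> (nat \<Rightarrow> real) \<Rightarrow> nat set set" where
  "ProjLagr d k \<Delta> lam ct = {S. is_arg_max (lagr_obj k lam ct) (\<lambda>S. S \<in> separated d \<Delta>) S}"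

definition ProjLagr_value :: "nat \<Rightarrow> nat \<Rightarrow> nat \<Rightarrow> real \<Rightarrow> (nat \<Rightarrow> real) \<Rightarrow> real" where
  "ProjLagr_value d k \<Delta> lam ct = (MAX S\<in>separated d \<Delta>. lagr_obj k lam ct S)"

definition is_lambda_hat :: "nat \<Rightarrow> nat \<Rightarrow> nat \<Rightarrow> (nat \<Rightarrow> real) \<Rightarrow> int \<Rightarrow> bool" where
  "is_lambda_hat d k \<Delta> ct l \<longleftrightarrow>
     is_arg_max (\<lambda>l. l)
       (is_arg_min (\<lambda>l. ProjLagr_value d k \<Delta> (real_of_int l) ct) (\<lambda>_. True)) l"

definition perturb :: "nat \<Rightarrow> (nat \<Rightarrow> int) \<Rightarrow> (nat \<Rightarrow> int) \<Rightarrow> nat \<Rightarrow> real" where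
  "perturb d c X i = real_of_int (int d ^ 4 * c i + X i)"

definition lassp_round ::
    "nat \<Rightarrow> nat \<Rightarrow> nat \<Rightarrow> (nat \<Rightarrow> int) \<Rightarrow> (nat \<Rightarrow> int) \<Rightarrow> nat set \<Rightarrow> bool" where
  "lassp_round d k \<Delta> c X S \<longleftrightarrow>
     (\<forall>i\<in>{1..d}. X i \<in> {0..<int d ^ 3}) \<and>
     (\<exists>l. is_lambda_hat d k \<Delta> (perturb d c X) l \<and>
          S \<in> ProjLagr d k \<Delta> (real_of_int l - 1 / (real d + 1)) (perturb d c X))"

text \<open>\<open>lassp_run d k \<Delta> c Xs S\<close>: if the successive rounds sample the vectors \<open>Xs\<close>, then LASSP may stop
  after exactly these rounds and return \<open>S\<close>. The only nondeterminism left is the choice among the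
  maximizers in each round.\<close>

inductive lassp_run ::
    "nat \<Rightarrow> nat \<Rightarrow> nat \<Rightarrow> (nat \<Rightarrow> int) \<Rightarrow> (nat \<Rightarrow> int) list \<Rightarrow> nat set \<Rightarrow> bool"
  for d k \<Delta> c where
  accept: "lassp_round d k \<Delta> c X S \<Longrightarrow> card S = k \<Longrightarrow> lassp_run d k \<Delta> c [X] S"
| retry: "lassp_round d k \<Delta> c X S' \<Longrightarrow> card S' \<noteq> k \<Longrightarrow> lassp_run d k \<Delta> c Xs S
           \<Longrightarrow> lassp_run d k \<Delta> c (X # Xs) S"


section \<open>Randomized unit-cost RAM programs\<close>

text \<open>A store consists of named integer arrays; the scalar variable \<open>x\<close> is the cell \<open>0\<close> of the
  array \<open>x\<close>.\<close>

type_synonym vname = string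
type_synonym store = "vname \<Rightarrow> int \<Rightarrow> int"

datatype aexp =
    N int | Load vname aexp
  | Plus aexp aexp | Minus aexp aexp | Times aexp aexp | Div aexp aexp

datatype bexp = Less aexp aexp | Neg bexp | And bexp bexp

primrec aval :: "aexp \<Rightarrow> store \<Rightarrow> int" where
  "aval (N n) s = n"
| "aval (Load x a) s = s x (aval a s)"
| "aval (Plus a b) s = aval a s + aval b s"
| "aval (Minus a b) s = aval a s - aval b s"
| "aval (Times a b) s = aval a s * aval b s"
| "aval (Div a b) s = aval a s div aval b s"

primrec bval :: "bexp \<Rightarrow> store \<Rightarrow> bool" where
  "bval (Less a b) s \<longleftrightarrow> aval a s < aval b s"
| "bval (Neg b) s \<longleftrightarrow> \<not> bval b s"
| "bval (And a b) s \<longleftrightarrow> bval a s \<and> bval b s"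

text \<open>\<open>Assign x a e\<close> is \<open>x[a] := e\<close>; \<open>Rand x a e\<close> stores into \<open>x[a]\<close> a fresh uniform sample
  from \<open>{0..<e}\<close>.\<close>

datatype com =
    SKIP
  | Assign vname aexp aexp
  | Rand vname aexp aexp
  | Seq com com
  | IF bexp com com
  | WHILE bexp com

text \<open>A configuration consists of the commands still to be executed, the store, and the history of
  all random samples as pairs (range, value). The history is not accessible to the program.\<close>

type_synonym config = "com list \<times> store \<times> (int \<times> int) list"

definition upd :: "store \<Rightarrow> vname \<Rightarrow> int \<Rightarrow> int \<Rightarrow> store" where
  "upd s x i v = s(x := (s x)(i := v))"

fun step :: "config \<Rightarrow> config pmf" where
  "step ([], s, h) = return_pmf ([], s, h)"
| "step (SKIP # K, s, h) = return_pmf (K, s, h)"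
| "step (Assign x a e # K, s, h) = return_pmf (K, upd s x (aval a s) (aval e s), h)"
| "step (Rand x a e # K, s, h) =
     (if aval e s > 0
      then map_pmf (\<lambda>v. (K, upd s x (aval a s) v, h @ [(aval e s, v)])) (pmf_of_set {0..<aval e s})
      else return_pmf (Rand x a e # K, s, h))"
| "step (Seq p q # K, s, h) = return_pmf (p # q # K, s, h)"
| "step (IF b p q # K, s, h) = return_pmf ((if bval b s then p else q) # K, s, h)"
| "step (WHILE b p # K, s, h) = return_pmf (if bval b s then p # WHILE b p # K else K, s, h)"

text \<open>The distribution of the configuration after \<open>n\<close> time steps. Halted configurations are those
  with no command left; they are absorbing.\<close>

primrec run :: "nat \<Rightarrow> config \<Rightarrow> config pmf" where
  "run 0 cfg = return_pmf cfg"
| "run (Suc n) cfg = bind_pmf (run n cfg) step"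

definition halted :: "config set" where
  "halted = {(K, s, h). K = []}"

definition init_store :: "nat \<Rightarrow> nat \<Rightarrow> nat \<Rightarrow> (nat \<Rightarrow> int) \<Rightarrow> store" where
  "init_store d k \<Delta> m = (\<lambda>v i.
     if v = ''d'' \<and> i = 0 then int d
     else if v = ''k'' \<and> i = 0 then int k
     else if v = ''Delta'' \<and> i = 0 then int \<Delta>
     else if v = ''x'' \<and> i \<in> {1..int d} then m (nat i)
     else 0)"

definition init_config :: "com \<Rightarrow> nat \<Rightarrow> nat \<Rightarrow> nat \<Rightarrow> (nat \<Rightarrow> int) \<Rightarrow> config" where
  "init_config P d k \<Delta> m = ([P], init_store d k \<Delta> m, [])"

definition output_set :: "nat \<Rightarrow> store \<Rightarrow> nat set" where
  "output_set d s = {i \<in> {1..d}. s ''S'' (int i) \<noteq> 0}"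

definition output_vec :: "store \<Rightarrow> nat \<Rightarrow> int" where
  "output_vec s i = s ''xhat'' (int i)"

text \<open>Unit cost per command is justified only if numbers fit into a constant number of machine words
  of \<open>O(\<gamma> + log d)\<close> bits, that is, have absolute value at most \<open>(2 ^ \<gamma> * d) ^ B\<close>; the
  input \<open>\<Delta>\<close> may exceed this. Bounding the stored numbers suffices, because the expressions of
  a fixed program have constant size.\<close>

definition word_bounded :: "nat \<Rightarrow> nat \<Rightarrow> nat \<Rightarrow> nat \<Rightarrow> store \<Rightarrow> bool" where
  "word_bounded B d \<Delta> \<gamma> s \<longleftrightarrow> (\<forall>v i. \<bar>s v i\<bar> \<le> max (int \<Delta>) ((2 ^ \<gamma> * int d) ^ B))"

text \<open>The history of a run of LASSP that samples the vectors \<open>Xs\<close>, each entry uniformly from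
  \<open>{0..<d ^ 3}\<close>.\<close>

definition lassp_history :: "nat \<Rightarrow> (nat \<Rightarrow> int) list \<Rightarrow> (int \<times> int) list" where
  "lassp_history d Xs = concat (map (\<lambda>X. map (\<lambda>i. (int d ^ 3, X i)) [1..<Suc d]) Xs)"

text \<open>Every halting execution of the program is an execution of LASSP on the same random samples,
  with input \<open>c i = (m i)\<^sup>2\<close>, and returns the set that LASSP returns.\<close>

definition implements_LASSP :: "com \<Rightarrow> nat \<Rightarrow> nat \<Rightarrow> nat \<Rightarrow> (nat \<Rightarrow> int) \<Rightarrow> bool" where
  "implements_LASSP P d k \<Delta> m \<longleftrightarrow>
     (\<forall>n s h. ([], s, h) \<in> set_pmf (run n (init_config P d k \<Delta> m)) \<longrightarrow>
        (\<exists>Xs. h = lassp_history d Xs \<and> lassp_run d k \<Delta> (\<lambda>i. (m i)\<^sup>2) Xs (output_set d s)))"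

end

theory Submission
  imports Defs "HOL-Probability.Product_PMF"
begin

text \<open>
  For weights \<open>w\<close> let \<open>f j\<close> be the maximum weight of a separated set of size \<open>j\<close>. The function \<open>f\<close> is
  concave: given separated sets \<open>p\<^sub>1 < \<dots> < p\<^sub>a\<close> and \<open>q\<^sub>1 < \<dots> < q\<^sub>b\<close> with \<open>a + 2 \<le> b\<close>, cut both at the first
  index \<open>i\<close> where \<open>q\<^sub>i\<^sub>+\<^sub>1\<close> precedes \<open>p\<^sub>i\<^sub>+\<^sub>1\<close> by at least \<open>\<Delta>\<close> and exchange the tails; this yields separated sets of
  sizes \<open>a + 1\<close> and \<open>b - 1\<close> with the same total weight. Hence the multiplier chosen by LASSP is
  \<open>f k - f (k - 1)\<close>, and a round can fail only if \<open>f (k + 1) - f k = f k - f (k - 1)\<close>; the exchange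
  then produces two different maximizers of size \<open>k\<close>. By the isolation lemma this has probability at
  most \<open>d / d\<^sup>3\<close>. The perturbation is too small to reorder sets of different original weight, so an
  accepted set is optimal.

  The value of the relaxation is computed, scaled by \<open>d + 1\<close> to keep it integral, by a dynamic program
  in \<open>O(d)\<close> steps. The multiplier is the least \<open>l\<close> at which this convex function increases from \<open>l\<close> to
  \<open>l + 1\<close>, which is found by binary search over a range of \<open>O(\<gamma> + log d)\<close> bits.
\<close>

section \<open>Time-bounded weakest preconditions\<close>


text \<open>No multiplier alone singles out size \<open>k\<close>: at \<open>f k - f (k - 1)\<close>
  the sizes \<open>k - 1\<close> and \<open>k\<close> tie. The shift by \<open>1 / (d + 1)\<close>
  puts sizes below \<open>k\<close> strictly behind, and its total effect on a set of at most
  \<open>d\<close> elements stays below 1. As all weights are integers, it can reach past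
  \<open>k\<close> only if the next increment is equal too. The range \<open>d ^ 3\<close> beats the
  union bound over \<open>d\<close> coordinates, and the factor \<open>d ^ 4\<close> exceeds the sum
  of \<open>d\<close> samples. On the program side, word size and output are claims about every
  reachable configuration, while the running time is a claim about a distribution. Randomness is
  confined to \<open>sample_loop\<close>, whose duration does not depend on the samples. Everything
  else is deterministic and is handled by a calculus with upper time bounds that also demands the
  word bound at every intermediate step. Rounds last differently long on different samples, so lower
  bounds on the halting probability are chained by monotonicity in time. A single round already
  yields \<open>1 - 1 / d\<close>; further rounds serve the convergence to 1.\<close>

lemma run_add: "run (a + b) cfg = bind_pmf (run a cfg) (run b)"
  by (induction b) (simp_all add: bind_return_pmf' bind_assoc_pmf)

lemma run_halted: "run n ([], s, h) = return_pmf ([], s, h)"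
  by (induction n) (simp_all add: bind_return_pmf)

lemma prob_bind_pmf:
  "measure_pmf.prob (bind_pmf M f) A = measure_pmf.expectation M (\<lambda>x. measure_pmf.prob (f x) A)"
proof -
  have "ennreal (measure_pmf.prob (bind_pmf M f) A) =
      (\<integral>\<^sup>+x. ennreal (measure_pmf.prob (f x) A) \<partial>measure_pmf M)"
    by (simp flip: measure_pmf.emeasure_eq_measure)
  also have "\<dots> = ennreal (measure_pmf.expectation M (\<lambda>x. measure_pmf.prob (f x) A))"
    by (intro nn_integral_eq_integral measure_pmf.integrable_const_bound[where B = 1]) auto
  finally show ?thesis by (subst (asm) ennreal_inj) (auto intro!: integral_nonneg_AE)
qed

definition safe :: "(config \<Rightarrow> bool) \<Rightarrow> nat \<Rightarrow> config \<Rightarrow> bool" where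
  "safe G n cfg \<longleftrightarrow> (\<forall>t\<le>n. \<forall>c\<in>set_pmf (run t cfg). G c)"

definition halt_prob :: "nat \<Rightarrow> config \<Rightarrow> real" where
  "halt_prob n cfg = measure_pmf.prob (run n cfg) halted"

text \<open>A phase that lasts exactly \<open>T\<close> steps on every random branch. The
  configurations at time \<open>T\<close> are left to the next phase, and
  \<open>K \<noteq> []\<close> records that no branch halts inside, so that claims about outputs
  concern phase ends only.\<close>

definition segment :: "(store \<Rightarrow> bool) \<Rightarrow> nat \<Rightarrow> config \<Rightarrow> config pmf \<Rightarrow> bool" where
  "segment W T cfg M \<longleftrightarrow> run T cfg = M \<and>
     (\<forall>t<T. \<forall>(K, s, h)\<in>set_pmf (run t cfg). W s \<and> K \<noteq> [])"

lemma segment_step: "step (p # K, s, h) = M \<Longrightarrow> W s \<Longrightarrow> segment W 1 (p # K, s, h) M"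
  by (simp add: segment_def bind_return_pmf)

text \<open>Time is global in \<open>run\<close>, so the second phase has one length
  \<open>T'\<close> for all outcomes of the first. Durations that depend on the outcome are absorbed
  later by monotonicity of \<open>safe\<close> and \<open>halt_prob\<close>.\<close>

lemma segment_trans:
  assumes 1: "segment W T cfg M" and 2: "\<And>c. c \<in> set_pmf M \<Longrightarrow> segment W T' c (M' c)"
  shows "segment W (T + T') cfg (bind_pmf M M')"
proof -
  have "run (T + T') cfg = bind_pmf M M'"
    unfolding run_add using 1 2 by (auto simp: segment_def intro!: bind_pmf_cong)
  moreover have "\<forall>(K, s, h)\<in>set_pmf (run t cfg). W s \<and> K \<noteq> []" if t: "t < T + T'" for t
  proof (cases "t < T")
    case True
    then show ?thesis using 1 by (auto simp: segment_def)
  next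
    case False
    then obtain u where u: "t = T + u" "u < T'" using t
      by (metis add_less_cancel_left le_add_diff_inverse not_less)
    show ?thesis
      unfolding u(1) run_add using 1 2 u(2) by (auto simp: segment_def)
  qed
  ultimately show ?thesis by (simp add: segment_def)
qed

lemma segment_trans_det:
  assumes "segment W T cfg (return_pmf c)" "segment W T' c M"
  shows "segment W (T + T') cfg M"
  using segment_trans[OF assms(1), of T' "\<lambda>_. M"] assms(2) by (simp add: bind_return_pmf)

lemma safe_mono: "safe G n cfg \<Longrightarrow> n' \<le> n \<Longrightarrow> safe G n' cfg"
  unfolding safe_def by (meson order_trans)

lemma safe_segment:
  assumes 1: "segment W T cfg M" and 2: "\<And>c. c \<in> set_pmf M \<Longrightarrow> safe G n c"
    and G: "\<And>K s h. W s \<Longrightarrow> K \<noteq> [] \<Longrightarrow> G (K, s, h)"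
  shows "safe G (T + n) cfg"
  unfolding safe_def
proof (intro allI impI)
  fix t assume t: "t \<le> T + n"
  show "\<forall>c\<in>set_pmf (run t cfg). G c"
  proof (cases "t < T")
    case True
    then show ?thesis using 1 G by (fastforce simp: segment_def)
  next
    case False
    then obtain u where u: "t = T + u" "u \<le> n" using t
      by (metis add_le_cancel_left le_add_diff_inverse not_less)
    show ?thesis
      unfolding u(1) run_add using 1 2 u(2) by (auto simp: segment_def safe_def)
  qed
qed

text \<open>The prefix only adds steps that satisfy \<open>G\<close> anyway, so the horizon
  \<open>n\<close> is kept whatever the length of the prefix.\<close>

lemma safe_segment_det:
  assumes "segment W T cfg (return_pmf c)" "safe G n c"
    and "\<And>K s h. W s \<Longrightarrow> K \<noteq> [] \<Longrightarrow> G (K, s, h)"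
  shows "safe G n cfg"
  using safe_segment[OF assms(1), of G n] assms(2,3) by (auto intro: safe_mono)

lemma safe_halted: "G ([], s, h) \<Longrightarrow> safe G n ([], s, h)"
  by (auto simp: safe_def run_halted)

lemma halt_prob_segment:
  assumes "segment W T cfg M"
  shows "halt_prob (T + n) cfg = measure_pmf.expectation M (halt_prob n)"
proof -
  have "run (T + n) cfg = bind_pmf M (run n)"
    using assms by (simp add: run_add segment_def)
  then show ?thesis
    by (simp add: halt_prob_def[abs_def] prob_bind_pmf)
qed

lemma halt_prob_segment_det:
  "segment W T cfg (return_pmf c) \<Longrightarrow> halt_prob (T + n) cfg = halt_prob n c"
  by (simp add: halt_prob_segment)

lemma halt_prob_halted: "halt_prob n ([], s, h) = 1"
  by (simp add: halt_prob_def run_halted halted_def)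

lemma halt_prob_le_1: "halt_prob n cfg \<le> 1" and halt_prob_nonneg: "0 \<le> halt_prob n cfg"
  by (auto simp: halt_prob_def)

text \<open>Halted configurations are fixed points of \<open>step\<close>, so halted mass never
  leaves.\<close>

lemma halt_prob_mono:
  assumes "n \<le> n'"
  shows "halt_prob n cfg \<le> halt_prob n' cfg"
proof -
  have "halt_prob n cfg \<le> halt_prob (Suc n) cfg" for n
  proof -
    have "halt_prob n cfg = measure_pmf.expectation (run n cfg) (indicator halted)"
      by (simp add: halt_prob_def)
    also have "\<dots> \<le> measure_pmf.expectation (run n cfg) (\<lambda>c. measure_pmf.prob (step c) halted)"
    proof (intro integral_mono measure_pmf.integrable_const_bound[where B=1])
      fix c show "indicator halted c \<le> measure_pmf.prob (step c) halted"
        by (cases c) (auto simp: halted_def indicator_def)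
    qed (auto simp: indicator_def)
    also have "\<dots> = halt_prob (Suc n) cfg"
      by (simp add: halt_prob_def[abs_def] prob_bind_pmf)
    finally show ?thesis .
  qed
  then show ?thesis using assms by (rule lift_Suc_mono_le)
qed

text \<open>Total correctness for executions without sampling: the result is a point mass.
  Continuation \<open>K\<close> and history \<open>h\<close> are arbitrary, which makes the
  statements composable. \<open>W\<close> is assumed at entry and guaranteed at all intermediate
  steps and at exit; \<open>T\<close> is an upper bound because the duration may depend on the
  store.\<close>

definition wp :: "(store \<Rightarrow> bool) \<Rightarrow> com \<Rightarrow> nat \<Rightarrow> (store \<Rightarrow> bool) \<Rightarrow> store \<Rightarrow> bool" where
  "wp W p T Q s \<longleftrightarrow> (W s \<longrightarrow> (\<forall>K h. \<exists>n\<le>T. \<exists>s'.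
      segment W n (p # K, s, h) (return_pmf (K, s', h)) \<and> W s' \<and> Q s'))"

lemma wpD:
  assumes "wp W p T Q s" "W s"
  shows "\<exists>n\<le>T. \<exists>s'. segment W n (p # K, s, h) (return_pmf (K, s', h)) \<and> W s' \<and> Q s'"
  using assms unfolding wp_def by blast

lemma wpE:
  assumes "wp W p T Q s" "W s"
  obtains n s' where "n \<le> T" "segment W n (p # K, s, h) (return_pmf (K, s', h))" "W s'" "Q s'"
  using wpD[OF assms] by blast

lemma wp_mono: "wp W p T Q s \<Longrightarrow> T \<le> T' \<Longrightarrow> (\<And>s'. Q s' \<Longrightarrow> Q' s') \<Longrightarrow> wp W p T' Q' s"
  unfolding wp_def by (meson order_trans)

lemma wp_skip: "1 \<le> T \<Longrightarrow> Q s \<Longrightarrow> wp W SKIP T Q s"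
  unfolding wp_def using segment_step[of SKIP] by (metis step.simps(2))

lemma wp_assign:
  assumes "1 \<le> T" "W s \<Longrightarrow> W (upd s x (aval a s) (aval e s))" "Q (upd s x (aval a s) (aval e s))"
  shows "wp W (Assign x a e) T Q s"
  unfolding wp_def using assms segment_step[of "Assign x a e"] by (metis step.simps(3))

text \<open>The budget \<open>T - T1 - 1\<close> reserves one step for unfolding \<open>Seq\<close>
  itself.\<close>

lemma wp_seq:
  fixes T1 :: nat
  assumes "wp W p T1 Q1 s" "\<And>s'. Q1 s' \<Longrightarrow> wp W q (T - T1 - 1) Q s'" "T1 + 1 \<le> T"
  shows "wp W (Seq p q) T Q s"
  unfolding wp_def
proof (intro impI allI)
  fix K h assume W: "W s"
  have 0: "segment W 1 (Seq p q # K, s, h) (return_pmf (p # q # K, s, h))"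
    using W by (intro segment_step) auto
  obtain n s' where 1: "n \<le> T1" "segment W n (p # q # K, s, h) (return_pmf (q # K, s', h))"
    "W s'" "Q1 s'" using assms(1) W by (rule wpE)
  obtain n' s'' where 2: "n' \<le> T - T1 - 1" "segment W n' (q # K, s', h) (return_pmf (K, s'', h))"
    "W s''" "Q s''" using assms(2)[OF 1(4)] 1(3) by (rule wpE)
  have "segment W (1 + n + n') (Seq p q # K, s, h) (return_pmf (K, s'', h))"
    using 0 1(2) 2(2) by (metis segment_trans_det)
  moreover have "1 + n + n' \<le> T" using 1(1) 2(1) assms(3) by linarith
  ultimately show "\<exists>n\<le>T. \<exists>s'. segment W n (Seq p q # K, s, h) (return_pmf (K, s', h)) \<and> W s' \<and> Q s'"
    using 2 by blast
qed

lemma wp_assign_seq: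
  assumes "2 \<le> T" "W s \<Longrightarrow> W (upd s x (aval a s) (aval e s))"
    "wp W q (T - 2) Q (upd s x (aval a s) (aval e s))"
  shows "wp W (Seq (Assign x a e) q) T Q s"
proof (rule wp_seq)
  show "wp W (Assign x a e) 1 (\<lambda>s'. s' = upd s x (aval a s) (aval e s)) s"
    using assms by (intro wp_assign) auto
qed (use assms in \<open>auto simp: numeral_2_eq_2\<close>)

lemma wp_if:
  assumes "1 \<le> T" "bval b s \<Longrightarrow> wp W p (T - 1) Q s" "\<not> bval b s \<Longrightarrow> wp W q (T - 1) Q s"
  shows "wp W (IF b p q) T Q s"
  unfolding wp_def
proof (intro impI allI)
  fix K h assume W: "W s"
  let ?r = "if bval b s then p else q"
  have 0: "segment W 1 (IF b p q # K, s, h) (return_pmf (?r # K, s, h))"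
    using W by (intro segment_step) auto
  have "wp W ?r (T - 1) Q s" using assms by auto
  then obtain n s' where 1: "n \<le> T - 1" "segment W n (?r # K, s, h) (return_pmf (K, s', h))"
    "W s'" "Q s'" using W by (rule wpE)
  have "segment W (1 + n) (IF b p q # K, s, h) (return_pmf (K, s', h))"
    using 0 1(2) by (rule segment_trans_det)
  moreover have "1 + n \<le> T" using 1(1) assms(1) by linarith
  ultimately show "\<exists>n\<le>T. \<exists>s'. segment W n (IF b p q # K, s, h) (return_pmf (K, s', h)) \<and> W s' \<and> Q s'"
    using 1 by blast
qed

lemma wp_while_exit:
  assumes "1 \<le> T" "\<not> bval b s" "Q s"
  shows "wp W (WHILE b p) T Q s"
  unfolding wp_def
proof (intro impI allI)
  fix K h assume "W s"
  then have "segment W 1 (WHILE b p # K, s, h) (return_pmf (K, s, h))"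
    using assms by (intro segment_step) auto
  then show "\<exists>n\<le>T. \<exists>s'. segment W n (WHILE b p # K, s, h) (return_pmf (K, s', h)) \<and> W s' \<and> Q s'"
    using assms \<open>W s\<close> by blast
qed

text \<open>The index of the invariant bounds the number of remaining iterations.\<close>

lemma wp_while:
  assumes body: "\<And>j s. I (Suc j) s \<Longrightarrow> bval b s \<Longrightarrow> wp W p C (I j) s"
    and zero: "\<And>s. I 0 s \<Longrightarrow> \<not> bval b s"
    and post: "\<And>j s. I j s \<Longrightarrow> \<not> bval b s \<Longrightarrow> Q s"
    and init: "I j s" and T: "j * (C + 1) + 1 \<le> T"
  shows "wp W (WHILE b p) T Q s"
proof -
  have "wp W (WHILE b p) (j * (C + 1) + 1) Q s"
    using init
  proof (induction j arbitrary: s)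
    case (0 s)
    then show ?case
      using zero post by (intro wp_while_exit) auto
  next
    case (Suc j s)
    show ?case
    proof (cases "bval b s")
      case False
      then show ?thesis
        using Suc.prems post by (intro wp_while_exit) auto
    next
      case True
      show ?thesis unfolding wp_def
      proof (intro impI allI)
        fix K h assume W: "W s"
        have 0: "segment W 1 (WHILE b p # K, s, h) (return_pmf (p # WHILE b p # K, s, h))"
          using W True by (intro segment_step) auto
        obtain n s' where 1: "n \<le> C"
          "segment W n (p # WHILE b p # K, s, h) (return_pmf (WHILE b p # K, s', h))"
          "W s'" "I j s'" using body[OF Suc.prems True] W by (rule wpE)
        obtain n' s'' where 2: "n' \<le> j * (C + 1) + 1"
          "segment W n' (WHILE b p # K, s', h) (return_pmf (K, s'', h))"
          "W s''" "Q s''" using Suc.IH[OF 1(4)] 1(3) by (rule wpE)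
        have "segment W (1 + n + n') (WHILE b p # K, s, h) (return_pmf (K, s'', h))"
          using 0 1(2) 2(2) by (metis segment_trans_det)
        moreover have "1 + n + n' \<le> Suc j * (C + 1) + 1" using 1(1) 2(1) by simp
        ultimately show "\<exists>n\<le>Suc j * (C + 1) + 1. \<exists>s'.
            segment W n (WHILE b p # K, s, h) (return_pmf (K, s', h)) \<and> W s' \<and> Q s'"
          using 2 by blast
      qed
    qed
  qed
  then show ?thesis using T by (rule wp_mono)
qed

section \<open>Elementary properties of separated sets\<close>

text \<open>For \<open>i < j\<close> the condition \<open>\<Delta> \<le> j - i\<close> becomes
  \<open>i + (\<Delta> - 1) < j\<close>. With truncated subtraction this covers
  \<open>\<Delta> = 0\<close>, which behaves like \<open>\<Delta> = 1\<close>, and it expresses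
  order and distance by one strict relation.\<close>

lemma separated_iff:
  "S \<in> separated d \<Delta> \<longleftrightarrow> S \<subseteq> {1..d} \<and> (\<forall>i\<in>S. \<forall>j\<in>S. i < j \<longrightarrow> i + (\<Delta> - 1) < j)"
proof -
  have dist: "\<Delta> \<le> nat \<bar>int i - int j\<bar> \<longleftrightarrow> (if i < j then i + (\<Delta> - 1) < j else j + (\<Delta> - 1) < i)"
    if "i \<noteq> j" for i j
  proof (cases "i < j")
    case True
    then have "nat \<bar>int i - int j\<bar> = j - i" by simp
    then show ?thesis using True by auto
  next
    case False
    then have "nat \<bar>int i - int j\<bar> = i - j" "j < i" using that by simp_all
    then show ?thesis by auto
  qed
  have "enat \<Delta> \<le> sep S \<longleftrightarrow> (\<forall>i\<in>S. \<forall>j\<in>S. i \<noteq> j \<longrightarrow> \<Delta> \<le> nat \<bar>int i - int j\<bar>)"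
    unfolding sep_def le_INF_iff by auto
  then have "enat \<Delta> \<le> sep S \<longleftrightarrow> (\<forall>i\<in>S. \<forall>j\<in>S. i < j \<longrightarrow> i + (\<Delta> - 1) < j)"
    using dist by (metis linorder_neqE_nat nat_neq_iff)
  then show ?thesis unfolding separated_def by blast
qed

lemma finite_separated: "finite (separated d \<Delta>)"
  by (rule finite_subset[of _ "Pow {1..d}"]) (auto simp: separated_def)

lemma finite_sparse_separated: "finite (sparse_separated d k \<Delta>)"
  by (rule finite_subset[OF _ finite_separated[of d \<Delta>]]) (auto simp: sparse_separated_def)

lemma empty_separated: "{} \<in> separated d \<Delta>"
  by (simp add: separated_iff)

lemma finite_in_separated: "S \<in> separated d \<Delta> \<Longrightarrow> finite S"
  by (auto simp: separated_iff intro: finite_subset)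

lemma card_separated_le: "S \<in> separated d \<Delta> \<Longrightarrow> card S \<le> d"
  using card_mono[of "{1..d}" S] by (simp add: separated_iff)

lemma separated_subset: "S \<in> separated d \<Delta> \<Longrightarrow> T \<subseteq> S \<Longrightarrow> T \<in> separated d \<Delta>"
  by (auto simp: separated_iff subset_iff)

section \<open>Maximum-weight separated sets\<close>

text \<open>The argument \<open>e\<close> stands for \<open>\<Delta> - 1\<close>: once
  \<open>Suc i\<close> is taken, the indices up to \<open>i - e\<close> remain available, and
  truncation at 0 yields the empty prefix.\<close>

fun dp :: "(nat \<Rightarrow> int) \<Rightarrow> nat \<Rightarrow> nat \<Rightarrow> int" where
  "dp w e 0 = 0"
| "dp w e (Suc i) = max (dp w e i) (dp w e (i - e) + w (Suc i))"

text \<open>The test looks at table entries only, since the program keeps no record of its choices.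
  Equal entries mean that skipping \<open>Suc i\<close> is optimal too.\<close>

fun backtrack :: "(nat \<Rightarrow> int) \<Rightarrow> nat \<Rightarrow> nat \<Rightarrow> nat set" where
  "backtrack w e 0 = {}"
| "backtrack w e (Suc i) =
     (if dp w e i < dp w e (Suc i) then insert (Suc i) (backtrack w e (i - e)) else backtrack w e i)"

declare dp.simps(2) [simp del] backtrack.simps(2) [simp del]

text \<open>If the last index \<open>i\<close> belongs to \<open>S\<close>, separation confines the
  rest of \<open>S\<close> to the prefix of length \<open>i - 1 - (\<Delta> - 1)\<close>, which is
  the one that the recurrence consults.\<close>

lemma dp_upper:
  assumes "S \<in> separated i \<Delta>"
  shows "(\<Sum>j\<in>S. w j) \<le> dp w (\<Delta> - 1) i"
  using assms
proof (induction i arbitrary: S rule: less_induct)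
  case (less i)
  note S = less.prems[unfolded separated_iff]
  have fin: "finite S" using less.prems by (rule finite_in_separated)
  show ?case
  proof (cases i)
    case 0
    then show ?thesis using S by auto
  next
    case (Suc n)
    show ?thesis
    proof (cases "i \<in> S")
      case True
      have "j \<in> {1..n - (\<Delta> - 1)}" if "j \<in> S - {i}" for j
      proof -
        have "1 \<le> j" "j < i" using that S by force+
        moreover have "j + (\<Delta> - 1) < i" using that S True \<open>j < i\<close> by blast
        ultimately show ?thesis using Suc by auto
      qed
      then have "S - {i} \<subseteq> {1..n - (\<Delta> - 1)}" by blast
      then have "S - {i} \<in> separated (n - (\<Delta> - 1)) \<Delta>" using S unfolding separated_iff by blast
      then have "(\<Sum>j\<in>S - {i}. w j) \<le> dp w (\<Delta> - 1) (n - (\<Delta> - 1))"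
        using less.IH Suc by auto
      then show ?thesis
        using Suc by (auto simp: dp.simps(2) sum.remove[OF fin True])
    next
      case False
      then have "S \<subseteq> {1..n}" using S Suc by (auto simp: le_Suc_eq)
      then have "S \<in> separated n \<Delta>" using S by (auto simp: separated_iff)
      then have "(\<Sum>j\<in>S. w j) \<le> dp w (\<Delta> - 1) n" using less.IH Suc by auto
      then show ?thesis using Suc by (auto simp: dp.simps(2))
    qed
  qed
qed

lemma backtrack_separated: "backtrack w (\<Delta> - 1) i \<in> separated i \<Delta>"
proof (induction i rule: less_induct)
  case (less i)
  show ?case
  proof (cases i)
    case 0
    then show ?thesis by (simp add: empty_separated)
  next
    case (Suc n)
    have a: "backtrack w (\<Delta> - 1) (n - (\<Delta> - 1)) \<in> separated (n - (\<Delta> - 1)) \<Delta>"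
      and b: "backtrack w (\<Delta> - 1) n \<in> separated n \<Delta>"
      using less.IH Suc by auto
    have "insert i R \<in> separated i \<Delta>" if R: "R \<in> separated (n - (\<Delta> - 1)) \<Delta>" for R
    proof -
      have "j + (\<Delta> - 1) < i \<and> 1 \<le> j" if "j \<in> R" for j
      proof -
        have "1 \<le> j" "j \<le> n - (\<Delta> - 1)" using R that by (auto simp: separated_iff)
        then show ?thesis using Suc by auto
      qed
      then show ?thesis using R Suc by (force simp: separated_iff)
    qed
    moreover have "backtrack w (\<Delta> - 1) n \<in> separated i \<Delta>"
      using b Suc by (auto simp: separated_iff intro: order_trans)
    ultimately show ?thesis using Suc a by (simp add: backtrack.simps(2))
  qed
qed

text \<open>If the entry increases, the maximum in \<open>dp\<close> is the branch that takes the
  index; otherwise value and set are both inherited. With \<open>dp_upper\<close> this makes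
  \<open>dp\<close> the maximum and \<open>backtrack\<close> a maximizer.\<close>

lemma sum_backtrack: "(\<Sum>j\<in>backtrack w (\<Delta> - 1) i. w j) = dp w (\<Delta> - 1) i"
proof (induction i rule: less_induct)
  case (less i)
  show ?case
  proof (cases i)
    case (Suc n)
    have "backtrack w (\<Delta> - 1) (n - (\<Delta> - 1)) \<in> separated (n - (\<Delta> - 1)) \<Delta>"
      by (rule backtrack_separated)
    then have "Suc n \<notin> backtrack w (\<Delta> - 1) (n - (\<Delta> - 1))"
      "finite (backtrack w (\<Delta> - 1) (n - (\<Delta> - 1)))"
      by (auto simp: separated_iff intro: finite_subset)
    then show ?thesis
      using Suc less.IH by (auto simp: backtrack.simps(2) dp.simps(2) max_def split: if_splits)
  qed simp
qed

lemma dp_nonneg: "0 \<le> dp w e i"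
  by (induction i) (auto simp: dp.simps(2) le_max_iff_disj)

text \<open>At most \<open>i\<close> elements of weight at most \<open>M\<close> are selected. This
  keeps the table within the word size.\<close>

lemma dp_le:
  assumes "\<And>j. j \<in> {1..i} \<Longrightarrow> w j \<le> M" "0 \<le> M"
  shows "dp w e i \<le> int i * M"
  using assms(1)
proof (induction i rule: less_induct)
  case (less i)
  show ?case
  proof (cases i)
    case (Suc n)
    have "dp w e n \<le> int n * M" using less Suc by auto
    moreover have "dp w e (n - e) \<le> int (n - e) * M" using less Suc by auto
    moreover have "int (n - e) * M \<le> int n * M" using assms(2) by (intro mult_right_mono) auto
    moreover have "w (Suc n) \<le> M" using less.prems Suc by auto
    ultimately show ?thesis using Suc assms(2) by (auto simp: dp.simps(2) algebra_simps)
  qed simp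
qed

section \<open>Concavity in the cardinality\<close>

text \<open>Both junctions must keep the gap. In \<open>a\<close>, the step from
  \<open>q ! i\<close> to \<open>p ! i\<close> is fine by the choice of \<open>i\<close>. In
  \<open>b\<close>, minimality gives \<open>p ! (i - 1) \<le> q ! (i - 1) + e\<close>, which is
  below \<open>q ! i\<close>, and the omitted \<open>q ! i\<close> precedes
  \<open>q ! (i + 1)\<close> by more than \<open>e\<close>. Multisets are used because
  \<open>p\<close> and \<open>q\<close> may share elements.\<close>

lemma exchange_lists:
  fixes p q :: "nat list"
  assumes p: "sorted_wrt (\<lambda>x y. x + e < y) p" and q: "sorted_wrt (\<lambda>x y. x + e < y) q"
    and len: "length p + 2 \<le> length q"
  obtains a b where "sorted_wrt (\<lambda>x y. x + e < y) a" "sorted_wrt (\<lambda>x y. x + e < y) b"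
    "length a = length p + 1" "length b + 1 = length q" "mset a + mset b = mset p + mset q"
proof -
  \<comment> \<open>The first disjunct guarantees existence. If no crossing occurs,
    \<open>i = length p\<close>: then \<open>a\<close> is a prefix of \<open>q\<close>, and
    \<open>b\<close> extends all of \<open>p\<close> by the end of \<open>q\<close>.\<close>
  define P where "P i \<longleftrightarrow> i = length p \<or> q ! i + e < p ! i" for i
  define i where "i = (LEAST i. P i)"
  have "P i" unfolding i_def by (rule LeastI[of _ "length p"]) (simp add: P_def)
  have i_le: "i \<le> length p" unfolding i_def by (rule Least_le) (simp add: P_def)
  have before: "p ! j \<le> q ! j + e" if "j < i" for j
    using not_less_Least[of j P] that by (auto simp: P_def i_def)
  have pn: "p ! x + e < p ! y" if "x < y" "y < length p" for x y
    using p that by (simp add: sorted_wrt_iff_nth_less)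
  have qn: "q ! x + e < q ! y" if "x < y" "y < length q" for x y
    using q that by (simp add: sorted_wrt_iff_nth_less)
  let ?a = "take (i + 1) q @ drop i p" and ?b = "take i p @ drop (i + 1) q"
  have 1: "x + e < y" if xy: "x \<in> set (take (i + 1) q)" "y \<in> set (drop i p)" for x y
  proof -
    obtain u where u: "u < i + 1" "u < length q" "x = q ! u"
      using xy(1) by (auto simp: in_set_conv_nth)
    obtain v where v: "v < length p - i" "y = p ! (i + v)"
      using xy(2) by (auto simp: in_set_conv_nth)
    have "q ! i + e < p ! i" using \<open>P i\<close> v i_le by (auto simp: P_def)
    moreover have "x \<le> q ! i"
      using u qn[of u i] len i_le by (cases "u = i") auto
    moreover have "p ! i \<le> y"
      using v pn[of i "i + v"] by (cases "v = 0") (auto simp: less_diff_conv add.commute)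
    ultimately show ?thesis by linarith
  qed
  have 2: "x + e < y" if xy: "x \<in> set (take i p)" "y \<in> set (drop (i + 1) q)" for x y
  proof -
    obtain u where u: "u < i" "u < length p" "x = p ! u"
      using xy(1) by (auto simp: in_set_conv_nth)
    obtain v where v: "v < length q - (i + 1)" "y = q ! (i + 1 + v)"
      using xy(2) by (auto simp: in_set_conv_nth)
    have "p ! (i - 1) \<le> q ! (i - 1) + e" using before u by auto
    moreover have "x \<le> p ! (i - 1)"
    proof (cases "u = i - 1")
      case False
      then have "p ! u + e < p ! (i - 1)" using u i_le by (intro pn) auto
      then show ?thesis using u by simp
    qed (use u in simp)
    moreover have "q ! (i - 1) + e < q ! i" using u i_le len by (intro qn) auto
    moreover have "q ! i + e < y" using v by (auto intro!: qn)
    ultimately show ?thesis by linarith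
  qed
  show ?thesis
  proof (rule that[of ?a ?b])
    show "sorted_wrt (\<lambda>x y. x + e < y) ?a" "sorted_wrt (\<lambda>x y. x + e < y) ?b"
      using 1 2 p q by (auto simp: sorted_wrt_append sorted_wrt_take sorted_wrt_drop)
    show "length ?a = length p + 1" "length ?b + 1 = length q" using i_le len by auto
    have *: "mset r = mset (take j r) + mset (drop j r)" for j and r :: "nat list"
      by (metis append_take_drop_id mset_append)
    show "mset ?a + mset ?b = mset p + mset q"
      unfolding *[of p i] *[of q "i + 1"] mset_append by (simp only: ac_simps)
  qed
qed

lemma separated_list:
  assumes "S \<in> separated d \<Delta>"
  obtains xs where "sorted_wrt (\<lambda>x y. x + (\<Delta> - 1) < y) xs" "set xs = S" "distinct xs"
proof (rule that[of "sorted_list_of_set S"])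
  have fin: "finite S" using assms by (rule finite_in_separated)
  have "x + (\<Delta> - 1) < y" if "x \<in> S" "y \<in> S" "x < y" for x y
    using assms that by (auto simp: separated_iff)
  moreover have "sorted_wrt (<) (sorted_list_of_set S)" by simp
  ultimately show "sorted_wrt (\<lambda>x y. x + (\<Delta> - 1) < y) (sorted_list_of_set S)"
    using fin sorted_wrt_mono_rel[of "sorted_list_of_set S" "(<)" "\<lambda>x y. x + (\<Delta> - 1) < y"]
    by simp
qed (use assms in \<open>auto dest: finite_in_separated\<close>)

lemma separated_of_list:
  assumes "sorted_wrt (\<lambda>x y. x + (\<Delta> - 1) < y) xs" "set xs \<subseteq> {1..d}"
  shows "set xs \<in> separated d \<Delta>" "distinct xs"
proof -
  have *: "xs ! i + (\<Delta> - 1) < xs ! j" if "i < j" "j < length xs" for i j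
    using assms(1) that by (simp add: sorted_wrt_iff_nth_less)
  then have less: "xs ! i < xs ! j" if "i < j" "j < length xs" for i j
    using that by (meson add_lessD1)
  then have "sorted_wrt (<) xs" by (simp add: sorted_wrt_iff_nth_less)
  then show "distinct xs" by (simp add: strict_sorted_iff)
  have "i + (\<Delta> - 1) < j" if ij: "i \<in> set xs" "j \<in> set xs" "i < j" for i j
  proof -
    obtain u v where uv: "u < length xs" "v < length xs" "i = xs ! u" "j = xs ! v"
      using ij by (auto simp: in_set_conv_nth)
    then have "u < v" using less[of v u] ij(3) by (cases u v rule: linorder_cases) auto
    then show ?thesis using * uv by blast
  qed
  then show "set xs \<in> separated d \<Delta>" using assms(2) by (auto simp: separated_iff)
qed

text \<open>The sum identity holds for all weights at once because it comes from a multiset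
  equation. \<open>best_tie\<close> exploits this by plugging in the indicator of a single
  index.\<close>

lemma exchange:
  assumes P: "P \<in> separated d \<Delta>" and Q: "Q \<in> separated d \<Delta>" and card: "card P + 2 \<le> card Q"
  obtains A B where "A \<in> separated d \<Delta>" "B \<in> separated d \<Delta>" "card A = card P + 1"
    "card B + 1 = card Q" "\<And>w :: nat \<Rightarrow> int. sum w A + sum w B = sum w P + sum w Q"
proof -
  obtain p where p: "sorted_wrt (\<lambda>x y. x + (\<Delta> - 1) < y) p" "set p = P" "distinct p"
    using P by (rule separated_list)
  obtain q where q: "sorted_wrt (\<lambda>x y. x + (\<Delta> - 1) < y) q" "set q = Q" "distinct q"
    using Q by (rule separated_list)
  have len: "length p = card P" "length q = card Q"
    using p q by (auto simp: distinct_card)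
  obtain a b where ab: "sorted_wrt (\<lambda>x y. x + (\<Delta> - 1) < y) a"
    "sorted_wrt (\<lambda>x y. x + (\<Delta> - 1) < y) b" "length a = length p + 1" "length b + 1 = length q"
    "mset a + mset b = mset p + mset q"
    using exchange_lists[OF p(1) q(1)] card len by auto
  have "set a \<union> set b = P \<union> Q"
    using arg_cong[OF ab(5), of set_mset] p q by simp
  then have sub: "set a \<subseteq> {1..d}" "set b \<subseteq> {1..d}" using P Q by (auto simp: separated_iff)
  have a: "set a \<in> separated d \<Delta>" "distinct a" and b: "set b \<in> separated d \<Delta>" "distinct b"
    using separated_of_list ab sub by auto
  have sum_list: "sum w (set xs) = sum_mset (image_mset w (mset xs))" if "distinct xs"
    for xs and w :: "nat \<Rightarrow> int"
    using that by (simp add: sum_list_distinct_conv_sum_set[symmetric] sum_mset_sum_list[symmetric])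
  have "sum w (set a) + sum w (set b) = sum w P + sum w Q" for w :: "nat \<Rightarrow> int"
    using sum_list[OF a(2)] sum_list[OF b(2)] sum_list[OF p(3)] sum_list[OF q(3)] p(2) q(2)
      arg_cong[OF ab(5), of "\<lambda>M. sum_mset (image_mset w M)"] by simp
  then show ?thesis
    using that[OF a(1) b(1)] a b ab len by (auto simp: distinct_card)
qed

text \<open>The function \<open>f\<close> of the overview. For a size without separated sets this is
  \<open>Max\<close> of the empty set, hence the nonemptiness hypotheses below.\<close>

definition best :: "nat \<Rightarrow> nat \<Rightarrow> (nat \<Rightarrow> int) \<Rightarrow> nat \<Rightarrow> int" where
  "best d \<Delta> w j = (MAX S\<in>sparse_separated d j \<Delta>. sum w S)"

lemma best_ge: "S \<in> sparse_separated d j \<Delta> \<Longrightarrow> sum w S \<le> best d \<Delta> w j"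
  unfolding best_def by (simp add: finite_sparse_separated)

lemma best_attained:
  assumes "sparse_separated d j \<Delta> \<noteq> {}"
  obtains S where "S \<in> sparse_separated d j \<Delta>" "sum w S = best d \<Delta> w j"
proof -
  have "best d \<Delta> w j \<in> sum w ` sparse_separated d j \<Delta>"
    unfolding best_def using assms by (intro Max_in) (auto simp: finite_sparse_separated)
  then show ?thesis using that by auto
qed

text \<open>Subsets of separated sets are separated, so the attainable sizes form an initial
  segment, on which \<open>best\<close> is meaningful.\<close>

lemma sparse_separated_nonempty_mono:
  assumes "sparse_separated d b \<Delta> \<noteq> {}" "a \<le> b"
  shows "sparse_separated d a \<Delta> \<noteq> {}"
proof -
  obtain S where "S \<in> separated d \<Delta>" "card S = b"
    using assms by (auto simp: sparse_separated_def)
  moreover then obtain T where "T \<subseteq> S" "card T = a"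
    using assms(2) by (metis obtain_subset_with_card_n)
  ultimately show ?thesis by (auto simp: sparse_separated_def intro: separated_subset)
qed

text \<open>Exchanging optimal sets of sizes \<open>j\<close> and \<open>j + 2\<close> yields two
  sets of size \<open>j + 1\<close> with the same total weight.\<close>

lemma best_concave:
  assumes "sparse_separated d (j + 2) \<Delta> \<noteq> {}"
  shows "best d \<Delta> w j + best d \<Delta> w (j + 2) \<le> 2 * best d \<Delta> w (j + 1)"
proof -
  have "sparse_separated d j \<Delta> \<noteq> {}"
    using assms by (rule sparse_separated_nonempty_mono) simp
  then obtain P where P: "P \<in> sparse_separated d j \<Delta>" "sum w P = best d \<Delta> w j"
    by (rule best_attained)
  obtain Q where Q: "Q \<in> sparse_separated d (j + 2) \<Delta>" "sum w Q = best d \<Delta> w (j + 2)"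
    using assms by (rule best_attained)
  obtain A B where AB: "A \<in> separated d \<Delta>" "B \<in> separated d \<Delta>" "card A = card P + 1"
    "card B + 1 = card Q" "\<And>w :: nat \<Rightarrow> int. sum w A + sum w B = sum w P + sum w Q"
    using exchange[of P d \<Delta> Q] P Q by (auto simp: sparse_separated_def)
  have "sum w A \<le> best d \<Delta> w (j + 1)" "sum w B \<le> best d \<Delta> w (j + 1)"
    using AB P Q by (auto intro!: best_ge simp: sparse_separated_def)
  then show ?thesis using AB(5)[of w] P Q by simp
qed

text \<open>In the equality case neither set produced by the exchange can fall short of the optimum
  for size \<open>j + 1\<close>, so both attain it. Their distinctness turns equal increments into a
  failure of isolation.\<close>

lemma best_tie:
  assumes ne: "sparse_separated d (j + 2) \<Delta> \<noteq> {}"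
    and eq: "best d \<Delta> w j + best d \<Delta> w (j + 2) = 2 * best d \<Delta> w (j + 1)"
  obtains A B where "A \<in> sparse_separated d (j + 1) \<Delta>" "B \<in> sparse_separated d (j + 1) \<Delta>" "A \<noteq> B"
    "sum w A = best d \<Delta> w (j + 1)" "sum w B = best d \<Delta> w (j + 1)"
proof -
  have "sparse_separated d j \<Delta> \<noteq> {}"
    using ne by (rule sparse_separated_nonempty_mono) simp
  then obtain P where P: "P \<in> sparse_separated d j \<Delta>" "sum w P = best d \<Delta> w j"
    by (rule best_attained)
  obtain Q where Q: "Q \<in> sparse_separated d (j + 2) \<Delta>" "sum w Q = best d \<Delta> w (j + 2)"
    using ne by (rule best_attained)
  obtain A B where AB: "A \<in> separated d \<Delta>" "B \<in> separated d \<Delta>" "card A = card P + 1"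
    "card B + 1 = card Q" "\<And>w :: nat \<Rightarrow> int. sum w A + sum w B = sum w P + sum w Q"
    using exchange[of P d \<Delta> Q] P Q by (auto simp: sparse_separated_def)
  have AB': "A \<in> sparse_separated d (j + 1) \<Delta>" "B \<in> sparse_separated d (j + 1) \<Delta>"
    using AB P Q by (auto simp: sparse_separated_def)
  have "sum w A \<le> best d \<Delta> w (j + 1)" "sum w B \<le> best d \<Delta> w (j + 1)"
    using AB' by (auto intro!: best_ge)
  then have "sum w A = best d \<Delta> w (j + 1)" "sum w B = best d \<Delta> w (j + 1)"
    using AB(5)[of w] P Q eq by auto
  moreover have "A \<noteq> B"
  proof
    assume "A = B"
    have finPQ: "finite P" "finite Q" "finite A"
      using P Q AB by (auto simp: sparse_separated_def intro: finite_in_separated)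
    have "\<not> Q \<subseteq> P"
      using P Q finPQ card_mono[of P Q] by (auto simp: sparse_separated_def)
    then obtain z where z: "z \<in> Q" "z \<notin> P" by auto
    \<comment> \<open>the weights count the multiplicity of \<open>z\<close>, which is odd in \<open>P\<close>, \<open>Q\<close> and even in \<open>A\<close>, \<open>B\<close>\<close>
    have "(\<Sum>i\<in>T. if i = z then 1 else 0) = (if z \<in> T then 1 else (0::int))" if "finite T" for T
      using that by simp
    then show False
      using AB(5)[of "\<lambda>i. if i = z then 1 else 0"] \<open>A = B\<close> z finPQ by (auto split: if_splits)
  qed
  ultimately show ?thesis using AB' that by blast
qed

lemma concave_increments:
  fixes f :: "nat \<Rightarrow> int"
  assumes "\<And>j. j + 2 \<le> K \<Longrightarrow> f j + f (j + 2) \<le> 2 * f (j + 1)" "i \<le> j" "j < K"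
  shows "f (j + 1) - f j \<le> f (i + 1) - f i"
  using assms(2,3)
proof (induction j rule: dec_induct)
  case (step n)
  then show ?case using assms(1)[of n] by auto
qed simp

text \<open>Telescoping: no later increment exceeds the first. This estimates sizes above
  \<open>k\<close>; \<open>concave_chord_lower\<close>, which bounds all increments below by the
  last one, estimates sizes below \<open>k\<close>.\<close>

lemma concave_chord_upper:
  fixes f :: "nat \<Rightarrow> int"
  assumes c: "\<And>j. j + 2 \<le> K \<Longrightarrow> f j + f (j + 2) \<le> 2 * f (j + 1)" and "i \<le> j" "j \<le> K"
  shows "f j - f i \<le> int (j - i) * (f (i + 1) - f i)"
  using assms(2,3)
proof (induction j rule: dec_induct)
  case (step n)
  have "f (n + 1) - f n \<le> f (i + 1) - f i"
    using c step by (intro concave_increments[of K f i n]) auto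
  moreover have "int (Suc n - i) = int (n - i) + 1" using step by auto
  ultimately show ?case using step by (simp add: algebra_simps)
qed simp

lemma concave_chord_lower:
  fixes f :: "nat \<Rightarrow> int"
  assumes c: "\<And>j. j + 2 \<le> K \<Longrightarrow> f j + f (j + 2) \<le> 2 * f (j + 1)" and "i \<le> j" "j < K"
  shows "int (j + 1 - i) * (f (j + 1) - f j) \<le> f (j + 1) - f i"
  using assms(2,3)
proof (induction j rule: dec_induct)
  case (step n)
  have "f (Suc n + 1) - f (Suc n) \<le> f (n + 1) - f n"
    using c step by (intro concave_increments[of K f n "Suc n"]) auto
  then have "int (n + 1 - i) * (f (Suc n + 1) - f (Suc n)) \<le> int (n + 1 - i) * (f (n + 1) - f n)"
    by (intro mult_left_mono) auto
  also have "\<dots> \<le> f (n + 1) - f i" using step by simp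
  finally have "int (n + 1 - i) * (f (Suc n + 1) - f (Suc n)) \<le> f (n + 1) - f i" .
  moreover have "int (Suc n + 1 - i) = int (n + 1 - i) + 1" using step by auto
  ultimately show ?case by (simp add: algebra_simps)
qed simp

section \<open>The Lagrangian relaxation\<close>

lemma lagr_obj_le_value: "S \<in> separated d \<Delta> \<Longrightarrow> lagr_obj k lam ct S \<le> ProjLagr_value d k \<Delta> lam ct"
  unfolding ProjLagr_value_def by (simp add: finite_separated)

lemma ProjLagr_value_attained:
  obtains S where "S \<in> separated d \<Delta>" "lagr_obj k lam ct S = ProjLagr_value d k \<Delta> lam ct"
proof -
  have "ProjLagr_value d k \<Delta> lam ct \<in> lagr_obj k lam ct ` separated d \<Delta>"
    unfolding ProjLagr_value_def using empty_separated
    by (intro Max_in) (auto simp: finite_separated)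
  then show ?thesis using that by auto
qed

lemma ProjLagr_iff:
  "S \<in> ProjLagr d k \<Delta> lam ct \<longleftrightarrow>
     S \<in> separated d \<Delta> \<and> (\<forall>T\<in>separated d \<Delta>. lagr_obj k lam ct T \<le> lagr_obj k lam ct S)"
  unfolding ProjLagr_def is_arg_max_def by (auto simp: not_less)

lemma ProjLagr_value_eqI:
  "S \<in> ProjLagr d k \<Delta> lam ct \<Longrightarrow> ProjLagr_value d k \<Delta> lam ct = lagr_obj k lam ct S"
  unfolding ProjLagr_value_def ProjLagr_iff by (intro Max_eqI) (auto simp: finite_separated)

text \<open>The value is a maximum of affine functions of \<open>lam\<close> with slopes
  \<open>k - card S\<close>. A set that is optimal at \<open>lam'\<close> after a strict increase
  has positive slope, and its line bounds the value from below further right.\<close>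

lemma value_increase_persists:
  assumes less: "ProjLagr_value d k \<Delta> lam ct < ProjLagr_value d k \<Delta> lam' ct"
    and "lam < lam'" "lam' \<le> lam''"
  shows "ProjLagr_value d k \<Delta> lam' ct \<le> ProjLagr_value d k \<Delta> lam'' ct"
proof -
  obtain S where S: "S \<in> separated d \<Delta>" "lagr_obj k lam' ct S = ProjLagr_value d k \<Delta> lam' ct"
    by (rule ProjLagr_value_attained)
  have "lagr_obj k lam ct S < lagr_obj k lam' ct S"
    using lagr_obj_le_value[OF S(1), of k lam ct] S(2) less by linarith
  then have "lam * (real k - real (card S)) < lam' * (real k - real (card S))"
    by (simp add: lagr_obj_def)
  then have "0 < real k - real (card S)"
    using \<open>lam < lam'\<close> by (metis mult_less_cancel_right_disj not_less_iff_gr_or_eq)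
  then have "lam' * (real k - real (card S)) \<le> lam'' * (real k - real (card S))"
    using \<open>lam' \<le> lam''\<close> by (intro mult_right_mono) auto
  then have "lagr_obj k lam' ct S \<le> lagr_obj k lam'' ct S"
    by (simp add: lagr_obj_def)
  then show ?thesis using S lagr_obj_le_value[OF S(1), of k lam'' ct] by linarith
qed

text \<open>The mirror image: a set that is optimal at \<open>lam'\<close> has slope at most 0 if
  the value at the larger \<open>lam\<close> is no larger, so its line does not fall towards the
  left.\<close>

lemma value_decrease_persists:
  assumes le: "ProjLagr_value d k \<Delta> lam ct \<le> ProjLagr_value d k \<Delta> lam' ct"
    and "lam' < lam" "lam'' \<le> lam'"
  shows "ProjLagr_value d k \<Delta> lam' ct \<le> ProjLagr_value d k \<Delta> lam'' ct"
proof -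
  obtain S where S: "S \<in> separated d \<Delta>" "lagr_obj k lam' ct S = ProjLagr_value d k \<Delta> lam' ct"
    by (rule ProjLagr_value_attained)
  have "lagr_obj k lam ct S \<le> lagr_obj k lam' ct S"
    using lagr_obj_le_value[OF S(1), of k lam ct] S(2) le by linarith
  then have "lam * (real k - real (card S)) \<le> lam' * (real k - real (card S))"
    by (simp add: lagr_obj_def)
  then have "real k - real (card S) \<le> 0"
    using \<open>lam' < lam\<close> by (metis mult_le_cancel_right not_less)
  then have "lam' * (real k - real (card S)) \<le> lam'' * (real k - real (card S))"
    using \<open>lam'' \<le> lam'\<close> by (intro mult_right_mono_neg) auto
  then have "lagr_obj k lam' ct S \<le> lagr_obj k lam'' ct S"
    by (simp add: lagr_obj_def)
  then show ?thesis using S lagr_obj_le_value[OF S(1), of k lam'' ct] by linarith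
qed

text \<open>By the two persistence lemmas, comparing with both neighbours is enough. The strict
  inequality on the right encodes the choice of the largest minimizer.\<close>

lemma is_lambda_hatI:
  fixes l :: int
  assumes up: "ProjLagr_value d k \<Delta> (of_int l) ct < ProjLagr_value d k \<Delta> (of_int (l + 1)) ct"
    and down: "ProjLagr_value d k \<Delta> (of_int l) ct \<le> ProjLagr_value d k \<Delta> (of_int (l - 1)) ct"
  shows "is_lambda_hat d k \<Delta> ct l"
proof -
  let ?V = "\<lambda>l. ProjLagr_value d k \<Delta> (real_of_int l) ct"
  have gt: "?V l < ?V l'" if "l < l'" for l'
    using value_increase_persists[OF up, of "of_int l'"] up that by force
  have le: "?V l \<le> ?V l'" if "l' < l" for l'
    using value_decrease_persists[OF down, of "of_int l'"] down that by force
  have min: "?V l \<le> ?V l'" for l'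
    using gt[of l'] le[of l'] by (cases l l' rule: linorder_cases) auto
  show ?thesis
    unfolding is_lambda_hat_def is_arg_max_def is_arg_min_def
    using min gt by (metis linorder_not_less)
qed

lemma is_lambda_hatD:
  assumes "is_lambda_hat d k \<Delta> ct l"
  shows "ProjLagr_value d k \<Delta> (of_int l) ct < ProjLagr_value d k \<Delta> (of_int (l + 1)) ct"
    and "ProjLagr_value d k \<Delta> (of_int l) ct \<le> ProjLagr_value d k \<Delta> (of_int (l - 1)) ct"
proof -
  let ?V = "\<lambda>l. ProjLagr_value d k \<Delta> (real_of_int l) ct"
  have min: "?V l \<le> ?V l'" for l'
    using assms by (auto simp: is_lambda_hat_def is_arg_max_def is_arg_min_def not_less)
  have max: "l' \<le> l" if "\<And>l''. ?V l' \<le> ?V l''" for l'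
    using assms that by (force simp: is_lambda_hat_def is_arg_max_def is_arg_min_def not_less)
  show "?V l \<le> ?V (l - 1)" by (rule min)
  show "?V l < ?V (l + 1)"
  proof (rule ccontr)
    assume "\<not> ?V l < ?V (l + 1)"
    then have "?V (l + 1) \<le> ?V l''" for l'' using min[of l''] by linarith
    then show False using max[of "l + 1"] by simp
  qed
qed

text \<open>At size \<open>k\<close> the multiplier term vanishes on both sides, whatever
  \<open>lam\<close> is.\<close>

lemma ProjLagr_card_eq_max:
  assumes "S \<in> ProjLagr d k \<Delta> lam ct" "card S = k" "T \<in> sparse_separated d k \<Delta>"
  shows "sum ct T \<le> sum ct S"
  using assms by (auto simp: ProjLagr_iff sparse_separated_def lagr_obj_def)

text \<open>The conditions on \<open>l\<close> pin it to \<open>f k - f (k - 1)\<close>. The lowered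
  multiplier puts every smaller size strictly behind \<open>k\<close>, while a larger size gains
  less than 1 from it. By integrality, \<open>card S > k\<close> then forces the increment after
  \<open>k\<close> to equal \<open>l\<close> as well, and \<open>best_tie\<close> applies.\<close>

lemma round_failure_tie:
  fixes w :: "nat \<Rightarrow> int"
  assumes k: "1 \<le> k" and ne: "sparse_separated d k \<Delta> \<noteq> {}"
    and lam: "is_lambda_hat d k \<Delta> (\<lambda>i. real_of_int (w i)) l"
    and S: "S \<in> ProjLagr d k \<Delta> (real_of_int l - 1 / (real d + 1)) (\<lambda>i. real_of_int (w i))"
    and card: "card S \<noteq> k"
  obtains A B where "A \<in> sparse_separated d k \<Delta>" "B \<in> sparse_separated d k \<Delta>" "A \<noteq> B"
    "sum w A = best d \<Delta> w k" "sum w B = best d \<Delta> w k"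
proof -
  define f where "f = best d \<Delta> w"
  let ?V = "\<lambda>l::int. ProjLagr_value d k \<Delta> (real_of_int l) (\<lambda>i. real_of_int (w i))"
  have obj: "lagr_obj k lam (\<lambda>i. real_of_int (w i)) T
      = real_of_int (sum w T) + lam * (real k - real (card T))" for lam T
    by (simp add: lagr_obj_def)
  have V_ge: "f j + l * (int k - int j) \<le> ?V l" if "sparse_separated d j \<Delta> \<noteq> {}" for j and l :: int
  proof -
    obtain T where "T \<in> sparse_separated d j \<Delta>" "sum w T = f j"
      unfolding f_def using \<open>sparse_separated d j \<Delta> \<noteq> {}\<close> by (rule best_attained)
    then show ?thesis
      using lagr_obj_le_value[of T d \<Delta> k "real_of_int l" "\<lambda>i. real_of_int (w i)"]
      by (auto simp: sparse_separated_def obj)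
  qed
  have V_att: "\<exists>j. sparse_separated d j \<Delta> \<noteq> {} \<and> ?V l = f j + l * (int k - int j)" for l :: int
  proof -
    obtain T where T: "T \<in> separated d \<Delta>"
      "lagr_obj k (real_of_int l) (\<lambda>i. real_of_int (w i)) T = ?V l"
      by (rule ProjLagr_value_attained)
    then have T': "T \<in> sparse_separated d (card T) \<Delta>" by (simp add: sparse_separated_def)
    have "sum w T \<le> f (card T)" unfolding f_def by (rule best_ge[OF T'])
    then have "?V l \<le> f (card T) + l * (int k - int (card T))"
      using T(2)[symmetric] unfolding obj by simp (simp only: of_int_le_iff flip: of_int_sum)
    moreover have "f (card T) + l * (int k - int (card T)) \<le> ?V l"
      using T' by (intro V_ge) auto
    ultimately show ?thesis using T' by (intro exI[of _ "card T"]) auto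
  qed
  have concave: "f j + f (j + 2) \<le> 2 * f (j + 1)"
    if "sparse_separated d K \<Delta> \<noteq> {}" "j + 2 \<le> K" for j K
    unfolding f_def using sparse_separated_nonempty_mono[OF that] by (rule best_concave)
  note ne_le = sparse_separated_nonempty_mono
  have km: "k - 1 + 1 = k" using k by simp
  \<comment> \<open>A size \<open>j\<close> that is optimal at \<open>l + 1\<close> satisfies
    \<open>j < k\<close>, as its line must rise from \<open>l\<close>. If the increment at
    \<open>k\<close> were at least \<open>l + 1\<close>, so would be all earlier ones, and size
    \<open>k\<close> would reach \<open>?V (l + 1)\<close> already at \<open>l\<close>.\<close>
  have le: "f k - f (k - 1) \<le> l"
  proof -
    obtain j where j: "sparse_separated d j \<Delta> \<noteq> {}"
      "?V (l + 1) = f j + (l + 1) * (int k - int j)" using V_att by blast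
    have "?V l < ?V (l + 1)" by (rule is_lambda_hatD[OF lam])
    then have "real_of_int (f j + l * (int k - int j)) < real_of_int (f j + (l + 1) * (int k - int j))"
      using V_ge[OF j(1), of l] j(2) by simp
    then have "j < k" by (simp add: algebra_simps)
    have "real_of_int (f k + l * (int k - int k)) < real_of_int (f j + (l + 1) * (int k - int j))"
      using V_ge[OF ne, of l] \<open>?V l < ?V (l + 1)\<close> j(2) by simp
    then have 1: "f k - f j < (l + 1) * (int k - int j)" unfolding of_int_less_iff by simp
    have "int (k - 1 + 1 - j) * (f (k - 1 + 1) - f (k - 1)) \<le> f (k - 1 + 1) - f j"
      using \<open>j < k\<close> by (intro concave_chord_lower[of k f, OF concave[OF ne]]) auto
    then have "(int k - int j) * (f k - f (k - 1)) \<le> f k - f j"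
      using \<open>j < k\<close> km by (simp add: of_nat_diff)
    with 1 have "(int k - int j) * (f k - f (k - 1)) < (int k - int j) * (l + 1)"
      by (simp add: mult.commute)
    then have "f k - f (k - 1) < l + 1" using \<open>j < k\<close> by simp
    then show ?thesis by simp
  qed
  \<comment> \<open>If the increment at \<open>k\<close> were below \<open>l\<close>, no size
    \<open>j \<ge> k\<close> could beat \<open>k - 1\<close> at the multiplier \<open>l - 1\<close>.
    Size \<open>k - 1\<close> gains 1 when the multiplier moves up to \<open>l\<close>, so the value
    would strictly increase there.\<close>
  have ge: "l \<le> f k - f (k - 1)"
  proof (rule ccontr)
    assume "\<not> ?thesis"
    then have incr: "f k - f (k - 1) \<le> l - 1" by simp
    obtain j where j: "sparse_separated d j \<Delta> \<noteq> {}"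
      "?V (l - 1) = f j + (l - 1) * (int k - int j)" using V_att by blast
    have V: "?V l \<le> ?V (l - 1)" by (rule is_lambda_hatD[OF lam])
    have "real_of_int (f j + l * (int k - int j)) \<le> real_of_int (f j + (l - 1) * (int k - int j))"
      using V_ge[OF j(1), of l] j(2) V by simp
    then have "k \<le> j" by (simp add: algebra_simps)
    have "f j - f (k - 1) \<le> int (j - (k - 1)) * (f (k - 1 + 1) - f (k - 1))"
      using \<open>k \<le> j\<close> by (intro concave_chord_upper[of j f, OF concave[OF j(1)]]) auto
    also have "\<dots> \<le> int (j - (k - 1)) * (l - 1)"
      using incr km by (intro mult_left_mono) auto
    also have "int (j - (k - 1)) = int j - int k + 1" using \<open>k \<le> j\<close> k by simp
    finally have "f j + (l - 1) * (int k - int j) \<le> f (k - 1) + (l - 1)"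
      by (simp add: algebra_simps)
    moreover have "real_of_int (f (k - 1) + l * (int k - int (k - 1))) \<le> ?V l"
      using ne_le[OF ne, of "k - 1"] by (intro V_ge) auto
    moreover have "l * (int k - int (k - 1)) = l" using k by (simp add: of_nat_diff)
    ultimately have "real_of_int (f (k - 1) + l) \<le> real_of_int (f (k - 1) + (l - 1))"
      using V j(2) by (smt (verit) of_int_le_iff)
    then show False by simp
  qed
  have l: "f k - f (k - 1) = l" using le ge by simp
  define b where "b = card S"
  have Ssep: "S \<in> separated d \<Delta>" using S by (simp add: ProjLagr_iff)
  then have Sb: "S \<in> sparse_separated d b \<Delta>" by (simp add: sparse_separated_def b_def)
  then have neb: "sparse_separated d b \<Delta> \<noteq> {}" by auto
  have bd: "b \<le> d" unfolding b_def using Ssep by (rule card_separated_le)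
  obtain T where T: "T \<in> sparse_separated d k \<Delta>" "sum w T = f k"
    unfolding f_def using ne by (rule best_attained)
  have "f k + (l - 1 / (real d + 1)) * (real k - real k)
      \<le> sum w S + (l - 1 / (real d + 1)) * (real k - real b)"
    using S T unfolding ProjLagr_iff obj b_def sparse_separated_def
    by (smt (verit, best) mem_Collect_eq)
  moreover have "real_of_int (sum w S) \<le> f b"
    unfolding f_def of_int_le_iff using Sb by (rule best_ge)
  ultimately have opt: "real_of_int (f k) \<le> f b + (l - 1 / (real d + 1)) * (real k - real b)"
    by (simp del: of_int_sum)
  have "k < b"
  proof (rule ccontr)
    assume "\<not> k < b"
    then have "b < k" using card b_def by simp
    have "int (k - 1 + 1 - b) * (f (k - 1 + 1) - f (k - 1)) \<le> f (k - 1 + 1) - f b"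
      using \<open>b < k\<close> by (intro concave_chord_lower[of k f, OF concave[OF ne]]) auto
    then have "(int k - int b) * l \<le> f k - f b"
      using \<open>b < k\<close> km l by (simp add: of_nat_diff)
    then have "real_of_int ((int k - int b) * l) \<le> real_of_int (f k - f b)" by (rule of_int_le_iff[THEN iffD2])
    moreover have "0 < (1 / (real d + 1)) * (real k - real b)" using \<open>b < k\<close> by simp
    ultimately show False using opt by (simp add: algebra_simps)
  qed
  define r where "r = 1 / (real d + 1)"
  \<comment> \<open>Here \<open>b - k \<le> d\<close> meets the denominator \<open>d + 1\<close>:
    the total shift stays below 1.\<close>
  have "r * (real b - real k) < 1"
    unfolding r_def using bd \<open>k < b\<close> by (simp add: divide_simps)
  then have "real_of_int ((int b - int k) * l) - 1 < real_of_int (f b - f k)"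
    using opt[folded r_def] by (simp add: algebra_simps)
  \<comment> \<open>Between integers, a deficit of less than 1 vanishes.\<close>
  then have 1: "(int b - int k) * l \<le> f b - f k" by linarith
  have "f b - f k \<le> int (b - k) * (f (k + 1) - f k)"
    using \<open>k < b\<close> by (intro concave_chord_upper[of b f, OF concave[OF neb]]) auto
  also have "int (b - k) = int b - int k" using \<open>k < b\<close> by simp
  finally have "(int b - int k) * l \<le> (int b - int k) * (f (k + 1) - f k)"
    using 1 by (rule order_trans[rotated])
  then have 2: "l \<le> f (k + 1) - f k" using \<open>k < b\<close> by simp
  have ne2: "sparse_separated d (k - 1 + 2) \<Delta> \<noteq> {}"
    using neb by (rule ne_le) (use \<open>k < b\<close> k in auto)
  have "f (k - 1) + f (k - 1 + 2) \<le> 2 * f (k - 1 + 1)"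
    using ne2 by (rule concave) simp
  moreover have "k - 1 + 2 = k + 1" using k by simp
  ultimately have "f (k - 1) + f (k - 1 + 2) = 2 * f (k - 1 + 1)"
    using 2 l km by simp
  then show ?thesis
    using best_tie[OF ne2, of w] that unfolding f_def km by metis
qed

text \<open>Multiplying by \<open>d + 1\<close> clears the denominator of \<open>lam\<close>, and
  the penalty per chosen element becomes the shift \<open>- q\<close> of its weight. Up to the
  constant \<open>q * k\<close>, the relaxation is an integer maximum-weight problem over separated
  sets.\<close>

lemma ProjLagr_dp:
  fixes w ct :: "nat \<Rightarrow> int" and q :: int and d :: nat
  defines "lam \<equiv> real_of_int q / (real d + 1)"
  assumes w: "\<And>i. i \<in> {1..d} \<Longrightarrow> w i = (int d + 1) * ct i - q"
  shows "backtrack w (\<Delta> - 1) d \<in> ProjLagr d k \<Delta> lam (\<lambda>i. real_of_int (ct i))"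
    and "(real d + 1) * ProjLagr_value d k \<Delta> lam (\<lambda>i. real_of_int (ct i))
      = real_of_int (dp w (\<Delta> - 1) d + q * int k)"
proof -
  have obj: "(real d + 1) * lagr_obj k lam (\<lambda>i. real_of_int (ct i)) S = real_of_int (sum w S + q * int k)"
    if "S \<in> separated d \<Delta>" for S
  proof -
    have "sum w S = (\<Sum>i\<in>S. (int d + 1) * ct i - q)"
      using that w by (intro sum.cong) (auto simp: separated_iff)
    also have "\<dots> = (int d + 1) * sum ct S - q * int (card S)"
      by (simp add: sum_subtractf sum_distrib_left)
    finally have "sum w S + q * int k = (int d + 1) * sum ct S + q * (int k - int (card S))"
      by (simp add: algebra_simps)
    then have "real_of_int (sum w S + q * int k) =
        real_of_int ((int d + 1) * sum ct S + q * (int k - int (card S)))" by (rule arg_cong)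
    also have "\<dots> = (real d + 1) * (\<Sum>i\<in>S. real_of_int (ct i)) + q * (real k - real (card S))"
      by simp
    also have "\<dots> = (real d + 1) * lagr_obj k lam (\<lambda>i. real_of_int (ct i)) S"
      by (simp add: lagr_obj_def lam_def distrib_left)
    finally show ?thesis by simp
  qed
  have bt: "backtrack w (\<Delta> - 1) d \<in> separated d \<Delta>" by (rule backtrack_separated)
  have "(real d + 1) * lagr_obj k lam (\<lambda>i. real_of_int (ct i)) T
      \<le> (real d + 1) * lagr_obj k lam (\<lambda>i. real_of_int (ct i)) (backtrack w (\<Delta> - 1) d)"
    if "T \<in> separated d \<Delta>" for T
    unfolding obj[OF that] obj[OF bt] sum_backtrack of_int_le_iff using dp_upper[OF that, of w] by simp
  then show P: "backtrack w (\<Delta> - 1) d \<in> ProjLagr d k \<Delta> lam (\<lambda>i. real_of_int (ct i))"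
    unfolding ProjLagr_iff using bt by auto
  show "(real d + 1) * ProjLagr_value d k \<Delta> lam (\<lambda>i. real_of_int (ct i))
      = real_of_int (dp w (\<Delta> - 1) d + q * int k)"
    unfolding ProjLagr_value_eqI[OF P] obj[OF bt] sum_backtrack ..
qed

section \<open>Isolation\<close>

definition sample_pmf :: "nat \<Rightarrow> (nat \<Rightarrow> int) pmf" where
  "sample_pmf d = Pi_pmf {1..d} 0 (\<lambda>_. pmf_of_set {0..<int d ^ 3})"

text \<open>With the other coordinates fixed, a tie between optimal sets with and without
  \<open>i\<close> pins down \<open>X i\<close>: raising this coordinate lifts \<open>A\<close>
  strictly and leaves every set without \<open>i\<close> unchanged, so no such set \<open>C\<close>
  can be optimal any more.\<close>

lemma isolation_determines_coordinate:
  fixes a X Y :: "nat \<Rightarrow> int"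
  assumes fin: "\<And>S. S \<in> F \<Longrightarrow> finite S" and eq: "\<And>j. j \<noteq> i \<Longrightarrow> X j = Y j"
    and X: "A \<in> F" "i \<in> A" "B \<in> F" "i \<notin> B" "\<And>S. S \<in> F \<Longrightarrow> (\<Sum>j\<in>S. a j + X j) \<le> (\<Sum>j\<in>A. a j + X j)"
      "(\<Sum>j\<in>A. a j + X j) = (\<Sum>j\<in>B. a j + X j)"
    and Y: "C \<in> F" "i \<notin> C" "\<And>S. S \<in> F \<Longrightarrow> (\<Sum>j\<in>S. a j + Y j) \<le> (\<Sum>j\<in>C. a j + Y j)"
  shows "Y i \<le> X i"
proof (rule ccontr)
  assume "\<not> Y i \<le> X i"
  have le: "X j \<le> Y j" for j
    using eq[of j] \<open>\<not> Y i \<le> X i\<close> by (cases "j = i") auto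
  have "(\<Sum>j\<in>A. a j + X j) < (\<Sum>j\<in>A. a j + Y j)"
    using fin[OF X(1)] X(2) \<open>\<not> Y i \<le> X i\<close> le
    by (intro sum_strict_mono_ex1) (auto simp: not_le)
  also have "\<dots> \<le> (\<Sum>j\<in>C. a j + Y j)" using Y(3) X(1) by blast
  also have "\<dots> = (\<Sum>j\<in>C. a j + X j)"
    using Y(2) by (intro sum.cong) (auto intro: eq[symmetric])
  also have "\<dots> \<le> (\<Sum>j\<in>A. a j + X j)" using X(5) Y(1) by blast
  finally show False by simp
qed

text \<open>The isolation lemma by counting. Each index that distinguishes two optimal sets accounts
  for at most \<open>(d ^ 3) ^ (d - 1)\<close> of the \<open>(d ^ 3) ^ d\<close> samples, and there
  are \<open>d\<close> indices.\<close>

lemma prob_isolation_failure: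
  fixes a :: "nat \<Rightarrow> int"
  assumes d: "1 \<le> d" and F: "F \<subseteq> Pow {1..d}"
  shows "measure_pmf.prob (sample_pmf d)
      {X. \<exists>A\<in>F. \<exists>B\<in>F. A \<noteq> B \<and> (\<forall>S\<in>F. (\<Sum>j\<in>S. a j + X j) \<le> (\<Sum>j\<in>A. a j + X j)) \<and>
        (\<Sum>j\<in>A. a j + X j) = (\<Sum>j\<in>B. a j + X j)} \<le> 1 / (real d)\<^sup>2" (is "measure_pmf.prob _ ?bad \<le> _")
proof -
  let ?R = "{0..<int d ^ 3}"
  let ?U = "PiE_dflt {1..d} 0 (\<lambda>_. ?R)"
  have R: "card ?R = d ^ 3" "?R \<noteq> {}" using d by (auto simp: nat_power_eq)
  have finF: "finite S" if "S \<in> F" for S using that F by (auto intro: finite_subset)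
  have U: "sample_pmf d = pmf_of_set ?U"
    unfolding sample_pmf_def using R by (intro Pi_pmf_of_set) auto
  have finU: "finite ?U" by (intro finite_PiE_dflt) auto
  have neU: "?U \<noteq> {}" using R by (simp add: PiE_dflt_empty_iff)
  have cardU: "card ?U = (d ^ 3) ^ d" using R by (subst card_PiE_dflt) auto
  define E where "E i = {X\<in>?U. \<exists>A\<in>F. \<exists>B\<in>F. i \<in> A \<and> i \<notin> B \<and>
      (\<forall>S\<in>F. (\<Sum>j\<in>S. a j + X j) \<le> (\<Sum>j\<in>A. a j + X j)) \<and>
      (\<Sum>j\<in>A. a j + X j) = (\<Sum>j\<in>B. a j + X j)}" for i
  have cardE: "card (E i) \<le> (d ^ 3) ^ (d - 1)" if i: "i \<in> {1..d}" for i
  proof -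
    let ?U' = "PiE_dflt ({1..d} - {i}) 0 (\<lambda>_. ?R)"
    \<comment> \<open>Erasing coordinate \<open>i\<close> loses nothing on \<open>E i\<close>,
      because the other coordinates determine it.\<close>
    have "inj_on (\<lambda>X. X(i := 0)) (E i)"
    proof (rule inj_onI)
      fix X Y assume XY: "X \<in> E i" "Y \<in> E i" "X(i := 0) = Y(i := 0)"
      have eq: "X j = Y j" if "j \<noteq> i" for j
        using fun_cong[OF XY(3), of j] that by simp
      obtain A B where X: "A \<in> F" "i \<in> A" "B \<in> F" "i \<notin> B"
        "\<And>S. S \<in> F \<Longrightarrow> (\<Sum>j\<in>S. a j + X j) \<le> (\<Sum>j\<in>A. a j + X j)"
        "(\<Sum>j\<in>A. a j + X j) = (\<Sum>j\<in>B. a j + X j)" using XY(1) by (auto simp: E_def)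
      obtain C D where Y: "C \<in> F" "i \<in> C" "D \<in> F" "i \<notin> D"
        "\<And>S. S \<in> F \<Longrightarrow> (\<Sum>j\<in>S. a j + Y j) \<le> (\<Sum>j\<in>C. a j + Y j)"
        "(\<Sum>j\<in>C. a j + Y j) = (\<Sum>j\<in>D. a j + Y j)" using XY(2) by (auto simp: E_def)
      have "Y i \<le> X i"
        by (rule isolation_determines_coordinate[OF finF eq X Y(3,4)]) (use Y(5,6) in auto)
      moreover have "X i \<le> Y i"
        by (rule isolation_determines_coordinate[OF finF eq[symmetric] Y X(3,4)]) (use X(5,6) in auto)
      ultimately show "X = Y" using eq by (intro ext) (metis order_antisym)
    qed
    moreover have "(\<lambda>X. X(i := 0)) ` E i \<subseteq> ?U'"
      by (auto simp: E_def PiE_dflt_def)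
    moreover have "finite ?U'" by (intro finite_PiE_dflt) auto
    ultimately have "card (E i) \<le> card ?U'" by (metis card_inj_on_le)
    also have "card ?U' = (d ^ 3) ^ (d - 1)" using R i by (subst card_PiE_dflt) auto
    finally show ?thesis .
  qed
  have finE: "finite (E i)" for i using finU by (auto simp: E_def)
  have "?bad \<inter> ?U \<subseteq> (\<Union>i\<in>{1..d}. E i)"
  proof
    fix X assume "X \<in> ?bad \<inter> ?U"
    then obtain A B where AB: "A \<in> F" "B \<in> F" "A \<noteq> B" "X \<in> ?U"
      "\<forall>S\<in>F. (\<Sum>j\<in>S. a j + X j) \<le> (\<Sum>j\<in>A. a j + X j)"
      "(\<Sum>j\<in>A. a j + X j) = (\<Sum>j\<in>B. a j + X j)" by blast
    from AB(3) consider i where "i \<in> A" "i \<notin> B" | i where "i \<in> B" "i \<notin> A" by blast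
    then show "X \<in> (\<Union>i\<in>{1..d}. E i)"
    proof cases
      case 1
      then have "X \<in> E i" using AB unfolding E_def by blast
      moreover have "i \<in> {1..d}" using 1 AB(1) F by blast
      ultimately show ?thesis by blast
    next
      case 2
      \<comment> \<open>The tied set \<open>B\<close> is optimal as well, so \<open>A\<close> and
        \<open>B\<close> may change roles.\<close>
      have "\<forall>S\<in>F. (\<Sum>j\<in>S. a j + X j) \<le> (\<Sum>j\<in>B. a j + X j)" using AB(5,6) by simp
      then have "X \<in> E i" using AB(1,2,4) AB(6)[symmetric] 2 unfolding E_def by blast
      moreover have "i \<in> {1..d}" using 2 AB(2) F by blast
      ultimately show ?thesis by blast
    qed
  qed
  then have "card (?U \<inter> ?bad) \<le> card (\<Union>i\<in>{1..d}. E i)"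
    using finE by (intro card_mono) auto
  also have "\<dots> \<le> (\<Sum>i\<in>{1..d}. card (E i))" by (rule card_UN_le) simp
  also have "\<dots> \<le> (\<Sum>i\<in>{1..d}. (d ^ 3) ^ (d - 1))" by (intro sum_mono cardE)
  finally have "card (?U \<inter> ?bad) \<le> d * (d ^ 3) ^ (d - 1)" by simp
  then have "real (card (?U \<inter> ?bad)) \<le> real (d * (d ^ 3) ^ (d - 1))" by (rule of_nat_mono)
  then have "measure_pmf.prob (sample_pmf d) ?bad \<le> real (d * (d ^ 3) ^ (d - 1)) / real ((d ^ 3) ^ d)"
    unfolding U measure_pmf_of_set[OF neU finU] cardU by (intro divide_right_mono) auto
  also have "real ((d ^ 3) ^ d) = real d ^ 3 * real (d ^ 3) ^ (d - 1)"
    using d by (cases d) auto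
  also have "real (d * (d ^ 3) ^ (d - 1)) / (real d ^ 3 * real (d ^ 3) ^ (d - 1)) = 1 / (real d)\<^sup>2"
    using d by (simp add: divide_simps power2_eq_square power3_eq_cube)
  finally show ?thesis .
qed

section \<open>From maximum-weight sets to projections\<close>

text \<open>The samples of at most \<open>d\<close> elements add up to at most
  \<open>d * (d ^ 3 - 1)\<close>, less than one unit of the scaled weights, so a strict difference
  in \<open>c\<close> survives.\<close>

lemma perturbation_preserves_max:
  fixes c X :: "nat \<Rightarrow> int"
  assumes X: "\<forall>i\<in>{1..d}. X i \<in> {0..<int d ^ 3}" and S: "S \<subseteq> {1..d}" and T: "T \<subseteq> {1..d}"
    and d: "1 \<le> d" and le: "sum (perturb d c X) T \<le> sum (perturb d c X) S"
  shows "sum c T \<le> sum c S"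
proof -
  have eq: "sum (perturb d c X) A = real_of_int (int d ^ 4 * sum c A + sum X A)" for A
    by (simp add: perturb_def sum.distrib sum_distrib_left)
  have "int d ^ 4 * sum c T + sum X T \<le> int d ^ 4 * sum c S + sum X S"
    using le unfolding eq by (simp only: of_int_le_iff)
  moreover have "0 \<le> sum X T" using X T by (intro sum_nonneg) auto
  moreover have "sum X S < int d ^ 4"
  proof -
    have "sum X S \<le> (\<Sum>i\<in>S. int d ^ 3 - 1)"
      using X S by (intro sum_mono) force
    also have "\<dots> = int (card S) * (int d ^ 3 - 1)" by simp
    also have "\<dots> \<le> int d * (int d ^ 3 - 1)"
      using card_mono[OF _ S] d by (intro mult_right_mono) auto
    also have "\<dots> < int d ^ 4" using d by (simp add: algebra_simps eval_nat_numeral)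
    finally show ?thesis .
  qed
  ultimately have "int d ^ 4 * sum c T < int d ^ 4 * (sum c S + 1)" by (simp add: distrib_left)
  then have "sum c T < sum c S + 1" using d by simp
  then show ?thesis by simp
qed

text \<open>Optimality comes from the accepted round alone; rejected rounds only prolong the
  run.\<close>

lemma lassp_run_max:
  assumes "lassp_run d k \<Delta> c Xs S" "1 \<le> d"
  shows "S \<in> sparse_separated d k \<Delta>" "T \<in> sparse_separated d k \<Delta> \<Longrightarrow> sum c T \<le> sum c S"
proof -
  have "S \<in> sparse_separated d k \<Delta> \<and> (T \<in> sparse_separated d k \<Delta> \<longrightarrow> sum c T \<le> sum c S)"
    using assms(1)
  proof induction
    case (accept X S)
    then obtain lam where lam: "S \<in> ProjLagr d k \<Delta> lam (perturb d c X)"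
      and X: "\<forall>i\<in>{1..d}. X i \<in> {0..<int d ^ 3}" by (auto simp: lassp_round_def)
    have S: "S \<in> sparse_separated d k \<Delta>"
      using lam accept by (simp add: ProjLagr_iff sparse_separated_def)
    moreover have "sum c T \<le> sum c S" if T: "T \<in> sparse_separated d k \<Delta>"
      using S T by (intro perturbation_preserves_max[OF X _ _ assms(2)]
          ProjLagr_card_eq_max[OF lam accept(2)]) (auto simp: sparse_separated_def separated_iff)
    ultimately show ?case by blast
  qed
  then show "S \<in> sparse_separated d k \<Delta>" "T \<in> sparse_separated d k \<Delta> \<Longrightarrow> sum c T \<le> sum c S"
    by auto
qed

text \<open>The squared distance to a vector supported in \<open>T\<close> is at least the mass of
  \<open>x\<close> outside \<open>T\<close>, and the restriction of \<open>x\<close> to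
  \<open>S\<close> attains this for \<open>S\<close>. If \<open>x\<close> has no zero on
  \<open>S\<close>, that restriction has support exactly \<open>S\<close>, so the minimizer over the
  larger feasible set lies in the smaller one.\<close>

lemma solves_projectionI:
  assumes S: "S \<in> sparse_separated d k \<Delta>"
    and max: "\<And>T. T \<in> sparse_separated d k \<Delta> \<Longrightarrow> (\<Sum>i\<in>T. (x i)\<^sup>2) \<le> (\<Sum>i\<in>S. (x i)\<^sup>2)"
    and xh: "\<And>i. i \<in> {1..d} \<Longrightarrow> xh i = (if i \<in> S then x i else 0)"
  shows "solves_projection d k \<Delta> x S xh"
proof -
  have sub: "T \<subseteq> {1..d}" if "T \<in> sparse_separated d k \<Delta>" for T
    using that by (auto simp: sparse_separated_def separated_iff)
  have dist_ge: "(\<Sum>i\<in>{1..d} - T. (x i)\<^sup>2) \<le> (\<Sum>i\<in>{1..d}. (x i - x' i)\<^sup>2)"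
    if "supp d x' \<subseteq> T" for T x'
  proof -
    have "(\<Sum>i\<in>{1..d} - T. (x i)\<^sup>2) = (\<Sum>i\<in>{1..d} - T. (x i - x' i)\<^sup>2)"
      using that by (intro sum.cong) (auto simp: supp_def)
    also have "\<dots> \<le> (\<Sum>i\<in>{1..d}. (x i - x' i)\<^sup>2)" by (intro sum_mono2) auto
    finally show ?thesis .
  qed
  have split: "(\<Sum>i\<in>{1..d} - T. (x i)\<^sup>2) = (\<Sum>i\<in>{1..d}. (x i)\<^sup>2) - (\<Sum>i\<in>T. (x i)\<^sup>2)"
    if "T \<in> sparse_separated d k \<Delta>" for T
    using sub[OF that] by (simp add: sum_diff)
  have "(\<Sum>i\<in>{1..d}. (x i - xh i)\<^sup>2) = (\<Sum>i\<in>{1..d}. if i \<in> S then 0 else (x i)\<^sup>2)"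
    using xh by (intro sum.cong) auto
  also have "\<dots> = (\<Sum>i\<in>{1..d} - S. (x i)\<^sup>2)" by (simp add: sum.If_cases Diff_eq)
  finally have dist: "(\<Sum>i\<in>{1..d}. (x i - xh i)\<^sup>2) = (\<Sum>i\<in>{1..d} - S. (x i)\<^sup>2)" .
  have opt: "L2_set (\<lambda>i. x i - xh i) {1..d} \<le> L2_set (\<lambda>i. x i - x' i) {1..d}"
    if "x' \<in> sparse_separated_vectors d k \<Delta>" for x'
  proof -
    obtain T where T: "T \<in> sparse_separated d k \<Delta>" "supp d x' \<subseteq> T"
      using \<open>x' \<in> _\<close> by (auto simp: sparse_separated_vectors_def)
    show ?thesis unfolding L2_set_def dist
      using dist_ge[OF T(2)] split[OF S] split[OF T(1)] max[OF T(1)] by simp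
  qed
  have supp: "supp d xh \<subseteq> S" using xh by (auto simp: supp_def split: if_splits)
  then have mem: "xh \<in> sparse_separated_vectors d k \<Delta>"
    using S by (auto simp: sparse_separated_vectors_def)
  have "projection_onto d (exact_sparse_separated_vectors d k \<Delta>) x xh" if "\<forall>i\<in>S. x i \<noteq> 0"
  proof -
    have "supp d xh = S" using supp that xh sub[OF S] by (auto simp: supp_def)
    then have "xh \<in> exact_sparse_separated_vectors d k \<Delta>"
      using S by (simp add: exact_sparse_separated_vectors_def)
    moreover have "exact_sparse_separated_vectors d k \<Delta> \<subseteq> sparse_separated_vectors d k \<Delta>"
      by (auto simp: exact_sparse_separated_vectors_def sparse_separated_vectors_def)
    ultimately show ?thesis
      using opt by (force simp: projection_onto_def is_arg_min_def not_less)
  qed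
  then show ?thesis
    using S max xh opt mem
    by (auto simp: solves_projection_def projection_onto_def is_arg_max_def is_arg_min_def not_less)
qed

section \<open>The program\<close>

abbreviation var :: "vname \<Rightarrow> aexp" where "var x \<equiv> Load x (N 0)"
abbreviation set_var :: "vname \<Rightarrow> aexp \<Rightarrow> com" (infix "::=" 65) where "x ::= e \<equiv> Assign x (N 0) e"
abbreviation seq :: "com \<Rightarrow> com \<Rightarrow> com" (infixr ";;" 60) where "p ;; q \<equiv> Seq p q"

definition sample_loop :: com where
  "sample_loop = WHILE (Less (var ''i'') (var ''d''))
     (''i'' ::= Plus (var ''i'') (N 1) ;;
      Rand ''X'' (var ''i'') (Times (var ''d'') (Times (var ''d'') (var ''d''))))"

text \<open>\<open>R\<close> ends up above the weight of every selection of indices and delimits the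
  search for the multiplier. \<open>S\<close> is cleared because a rejected round leaves its
  marks.\<close>

definition weights_prog :: com where
  "weights_prog = ''i'' ::= N 0 ;; ''R'' ::= N 1 ;;
     WHILE (Less (var ''i'') (var ''d''))
       (''i'' ::= Plus (var ''i'') (N 1) ;;
        Assign ''ct'' (var ''i'')
          (Plus (Times (Times (Times (var ''d'') (var ''d'')) (Times (var ''d'') (var ''d'')))
             (Times (Load ''x'' (var ''i'')) (Load ''x'' (var ''i'')))) (Load ''X'' (var ''i''))) ;;
        ''R'' ::= Plus (var ''R'') (Load ''ct'' (var ''i'')) ;;
        Assign ''S'' (var ''i'') (N 0))"

text \<open>Here \<open>i\<close> is already incremented: for \<open>i = n + 1\<close> and
  \<open>Delta = e + 1\<close> the cell read is \<open>n - e\<close>, and the other summand is the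
  shifted weight of \<open>ProjLagr_dp\<close>.\<close>

definition candidate :: aexp where
  "candidate = Plus (Load ''F'' (Minus (var ''i'') (var ''Delta'')))
     (Minus (Times (Plus (var ''d'') (N 1)) (Load ''ct'' (var ''i''))) (var ''q''))"

text \<open>The reads \<open>F[i - Delta]\<close> with \<open>i < Delta\<close> are intended: \<open>F\<close> is never written at indices \<open>\<le> 0\<close>
  and hence vanishes there.\<close>

definition dp_prog :: com where
  "dp_prog = ''i'' ::= N 0 ;;
     WHILE (Less (var ''i'') (var ''d''))
       (''i'' ::= Plus (var ''i'') (N 1) ;;
        IF (Less (Load ''F'' (Minus (var ''i'') (N 1))) candidate)
          (Assign ''F'' (var ''i'') candidate)
          (Assign ''F'' (var ''i'') (Load ''F'' (Minus (var ''i'') (N 1)))))"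

text \<open>Both sides are relaxation values times \<open>d + 1\<close>. The constant for
  \<open>mid\<close> is recomputed, since \<open>q\<close> and \<open>F\<close> already belong to
  \<open>mid + 1\<close>.\<close>

definition compare_prog :: com where
  "compare_prog =
     IF (Less (Plus (var ''v'') (Times (Times (Plus (var ''d'') (N 1)) (var ''mid'')) (var ''k'')))
              (Plus (Load ''F'' (var ''d'')) (Times (var ''q'') (var ''k''))))
       (''hi'' ::= var ''mid'') (''lo'' ::= var ''mid'')"

definition search_body :: com where
  "search_body = ''mid'' ::= Div (Plus (var ''lo'') (var ''hi'')) (N 2) ;;
     ''q'' ::= Times (Plus (var ''d'') (N 1)) (var ''mid'') ;; dp_prog ;;
     ''v'' ::= Load ''F'' (var ''d'') ;;
     ''q'' ::= Times (Plus (var ''d'') (N 1)) (Plus (var ''mid'') (N 1)) ;; dp_prog ;;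
     compare_prog"

text \<open>Increments of \<open>f\<close> can be negative, so the search interval extends to both
  sides of 0.\<close>

definition search_prog :: com where
  "search_prog = ''hi'' ::= var ''R'' ;; ''lo'' ::= Minus (N (-1)) (var ''R'') ;;
     WHILE (Less (Plus (var ''lo'') (N 1)) (var ''hi'')) search_body"

text \<open>\<open>i\<close> may become negative where \<open>backtrack\<close> truncates to 0; the
  loop guard ends the search in both cases.\<close>

definition backtrack_prog :: com where
  "backtrack_prog = ''cnt'' ::= N 0 ;; ''i'' ::= var ''d'' ;;
     WHILE (Less (N 0) (var ''i''))
       (IF (Less (Load ''F'' (Minus (var ''i'') (N 1))) (Load ''F'' (var ''i'')))
          (Assign ''S'' (var ''i'') (N 1) ;; ''cnt'' ::= Plus (var ''cnt'') (N 1) ;;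
           ''i'' ::= Minus (var ''i'') (var ''Delta''))
          (''i'' ::= Minus (var ''i'') (N 1)))"

definition evaluate_prog :: com where
  "evaluate_prog = weights_prog ;; search_prog ;;
     ''q'' ::= Minus (Times (Plus (var ''d'') (N 1)) (var ''hi'')) (N 1) ;; dp_prog ;; backtrack_prog"

definition size_mismatch :: bexp where
  "size_mismatch =
     Neg (And (Neg (Less (var ''cnt'') (var ''k''))) (Neg (Less (var ''k'') (var ''cnt''))))"

definition reset_prog :: com where
  "reset_prog = ''i'' ::= N 0"

text \<open>The \<open>repeat\<close> loop in \<open>WHILE\<close> form: \<open>cnt\<close> is
  initially 0 and \<open>k \<ge> 1\<close>, so the first round is always entered.\<close>

definition main_loop :: com where
  "main_loop = WHILE size_mismatch (reset_prog ;; sample_loop ;; evaluate_prog)"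

lemma bval_size_mismatch: "bval size_mismatch s \<longleftrightarrow> s ''cnt'' 0 \<noteq> s ''k'' 0"
  by (auto simp: size_mismatch_def)

definition output_prog :: com where
  "output_prog = ''i'' ::= N 0 ;;
     WHILE (Less (var ''i'') (var ''d''))
       (''i'' ::= Plus (var ''i'') (N 1) ;;
        Assign ''xhat'' (var ''i'') (Times (Load ''S'' (var ''i'')) (Load ''x'' (var ''i''))))"

text \<open>By \<open>separated_iff\<close>, \<open>Delta = 0\<close> may be replaced by 1. With
  \<open>Delta = 0\<close>, \<open>candidate\<close> would read the cell about to be written and
  backtracking would not advance.\<close>

definition init_prog :: com where
  "init_prog = IF (Less (N 0) (var ''Delta'')) SKIP (''Delta'' ::= N 1)"

definition lassp_prog :: com where
  "lassp_prog = init_prog ;; main_loop ;; output_prog"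

section \<open>Bounded stores, frame conditions and the table computation\<close>

definition bounded_store :: "int \<Rightarrow> store \<Rightarrow> bool" where
  "bounded_store M s \<longleftrightarrow> (\<forall>v i. \<bar>s v i\<bar> \<le> M)"

definition same_except :: "vname set \<Rightarrow> store \<Rightarrow> store \<Rightarrow> bool" where
  "same_except A s s' \<longleftrightarrow> (\<forall>v. v \<notin> A \<longrightarrow> s' v = s v)"

lemma same_exceptD: "same_except A s s' \<Longrightarrow> v \<notin> A \<Longrightarrow> s' v = s v"
  by (simp add: same_except_def)

lemma same_except_refl: "same_except A s s"
  by (simp add: same_except_def)

lemma same_except_trans:
  "same_except A s s' \<Longrightarrow> same_except B s' s'' \<Longrightarrow> A \<union> B \<subseteq> C \<Longrightarrow> same_except C s s''"
  unfolding same_except_def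
proof (intro allI impI)
  fix v assume "\<forall>v. v \<notin> A \<longrightarrow> s' v = s v" "\<forall>v. v \<notin> B \<longrightarrow> s'' v = s' v" "A \<union> B \<subseteq> C" "v \<notin> C"
  moreover from this have "v \<notin> A" "v \<notin> B" by auto
  ultimately show "s'' v = s v" by metis
qed

lemma same_except_upd: "same_except A s s' \<Longrightarrow> x \<in> A \<Longrightarrow> same_except A s (upd s' x i v)"
  by (auto simp: same_except_def upd_def)

lemma upd_apply: "upd s x i v y = (if y = x then (s x)(i := v) else s y)"
  by (simp add: upd_def)

lemma bounded_store_upd: "bounded_store M s \<Longrightarrow> \<bar>v\<bar> \<le> M \<Longrightarrow> bounded_store M (upd s x i v)"
  by (simp add: bounded_store_def upd_def)

lemma wp_bounded_assign:
  assumes "aval a s = i" "aval e s = v" "\<bar>v\<bar> \<le> M" "1 \<le> T" "Q (upd s x i v)"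
  shows "wp (bounded_store M) (Assign x a e) T Q s"
  using assms by (intro wp_assign) (auto simp: bounded_store_upd)

lemma wp_bounded_assign_seq:
  assumes "aval a s = i" "aval e s = v" "\<bar>v\<bar> \<le> M" "2 \<le> T"
    "wp (bounded_store M) q (T - 2) Q (upd s x i v)"
  shows "wp (bounded_store M) (Seq (Assign x a e) q) T Q s"
  using assms by (intro wp_assign_seq) (auto simp: bounded_store_upd)

lemma wp_dp_prog:
  fixes d e :: nat and ct :: "nat \<Rightarrow> int" and q :: int
  defines "w \<equiv> \<lambda>i. (int d + 1) * ct i - q"
  assumes s: "s ''d'' 0 = int d" "s ''Delta'' 0 = int e + 1" "s ''q'' 0 = q"
    "\<And>i. i \<in> {1..d} \<Longrightarrow> s ''ct'' (int i) = ct i" "\<And>j. j \<le> 0 \<Longrightarrow> s ''F'' j = 0"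
    and M: "int d \<le> M" "\<And>i. i \<le> d \<Longrightarrow> dp w e i \<le> M"
    and T: "5 * d + 3 \<le> T"
  shows "wp (bounded_store M) dp_prog T (\<lambda>s'. same_except {''F'', ''i''} s s' \<and>
      (\<forall>j\<le>0. s' ''F'' j = 0) \<and> (\<forall>j\<le>d. s' ''F'' (int j) = dp w e j)) s"
proof -
  \<comment> \<open>With \<open>j\<close> iterations to go, only entries up to \<open>d - j\<close>
    are claimed; the others may be left over from an earlier run with a different
    \<open>q\<close>.\<close>
  define I where "I j t \<longleftrightarrow> j \<le> d \<and> t ''i'' 0 = int d - int j \<and> same_except {''F'', ''i''} s t \<and>
    (\<forall>j\<le>0. t ''F'' j = 0) \<and> (\<forall>l. l + j \<le> d \<longrightarrow> t ''F'' (int l) = dp w e l)" for j :: nat and t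
  note upd_apply [simp]
  show ?thesis
    unfolding dp_prog_def
  proof (rule wp_bounded_assign_seq[where i = 0 and v = 0], goal_cases)
    case 5
    show ?case
    proof (rule wp_while[where I = I and j = d and C = 4], goal_cases)
      case (1 j t)
      then have I: "Suc j \<le> d" "t ''i'' 0 = int d - int (Suc j)" "same_except {''F'', ''i''} s t"
        "\<And>j. j \<le> 0 \<Longrightarrow> t ''F'' j = 0" "\<And>l. l + Suc j \<le> d \<Longrightarrow> t ''F'' (int l) = dp w e l"
        by (auto simp: I_def)
      define n where "n = d - Suc j"
      have n: "int d - int j = int n + 1" "n < d" using I(1) by (auto simp: n_def)
      have i: "t ''i'' 0 = int n" using I(2) n by simp
      have tv: "t ''d'' 0 = int d" "t ''Delta'' 0 = int e + 1" "t ''q'' 0 = q" "t ''ct'' = s ''ct''"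
        using s same_exceptD[OF I(3)] by auto
      have ct: "s ''ct'' (int n + 1) = ct (Suc n)" using s(4)[of "Suc n"] n by (simp add: add.commute)
      have F1: "t ''F'' (int n) = dp w e n" using I(5)[of n] I(1) by (simp add: n_def)
      have old: "t ''F'' (int l) = dp w e l" if "l \<le> n" for l
        using I(5)[of l] I(1) that by (simp add: n_def)
      \<comment> \<open>For \<open>e > n\<close> the index is negative, where \<open>F\<close> is 0;
        this matches \<open>dp w e 0\<close> after truncation.\<close>
      have F2: "t ''F'' (int n - int e) = dp w e (n - e)"
      proof (cases "e \<le> n")
        case True
        then show ?thesis using old[of "n - e"] by (simp only: of_nat_diff)
      qed (use I(4) in auto)
      define u where "u = upd t ''i'' 0 (int n + 1)"
      have uF: "u ''F'' = t ''F''" "u ''i'' 0 = int n + 1" by (simp_all add: u_def)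
      have cand: "aval candidate u = dp w e (n - e) + w (Suc n)"
        using tv ct F2 by (simp add: candidate_def u_def w_def)
      have new: "I j (upd u ''F'' (int n + 1) (dp w e (Suc n)))"
      proof -
        have "(upd u ''F'' (int n + 1) (dp w e (Suc n))) ''F'' (int l) = dp w e l" if "l + j \<le> d" for l
        proof (cases "l = Suc n")
          case False
          then have "l \<le> n" using that n by linarith
          then show ?thesis using old[of l] uF by simp
        qed simp
        moreover have "same_except {''F'', ''i''} s (upd u ''F'' (int n + 1) (dp w e (Suc n)))"
          unfolding u_def using I(3) by (intro same_except_upd) simp_all
        moreover have "\<forall>j\<le>0. (upd u ''F'' (int n + 1) (dp w e (Suc n))) ''F'' j = 0"
          using I(4) uF by simp
        moreover have "(upd u ''F'' (int n + 1) (dp w e (Suc n))) ''i'' 0 = int n + 1"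
          using uF by simp
        ultimately show ?thesis unfolding I_def n(1) using I(1) by simp
      qed
      have "wp (bounded_store M)
         (IF (Less (Load ''F'' (Minus (var ''i'') (N 1))) candidate)
            (Assign ''F'' (var ''i'') candidate)
            (Assign ''F'' (var ''i'') (Load ''F'' (Minus (var ''i'') (N 1))))) 2 (I j) u"
      proof (intro wp_if wp_assign)
        have M': "\<bar>dp w e (Suc n)\<bar> \<le> M" using M(2)[of "Suc n"] n dp_nonneg[of w e "Suc n"] by simp
        {
          assume "bval (Less (Load ''F'' (Minus (var ''i'') (N 1))) candidate) u"
          then have *: "aval candidate u = dp w e (Suc n)"
            using F1 uF cand by (simp add: dp.simps(2))
          show "I j (upd u ''F'' (aval (var ''i'') u) (aval candidate u))"
            using new uF * by simp
          show "bounded_store M (upd u ''F'' (aval (var ''i'') u) (aval candidate u))"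
            if "bounded_store M u" using that M' * by (simp add: bounded_store_upd)
        }
        {
          let ?e = "Load ''F'' (Minus (var ''i'') (N 1))"
          assume "\<not> bval (Less ?e candidate) u"
          then have *: "aval ?e u = dp w e (Suc n)"
            using F1 uF cand by (simp add: dp.simps(2))
          show "I j (upd u ''F'' (aval (var ''i'') u) (aval ?e u))"
            using new uF unfolding * by simp
          show "bounded_store M (upd u ''F'' (aval (var ''i'') u) (aval ?e u))"
            if "bounded_store M u" using that M' unfolding * by (simp add: bounded_store_upd)
        }
      qed auto
      then show ?case
        unfolding u_def using i n M(1) by (intro wp_bounded_assign_seq[where v = "int n + 1"]) simp_all
    next
      case (2 t)
      then show ?case
        using s(1) same_exceptD[of _ s t "''d''"] by (auto simp: I_def)
    next
      case (3 j t)
      then show ?case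
        using s(1) same_exceptD[of _ s t "''d''"] by (auto simp: I_def)
    next
      case 4
      show ?case
        using s by (auto simp: I_def same_except_upd same_except_refl)
    qed (use T in simp)
  qed (use M T in auto)
qed

section \<open>Verification of a round\<close>

lemma bit_precision_bounds:
  assumes "1 \<le> d"
  shows "1 \<le> bit_precision d m" "i \<in> {1..d} \<Longrightarrow> \<bar>m i\<bar> < 2 ^ bit_precision d m"
proof -
  define b where "b i = (LEAST b. 1 \<le> b \<and> \<bar>m i\<bar> < 2 ^ b)" for i
  have b: "1 \<le> b i \<and> \<bar>m i\<bar> < 2 ^ b i" for i
    unfolding b_def
  proof (rule LeastI)
    have "int (nat \<bar>m i\<bar>) < 2 ^ nat \<bar>m i\<bar>" by (rule of_nat_less_two_power)
    also have "(2::int) ^ nat \<bar>m i\<bar> \<le> 2 ^ (nat \<bar>m i\<bar> + 1)" by (intro power_increasing) auto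
    finally show "1 \<le> nat \<bar>m i\<bar> + 1 \<and> \<bar>m i\<bar> < 2 ^ (nat \<bar>m i\<bar> + 1)" by simp
  qed
  have le: "b i \<le> bit_precision d m" if "i \<in> {1..d}" for i
    unfolding bit_precision_def b_def using that by (intro Max_ge) auto
  show "1 \<le> bit_precision d m" using le[of 1] b[of 1] assms by auto
  show "\<bar>m i\<bar> < 2 ^ bit_precision d m" if "i \<in> {1..d}"
  proof -
    have "\<bar>m i\<bar> < 2 ^ b i" using b by blast
    also have "(2::int) ^ b i \<le> 2 ^ bit_precision d m" using le[OF that] by (intro power_increasing) auto
    finally show ?thesis .
  qed
qed

section \<open>Problem instances and magnitude bounds\<close>

locale lassp_input =
  fixes d k \<Delta> :: nat and m :: "nat \<Rightarrow> int" and \<gamma> :: nat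
  assumes k: "1 \<le> k" and feasible: "sparse_separated d k \<Delta> \<noteq> {}" and gamma: "\<gamma> = bit_precision d m"
begin

definition e :: nat where "e = \<Delta> - 1"
definition Q :: int where "Q = 2 ^ \<gamma> * int d"
text \<open>All magnitudes are measured in powers of \<open>Q\<close>: weights are at most
  \<open>Q ^ 5\<close>, \<open>R\<close> at most \<open>Q ^ 7\<close>, scaled multipliers at most
  \<open>Q ^ 11\<close> and table entries at most \<open>Q ^ 13\<close>. The exponent 15 leaves
  slack.\<close>

definition M :: int where "M = max (int \<Delta>) (Q ^ 15)"
definition c :: "nat \<Rightarrow> int" where "c i = (m i)\<^sup>2"
definition wt :: "(nat \<Rightarrow> int) \<Rightarrow> nat \<Rightarrow> int" where "wt X i = int d ^ 4 * c i + X i"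
definition R :: "(nat \<Rightarrow> int) \<Rightarrow> int" where "R X = 1 + (\<Sum>i\<in>{1..d}. wt X i)"
definition samples :: "(nat \<Rightarrow> int) set" where "samples = {X. \<forall>i\<in>{1..d}. X i \<in> {0..<int d ^ 3}}"

lemma d_ge: "k \<le> d" "1 \<le> d"
proof -
  show "k \<le> d" using feasible card_separated_le by (auto simp: sparse_separated_def)
  then show "1 \<le> d" using k by simp
qed

lemma gamma_ge: "1 \<le> \<gamma>"
  unfolding gamma using d_ge(2) by (rule bit_precision_bounds)

lemma m_less: "i \<in> {1..d} \<Longrightarrow> \<bar>m i\<bar> < 2 ^ \<gamma>"
  unfolding gamma using d_ge(2) by (rule bit_precision_bounds)

lemma Q_ge: "2 \<le> Q" "int d \<le> Q" "2 ^ \<gamma> \<le> Q"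
proof -
  have "(2::int) ^ 1 \<le> 2 ^ \<gamma>" using gamma_ge by (intro power_increasing) auto
  then have g: "(2::int) \<le> 2 ^ \<gamma>" by simp
  show "2 ^ \<gamma> \<le> Q" unfolding Q_def using d_ge mult_left_mono[of 1 "int d" "2 ^ \<gamma>"] by simp
  then show "2 \<le> Q" using g by simp
  show "int d \<le> Q" unfolding Q_def using g mult_right_mono[of 1 "2 ^ \<gamma>" "int d"] by simp
qed

lemma Q_power_mono: "i \<le> j \<Longrightarrow> Q ^ i \<le> Q ^ j"
  using Q_ge(1) by (intro power_increasing) auto

lemma Q_power_ge: "1 \<le> Q ^ i"
  using Q_ge(1) by (intro one_le_power) auto

text \<open>Every factor 2 is paid with one more power of \<open>Q\<close>, which keeps the later
  estimates free of constants.\<close>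

lemma Q_power_double: "2 * Q ^ i \<le> Q ^ Suc i"
  using Q_ge(1) Q_power_ge[of i] by (simp add: mult_right_mono)

lemma d_power_le: "int d ^ i \<le> Q ^ i"
  using Q_ge(2) by (intro power_mono) auto

lemma wt_bounds:
  assumes "X \<in> samples" "i \<in> {1..d}"
  shows "0 \<le> wt X i" "wt X i \<le> Q ^ 5"
proof -
  have X: "0 \<le> X i" "X i < int d ^ 3" using assms by (auto simp: samples_def)
  show "0 \<le> wt X i" using X by (simp add: wt_def c_def)
  have "c i \<le> (2 ^ \<gamma>)\<^sup>2"
    unfolding c_def using m_less[OF assms(2)] by (intro abs_le_square_iff[THEN iffD1]) simp
  then have "int d ^ 4 * c i \<le> int d ^ 4 * (2 ^ \<gamma>)\<^sup>2" by (intro mult_left_mono) auto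
  also have "\<dots> \<le> int d ^ 4 * (2 ^ \<gamma>) ^ 4" by (intro mult_left_mono power_increasing) auto
  also have "\<dots> = Q ^ 4" by (simp add: Q_def power_mult_distrib)
  finally have "wt X i \<le> Q ^ 4 + Q ^ 3"
    using X d_power_le[of 3] by (simp add: wt_def)
  also have "\<dots> \<le> 2 * Q ^ 4" using Q_power_mono[of 3 4] by simp
  also have "\<dots> \<le> Q ^ 5" using Q_power_double[of 4] by simp
  finally show "wt X i \<le> Q ^ 5" .
qed

lemma R_bounds:
  assumes "X \<in> samples"
  shows "1 \<le> R X" "R X \<le> Q ^ 7" "i \<in> {1..d} \<Longrightarrow> wt X i < R X"
    "j \<le> d \<Longrightarrow> 1 + (\<Sum>i\<in>{1..j}. wt X i) \<le> R X"
proof -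
  show "1 \<le> R X" unfolding R_def using sum_nonneg[of "{1..d}" "wt X"] wt_bounds[OF assms] by simp
  have "(\<Sum>i\<in>{1..d}. wt X i) \<le> (\<Sum>i\<in>{1..d}. Q ^ 5)" using wt_bounds[OF assms] by (intro sum_mono)
  also have "\<dots> = int d * Q ^ 5" by simp
  also have "\<dots> \<le> Q * Q ^ 5" using Q_ge Q_power_ge[of 5] by (intro mult_right_mono) auto
  also have "Q * Q ^ 5 = Q ^ 6" by (simp add: eval_nat_numeral)
  finally have "R X \<le> 2 * Q ^ 6" unfolding R_def using Q_power_ge[of 6] by simp
  also have "\<dots> \<le> Q ^ 7" using Q_power_double[of 6] by simp
  finally show "R X \<le> Q ^ 7" .
  show "1 + (\<Sum>i\<in>{1..j}. wt X i) \<le> R X" if "j \<le> d" for j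
    unfolding R_def using wt_bounds[OF assms] that by (auto intro!: sum_mono2)
  show "wt X i < R X" if "i \<in> {1..d}"
    unfolding R_def using member_le_sum[OF that, of "wt X"] wt_bounds[OF assms] by force
qed

lemma Q_power_le_M: "i \<le> 15 \<Longrightarrow> Q ^ i \<le> M"
  unfolding M_def using Q_power_mono[of i 15] by simp

lemma small_le_M: "int d \<le> M" "int d ^ 3 \<le> M" "2 ^ \<gamma> \<le> M" "2 \<le> M" "int e + 1 \<le> M" "int \<Delta> \<le> M"
proof -
  have "Q ^ 1 \<le> M" by (rule Q_power_le_M) simp
  then show "int d \<le> M" "2 ^ \<gamma> \<le> M" "2 \<le> M" using Q_ge by auto
  show "int d ^ 3 \<le> M" using d_power_le[of 3] Q_power_le_M[of 3] by simp
  show "int \<Delta> \<le> M" by (simp add: M_def)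
  moreover have "int e + 1 = max (int \<Delta>) 1" by (auto simp: e_def)
  ultimately show "int e + 1 \<le> M" using \<open>2 \<le> M\<close> by simp
qed

text \<open>A bound for \<open>q\<close>: multipliers lie within \<open>R X + 1\<close> of 0, and
  the last summand makes room for the \<open>- 1\<close> of the final table run.\<close>

definition lim :: "(nat \<Rightarrow> int) \<Rightarrow> int" where "lim X = (int d + 1) * (R X + 1) + 1"

lemma lim_le_M:
  assumes "X \<in> samples"
  shows "0 \<le> lim X" "int d * (2 * lim X) \<le> Q ^ 13" "lim X \<le> M"
proof -
  have R: "1 \<le> R X" "R X \<le> Q ^ 7" using R_bounds[OF assms] by auto
  have "2 * Q \<le> Q * Q" using Q_ge by (intro mult_right_mono) auto
  then have d: "int d + 1 \<le> Q ^ 2" using Q_ge unfolding power2_eq_square by linarith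
  have "R X + 1 \<le> 2 * Q ^ 7" using R(2) Q_power_ge[of 7] by simp
  also have "\<dots> \<le> Q ^ 8" using Q_power_double[of 7] by simp
  finally have "(int d + 1) * (R X + 1) \<le> Q ^ 2 * Q ^ 8"
    using d R by (intro mult_mono) auto
  also have "\<dots> = Q ^ 10" by (simp flip: power_add)
  finally have "lim X \<le> 2 * Q ^ 10" unfolding lim_def using Q_power_ge[of 10] by simp
  also have "\<dots> \<le> Q ^ 11" using Q_power_double[of 10] by simp
  finally have l: "lim X \<le> Q ^ 11" .
  then show "lim X \<le> M" using Q_power_le_M[of 11] by simp
  show n: "0 \<le> lim X" unfolding lim_def using R by simp
  have "2 * lim X \<le> 2 * Q ^ 11" using l by simp
  also have "\<dots> \<le> Q ^ 12" using Q_power_double[of 11] by simp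
  finally have "int d * (2 * lim X) \<le> Q * Q ^ 12" using Q_ge n by (intro mult_mono) auto
  then show "int d * (2 * lim X) \<le> Q ^ 13" by (simp add: eval_nat_numeral)
qed

lemma dp_le_M:
  assumes X: "X \<in> samples" and q: "\<bar>q\<bar> \<le> lim X" and i: "i \<le> d"
  shows "dp (\<lambda>i. (int d + 1) * wt X i - q) e i \<le> M"
proof -
  have "dp (\<lambda>i. (int d + 1) * wt X i - q) e i \<le> int i * (2 * lim X)"
  proof (rule dp_le)
    fix j assume "j \<in> {1..i}"
    then have "wt X j < R X" using R_bounds(3)[OF X] i by auto
    then have "(int d + 1) * wt X j \<le> (int d + 1) * (R X + 1)" by (intro mult_left_mono) auto
    also have "\<dots> \<le> lim X" by (simp add: lim_def)
    finally show "(int d + 1) * wt X j - q \<le> 2 * lim X" using q by linarith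
  qed (use lim_le_M[OF X] in simp)
  also have "\<dots> \<le> int d * (2 * lim X)" using i lim_le_M[OF X] by (intro mult_right_mono) auto
  also have "\<dots> \<le> Q ^ 13" by (rule lim_le_M[OF X])
  also have "\<dots> \<le> M" by (rule Q_power_le_M) simp
  finally show ?thesis .
qed

text \<open>\<open>Delta\<close> is already normalized. The zeros of \<open>F\<close> at indices up
  to 0 belong to the invariant because \<open>dp_prog\<close> reads them as empty prefixes.\<close>

definition inputs :: "store \<Rightarrow> bool" where
  "inputs s \<longleftrightarrow> s ''d'' 0 = int d \<and> s ''k'' 0 = int k \<and> s ''Delta'' 0 = int e + 1 \<and>
     (\<forall>i\<in>{1..d}. s ''x'' (int i) = m i) \<and> (\<forall>j\<le>0. s ''F'' j = 0)"

lemma wp_weights_prog: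
  assumes X: "X \<in> samples" and s: "inputs s" "\<And>i. i \<in> {1..d} \<Longrightarrow> s ''X'' (int i) = X i"
    and T: "8 * d + 5 \<le> T"
  shows "wp (bounded_store M) weights_prog T (\<lambda>s'. same_except {''i'', ''R'', ''ct'', ''S''} s s' \<and>
     s' ''R'' 0 = R X \<and> (\<forall>i\<in>{1..d}. s' ''ct'' (int i) = wt X i \<and> s' ''S'' (int i) = 0)) s"
proof -
  define I where "I j t \<longleftrightarrow> j \<le> d \<and> t ''i'' 0 = int d - int j \<and>
    same_except {''i'', ''R'', ''ct'', ''S''} s t \<and> t ''R'' 0 = 1 + (\<Sum>i\<in>{1..d - j}. wt X i) \<and>
    (\<forall>i\<in>{1..d - j}. t ''ct'' (int i) = wt X i \<and> t ''S'' (int i) = 0)" for j :: nat and t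
  note upd_apply [simp]
  have sd: "s ''d'' 0 = int d" using s by (simp add: inputs_def)
  show ?thesis
    unfolding weights_prog_def
  proof (rule wp_bounded_assign_seq[where i = 0 and v = 0], goal_cases)
    case 5
    show ?case
    proof (rule wp_bounded_assign_seq[where i = 0 and v = 1], goal_cases)
      case 5
      show ?case
      proof (rule wp_while[where I = I and j = d and C = 7], goal_cases)
        case (1 j t)
        then have I: "Suc j \<le> d" "t ''i'' 0 = int d - int (Suc j)"
          "same_except {''i'', ''R'', ''ct'', ''S''} s t" "t ''R'' 0 = 1 + (\<Sum>i\<in>{1..d - Suc j}. wt X i)"
          "\<forall>i\<in>{1..d - Suc j}. t ''ct'' (int i) = wt X i \<and> t ''S'' (int i) = 0"
          by (auto simp: I_def)
        define n where "n = d - Suc j"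
        have n: "int d - int j = int n + 1" "n < d" "d - j = Suc n" "int d - int (Suc j) = int n"
          using I(1) by (auto simp: n_def)
        note I' = I[unfolded n(4), folded n_def]
        have tv: "t ''d'' 0 = int d" "t ''x'' = s ''x''" "t ''X'' = s ''X''"
          using sd same_exceptD[OF I(3)] by auto
        have xX: "s ''x'' (int n + 1) = m (Suc n)" "s ''X'' (int n + 1) = X (Suc n)"
          using s(1)[unfolded inputs_def] s(2)[of "Suc n"] n(2)
          by (auto dest!: bspec[of _ _ "Suc n"] simp: add.commute)
        have wt: "int d * int d * (int d * int d) * (m (Suc n) * m (Suc n)) + X (Suc n) = wt X (Suc n)"
          by (simp add: wt_def c_def power2_eq_square eval_nat_numeral)
        have "0 \<le> wt X (Suc n)" "wt X (Suc n) \<le> Q ^ 5" using wt_bounds[OF X, of "Suc n"] n by auto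
        then have b1: "\<bar>wt X (Suc n)\<bar> \<le> M" using Q_power_le_M[of 5] by simp
        have "1 + (\<Sum>i\<in>{1..Suc n}. wt X i) \<le> R X" using R_bounds(4)[OF X, of "Suc n"] n by auto
        also have "\<dots> \<le> M" using R_bounds(2)[OF X] Q_power_le_M[of 7] by simp
        finally have "1 + (\<Sum>i\<in>{1..Suc n}. wt X i) \<le> M" .
        moreover have "0 \<le> (\<Sum>i\<in>{1..Suc n}. wt X i)" using wt_bounds[OF X] n by (intro sum_nonneg) auto
        ultimately have b2: "\<bar>1 + (\<Sum>i\<in>{1..n}. wt X i) + wt X (Suc n)\<bar> \<le> M" by simp
        show ?case
        proof (rule wp_bounded_assign_seq[where i = 0 and v = "int n + 1"], goal_cases)
          case 5
          define t1 where "t1 = upd t ''i'' 0 (int n + 1)"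
          define t2 where "t2 = upd t1 ''ct'' (int n + 1) (wt X (Suc n))"
          define t3 where "t3 = upd t2 ''R'' 0 (1 + (\<Sum>i\<in>{1..n}. wt X i) + wt X (Suc n))"
          define t4 where "t4 = upd t3 ''S'' (int n + 1) 0"
          have "t4 ''ct'' (int i) = wt X i \<and> t4 ''S'' (int i) = 0" if "i \<in> {1..Suc n}" for i
          proof (cases "i = Suc n")
            case False
            then have "i \<in> {1..n}" using that by auto
            then show ?thesis using I'(5) False by (simp add: t4_def t3_def t2_def t1_def)
          qed (simp add: t4_def t3_def t2_def t1_def)
          moreover have "same_except {''i'', ''R'', ''ct'', ''S''} s t4"
            unfolding t4_def t3_def t2_def t1_def using I'(3) by (intro same_except_upd) simp_all
          moreover have "t4 ''i'' 0 = int n + 1" "t4 ''R'' 0 = 1 + (\<Sum>i\<in>{1..Suc n}. wt X i)"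
            by (simp_all add: t4_def t3_def t2_def t1_def)
          ultimately have "I j t4"
            unfolding I_def n(1,3) using I(1) by simp
          then show ?case
            using tv xX wt b1 b2 I'(4) small_le_M(4) unfolding t1_def t2_def t3_def t4_def
            by (intro wp_bounded_assign_seq[where i = "int n + 1" and v = "wt X (Suc n)"]
              wp_bounded_assign_seq[where i = 0 and v = "1 + (\<Sum>i\<in>{1..n}. wt X i) + wt X (Suc n)"]
              wp_bounded_assign[where i = "int n + 1" and v = 0]) simp_all
        qed (use I'(2) n(2) small_le_M(1) in simp_all)
      next
        case (2 t)
        then show ?case
          using sd same_exceptD[of _ s t "''d''"] by (auto simp: I_def)
      next
        case (3 j t)
        then show ?case
          using sd same_exceptD[of _ s t "''d''"] by (auto simp: I_def R_def)
      next
        case 4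
        show ?case by (auto simp: I_def same_except_upd same_except_refl)
      qed (use T in simp)
    qed (use small_le_M T in simp_all)
  qed (use small_le_M T in simp_all)
qed

section \<open>The search interval for the multiplier\<close>

abbreviation relaxed_value :: "(nat \<Rightarrow> int) \<Rightarrow> int \<Rightarrow> real" where
  "relaxed_value X l \<equiv> ProjLagr_value d k \<Delta> (real_of_int l) (\<lambda>i. real_of_int (wt X i))"

lemma sum_wt_bounds:
  assumes X: "X \<in> samples" and S: "S \<in> separated d \<Delta>"
  shows "0 \<le> (\<Sum>i\<in>S. real_of_int (wt X i))" "(\<Sum>i\<in>S. real_of_int (wt X i)) \<le> real_of_int (R X) - 1"
proof -
  have sub: "S \<subseteq> {1..d}" using S by (simp add: separated_iff)
  then have "0 \<le> sum (wt X) S" using wt_bounds[OF X] by (intro sum_nonneg) auto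
  then show "0 \<le> (\<Sum>i\<in>S. real_of_int (wt X i))" by (simp flip: of_int_sum)
  have "sum (wt X) S \<le> R X - 1"
    unfolding R_def using sub wt_bounds[OF X] by (auto intro!: sum_mono2)
  then have "real_of_int (sum (wt X) S) \<le> real_of_int (R X - 1)" by (rule of_int_le_iff[THEN iffD2])
  then show "(\<Sum>i\<in>S. real_of_int (wt X i)) \<le> real_of_int (R X) - 1" by simp
qed

text \<open>At \<open>R X\<close> one chosen element costs more than all weights together, so the
  empty set is optimal; its slope is \<open>k \<ge> 1\<close>.\<close>

lemma search_upper_end:
  assumes X: "X \<in> samples"
  shows "relaxed_value X (R X) < relaxed_value X (R X + 1)"
proof -
  let ?r = "real_of_int (R X)"
  obtain S where S: "S \<in> separated d \<Delta>"
    "lagr_obj k ?r (\<lambda>i. real_of_int (wt X i)) S = relaxed_value X (R X)"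
    by (rule ProjLagr_value_attained)
  have r: "1 \<le> ?r" using R_bounds(1)[OF X] by simp
  have "relaxed_value X (R X) \<le> ?r * real k"
  proof (cases "S = {}")
    case True
    then show ?thesis using S by (simp add: lagr_obj_def)
  next
    case False
    then have "1 \<le> real (card S)" using S finite_in_separated by (simp add: Suc_le_eq card_gt_0_iff)
    then have "?r * 1 \<le> ?r * real (card S)" using r by (intro mult_left_mono) auto
    then show ?thesis using S sum_wt_bounds(2)[OF X S(1)]
      by (simp add: lagr_obj_def algebra_simps)
  qed
  also have "\<dots> < (?r + 1) * real k" using k by (simp add: algebra_simps)
  also have "\<dots> \<le> relaxed_value X (R X + 1)"
    using lagr_obj_le_value[OF empty_separated, of k "?r + 1" "\<lambda>i. real_of_int (wt X i)" d \<Delta>]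
    by (simp add: lagr_obj_def)
  finally show ?thesis .
qed

text \<open>At \<open>- R X\<close> each missing element forgoes more than all weights together. As
  size \<open>k\<close> is attainable, an optimal set has at least \<open>k\<close> elements; its
  slope is not positive, so the value does not drop towards the left.\<close>

lemma search_lower_end:
  assumes X: "X \<in> samples"
  shows "\<not> relaxed_value X (- 1 - R X) < relaxed_value X (- R X)"
proof -
  let ?r = "real_of_int (R X)"
  obtain S where S: "S \<in> separated d \<Delta>"
    "lagr_obj k (- ?r) (\<lambda>i. real_of_int (wt X i)) S = ProjLagr_value d k \<Delta> (- ?r) (\<lambda>i. real_of_int (wt X i))"
    by (rule ProjLagr_value_attained)
  obtain T where T: "T \<in> separated d \<Delta>" "card T = k"
    using feasible by (auto simp: sparse_separated_def)
  have "0 \<le> lagr_obj k (- ?r) (\<lambda>i. real_of_int (wt X i)) T"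
    using T sum_wt_bounds(1)[OF X T(1)] by (simp add: lagr_obj_def)
  also have "\<dots> \<le> lagr_obj k (- ?r) (\<lambda>i. real_of_int (wt X i)) S"
    unfolding S(2) by (rule lagr_obj_le_value[OF T(1)])
  finally have *: "?r * (real k - real (card S)) \<le> ?r - 1"
    using sum_wt_bounds(2)[OF X S(1)] by (simp add: lagr_obj_def)
  have "k \<le> card S"
  proof (rule ccontr)
    assume "\<not> k \<le> card S"
    then have "1 \<le> real k - real (card S)" by simp
    then have "?r * 1 \<le> ?r * (real k - real (card S))"
      using R_bounds(1)[OF X] by (intro mult_left_mono) auto
    then show False using * by simp
  qed
  then have "lagr_obj k (- ?r) (\<lambda>i. real_of_int (wt X i)) S
      \<le> lagr_obj k (- 1 - ?r) (\<lambda>i. real_of_int (wt X i)) S"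
    by (simp add: lagr_obj_def algebra_simps)
  also have "\<dots> \<le> ProjLagr_value d k \<Delta> (- 1 - ?r) (\<lambda>i. real_of_int (wt X i))"
    by (rule lagr_obj_le_value[OF S(1)])
  finally show ?thesis using S(2) by simp
qed

lemma relaxed_value_dp:
  "(real d + 1) * relaxed_value X l =
     real_of_int (dp (\<lambda>i. (int d + 1) * wt X i - (int d + 1) * l) e d + (int d + 1) * l * int k)"
proof -
  have "real_of_int ((int d + 1) * l) / (real d + 1) = real_of_int l"
    by (simp add: field_simps)
  then show ?thesis
    using ProjLagr_dp(2)[of d "\<lambda>i. (int d + 1) * wt X i - (int d + 1) * l" "wt X" "(int d + 1) * l" k \<Delta>]
    unfolding e_def by simp
qed

text \<open>Reduces the comparison of real optimal values to the integer test of
  \<open>compare_prog\<close>.\<close>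

lemma relaxed_value_less_iff:
  "relaxed_value X l < relaxed_value X l' \<longleftrightarrow>
     dp (\<lambda>i. (int d + 1) * wt X i - (int d + 1) * l) e d + (int d + 1) * l * int k
     < dp (\<lambda>i. (int d + 1) * wt X i - (int d + 1) * l') e d + (int d + 1) * l' * int k"
proof -
  have "relaxed_value X l < relaxed_value X l' \<longleftrightarrow>
      (real d + 1) * relaxed_value X l < (real d + 1) * relaxed_value X l'"
    by (simp add: mult_less_cancel_left)
  then show ?thesis unfolding relaxed_value_dp of_int_less_iff .
qed

lemma lim_ge:
  assumes "X \<in> samples" "- R X - 1 \<le> l" "l \<le> R X + 1"
  shows "\<bar>(int d + 1) * l\<bar> < lim X"
proof -
  have "\<bar>(int d + 1) * l\<bar> = (int d + 1) * \<bar>l\<bar>" by (simp add: abs_mult)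
  also have "\<dots> \<le> (int d + 1) * (R X + 1)" using assms by (intro mult_left_mono) auto
  finally show ?thesis by (simp add: lim_def)
qed

section \<open>Table runs and binary search\<close>

definition ready :: "(nat \<Rightarrow> int) \<Rightarrow> store \<Rightarrow> bool" where
  "ready X s \<longleftrightarrow> inputs s \<and> (\<forall>i\<in>{1..d}. s ''ct'' (int i) = wt X i)"

lemma wp_dp_ready:
  assumes X: "X \<in> samples" and s: "ready X s" and q: "s ''q'' 0 = q" "\<bar>q\<bar> \<le> lim X"
    and T: "5 * d + 3 \<le> T"
  shows "wp (bounded_store M) dp_prog T (\<lambda>s'. same_except {''F'', ''i''} s s' \<and> ready X s' \<and>
      (\<forall>j\<le>d. s' ''F'' (int j) = dp (\<lambda>i. (int d + 1) * wt X i - q) e j)) s"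
proof -
  have inp: "s ''d'' 0 = int d" "s ''k'' 0 = int k" "s ''Delta'' 0 = int e + 1"
    "\<forall>i\<in>{1..d}. s ''x'' (int i) = m i" "\<forall>j\<le>0. s ''F'' j = 0"
    "\<forall>i\<in>{1..d}. s ''ct'' (int i) = wt X i"
    using s by (auto simp: ready_def inputs_def)
  have "wp (bounded_store M) dp_prog T (\<lambda>s'. same_except {''F'', ''i''} s s' \<and>
      (\<forall>j\<le>0. s' ''F'' j = 0) \<and>
      (\<forall>j\<le>d. s' ''F'' (int j) = dp (\<lambda>i. (int d + 1) * wt X i - q) e j)) s"
  proof (rule wp_dp_prog)
    show "dp (\<lambda>i. (int d + 1) * wt X i - q) e i \<le> M" if "i \<le> d" for i
      using X q(2) that by (rule dp_le_M)
    show "s ''ct'' (int i) = wt X i" if "i \<in> {1..d}" for i using inp that by blast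
    show "s ''F'' j = 0" if "j \<le> 0" for j using inp that by blast
  qed (use inp q(1) T small_le_M(1) in simp_all)
  then show ?thesis
  proof (rule wp_mono)
    fix s' assume *: "same_except {''F'', ''i''} s s' \<and> (\<forall>j\<le>0. s' ''F'' j = 0) \<and>
        (\<forall>j\<le>d. s' ''F'' (int j) = dp (\<lambda>i. (int d + 1) * wt X i - q) e j)"
    then have "s' ''d'' = s ''d''" "s' ''k'' = s ''k''" "s' ''Delta'' = s ''Delta''"
      "s' ''x'' = s ''x''" "s' ''ct'' = s ''ct''"
      by (auto intro!: same_exceptD[of "{''F'', ''i''}" s s'])
    then have "ready X s'" using * inp by (simp add: ready_def inputs_def)
    with * show "same_except {''F'', ''i''} s s' \<and> ready X s' \<and>
        (\<forall>j\<le>d. s' ''F'' (int j) = dp (\<lambda>i. (int d + 1) * wt X i - q) e j)" by blast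
  qed simp
qed

lemma ready_upd:
  assumes "ready X s" "x \<notin> {''d'', ''k'', ''Delta'', ''x'', ''F'', ''ct''}"
  shows "ready X (upd s x i v)"
proof -
  have "upd s x i v y = s y" if "y \<in> {''d'', ''k'', ''Delta'', ''x'', ''F'', ''ct''}" for y
  proof -
    have "y \<noteq> x" using that assms(2) by blast
    then show ?thesis by (simp only: upd_apply if_False)
  qed
  then show ?thesis
    using assms(1) unfolding ready_def inputs_def by (metis insertCI)
qed

text \<open>Two table runs, for \<open>md\<close> and \<open>md + 1\<close>, dominate the cost; the
  sign of the discrete slope at \<open>md\<close> decides which half of the interval
  survives.\<close>

lemma wp_search_body:
  assumes X: "X \<in> samples" and t: "ready X t" "t ''lo'' 0 = lo" "t ''hi'' 0 = hi"
    and lohi: "lo + 1 < hi" "- R X - 1 \<le> lo" "hi \<le> R X"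
  defines "md \<equiv> (lo + hi) div 2"
  shows "wp (bounded_store M) search_body (10 * d + 18)
    (\<lambda>s'. same_except {''mid'', ''q'', ''v'', ''F'', ''i'', ''lo'', ''hi''} t s' \<and> ready X s' \<and>
      (if relaxed_value X md < relaxed_value X (md + 1)
       then s' ''lo'' 0 = lo \<and> s' ''hi'' 0 = md else s' ''lo'' 0 = md \<and> s' ''hi'' 0 = hi)) t"
proof -
  note upd_apply [simp]
  let ?D = "\<lambda>l. dp (\<lambda>i. (int d + 1) * wt X i - (int d + 1) * l) e d"
  have md: "lo < md" "md < hi" using lohi by (auto simp: md_def)
  have RM: "R X + 1 \<le> M" using R_bounds(2)[OF X] Q_power_double[of 7] Q_power_ge[of 7] Q_power_le_M[of 8] by simp
  have mdM: "\<bar>md\<bar> \<le> M" using md lohi RM by auto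
  have q1: "\<bar>(int d + 1) * md\<bar> < lim X" and q2: "\<bar>(int d + 1) * (md + 1)\<bar> < lim X"
    using md lohi by (auto intro!: lim_ge[OF X])
  define t2 where "t2 = upd (upd t ''mid'' 0 md) ''q'' 0 ((int d + 1) * md)"
  have rt2: "ready X t2" unfolding t2_def using t(1) by (intro ready_upd) auto
  have dt: "ready X s \<Longrightarrow> s ''d'' 0 = int d" "ready X s \<Longrightarrow> s ''k'' 0 = int k" for s
    by (auto simp: ready_def inputs_def)
  have DM: "\<bar>?D md\<bar> \<le> M"
    using dp_le_M[OF X, of "(int d + 1) * md" d] q1 dp_nonneg[of _ e d] by simp
  define Post where "Post s' \<longleftrightarrow>
      same_except {''mid'', ''q'', ''v'', ''F'', ''i'', ''lo'', ''hi''} t s' \<and> ready X s' \<and>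
      (if relaxed_value X md < relaxed_value X (md + 1)
       then s' ''lo'' 0 = lo \<and> s' ''hi'' 0 = md else s' ''lo'' 0 = md \<and> s' ''hi'' 0 = hi)" for s'
  have compare: "wp (bounded_store M) compare_prog 2 Post u"
    if u: "ready X u" "same_except {''mid'', ''q'', ''v'', ''F'', ''i''} t u" "u ''mid'' 0 = md"
      "u ''v'' 0 = ?D md" "u ''q'' 0 = (int d + 1) * (md + 1)" "u ''F'' (int d) = ?D (md + 1)" for u
  proof -
    have same: "same_except {''mid'', ''q'', ''v'', ''F'', ''i'', ''lo'', ''hi''} t (upd u x 0 md)"
      if "x \<in> {''lo'', ''hi''}" for x
      using same_except_trans[OF u(2) same_except_refl[of "{}" u]] that
      by (intro same_except_upd) auto
    have lh: "u ''lo'' 0 = lo" "u ''hi'' 0 = hi"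
      using same_exceptD[OF u(2)] t by auto
    show ?thesis
      unfolding compare_prog_def
    proof (rule wp_if, goal_cases)
      case 2
      then have "relaxed_value X md < relaxed_value X (md + 1)"
        unfolding relaxed_value_less_iff using dt[OF u(1)] u by simp
      then show ?case
        using u(3) mdM ready_upd[OF u(1), of "''hi''"] same[of "''hi''"] lh
        by (intro wp_bounded_assign[where i = 0 and v = md]) (auto simp: Post_def)
    next
      case 3
      then have "\<not> relaxed_value X md < relaxed_value X (md + 1)"
        unfolding relaxed_value_less_iff using dt[OF u(1)] u by simp
      then show ?case
        using u(3) mdM ready_upd[OF u(1), of "''lo''"] same[of "''lo''"] lh
        by (intro wp_bounded_assign[where i = 0 and v = md]) (auto simp: Post_def)
    qed simp
  qed
  show ?thesis
    unfolding search_body_def Post_def[symmetric]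
  proof (rule wp_bounded_assign_seq[where i = 0 and v = md], goal_cases)
    case 5
    show ?case
    proof (rule wp_bounded_assign_seq[where i = 0 and v = "(int d + 1) * md"], goal_cases)
      case 5
      show ?case unfolding t2_def[symmetric]
      proof (rule wp_seq[OF wp_dp_ready[OF X rt2, of "(int d + 1) * md" "5 * d + 3"]], goal_cases)
        case (4 u)
        then have u: "ready X u" "same_except {''F'', ''i''} t2 u" "u ''F'' (int d) = ?D md" by auto
        have um: "u ''mid'' 0 = md" using same_exceptD[OF u(2), of "''mid''"] by (simp add: t2_def)
        define u2 where "u2 = upd (upd u ''v'' 0 (?D md)) ''q'' 0 ((int d + 1) * (md + 1))"
        have ru2: "ready X u2" unfolding u2_def using u(1) by (intro ready_upd) auto
        have "same_except {''mid'', ''q''} t t2"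
          unfolding t2_def by (intro same_except_upd same_except_refl) auto
        then have "same_except {''mid'', ''q'', ''v'', ''F'', ''i''} t u"
          by (rule same_except_trans[OF _ u(2)]) auto
        then have su: "same_except {''mid'', ''q'', ''v'', ''F'', ''i''} t u2"
          unfolding u2_def by (intro same_except_upd) auto
        show ?case
        proof (rule wp_bounded_assign_seq[where i = 0 and v = "?D md"], goal_cases)
          case 5
          show ?case
          proof (rule wp_bounded_assign_seq[where i = 0 and v = "(int d + 1) * (md + 1)"], goal_cases)
            case 5
            show ?case unfolding u2_def[symmetric]
            proof (rule wp_seq[OF wp_dp_ready[OF X ru2, of "(int d + 1) * (md + 1)" "5 * d + 3"]], goal_cases)
              case (4 s')
              have "s' ''mid'' = u2 ''mid''" "s' ''v'' = u2 ''v''" "s' ''q'' = u2 ''q''"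
                using 4 same_exceptD[of "{''F'', ''i''}" u2 s'] by auto
              moreover have "same_except {''mid'', ''q'', ''v'', ''F'', ''i''} t s'"
                using 4 same_except_trans[OF su] by auto
              ultimately have "wp (bounded_store M) compare_prog 2 Post s'"
                using 4 um by (intro compare) (auto simp: u2_def)
              then show ?case by (rule wp_mono) auto
            qed (use q2 in \<open>auto simp: u2_def\<close>)
          qed (use dt[OF u(1)] um q2 lim_le_M(3)[OF X] in auto)
        qed (use dt[OF u(1)] u(3) DM in auto)
      qed (use q1 in \<open>auto simp: t2_def\<close>)
    qed (use dt[OF t(1)] q1 lim_le_M(3)[OF X] in auto)
  qed (use t mdM in \<open>auto simp: md_def\<close>)
qed

text \<open>The initial interval has length \<open>2 * R X + 1 \<le> Q ^ 9\<close>, and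
  \<open>Q\<close> is at most 2 to the power in parentheses.\<close>

definition search_steps :: nat where
  "search_steps = 9 * (\<gamma> + nat \<lceil>log 2 (real d)\<rceil>)"

lemma search_range:
  assumes "X \<in> samples"
  shows "2 * R X + 1 \<le> 2 ^ search_steps"
proof -
  let ?L = "nat \<lceil>log 2 (real d)\<rceil>"
  have "real d = 2 powr (log 2 (real d))" using d_ge by simp
  also have "\<dots> \<le> 2 powr (real ?L)" by (intro powr_mono) (auto simp: real_nat_ceiling_ge)
  also have "\<dots> = real (2 ^ ?L)" by (simp add: powr_realpow)
  finally have "d \<le> 2 ^ ?L" by (simp only: of_nat_le_iff)
  then have "int d \<le> 2 ^ ?L" by (metis of_nat_le_iff of_nat_numeral of_nat_power)
  then have "Q \<le> 2 ^ (\<gamma> + ?L)" unfolding Q_def power_add by (intro mult_left_mono) auto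
  then have "Q ^ 9 \<le> (2 ^ (\<gamma> + ?L)) ^ 9" using Q_ge by (intro power_mono) auto
  also have "\<dots> = 2 ^ search_steps" unfolding search_steps_def by (simp add: mult.commute flip: power_mult)
  finally have *: "Q ^ 9 \<le> 2 ^ search_steps" .
  have "2 * R X + 1 \<le> 2 * Q ^ 8"
    using R_bounds(2)[OF assms] Q_power_double[of 7] Q_power_ge[of 7] by simp
  also have "\<dots> \<le> Q ^ 9" using Q_power_double[of 8] by simp
  finally show ?thesis using * by simp
qed

lemma wp_search_prog:
  assumes X: "X \<in> samples" and s: "ready X s" "s ''R'' 0 = R X"
    and T: "search_steps * (19 + 10 * d) + 5 \<le> T"
  shows "wp (bounded_store M) search_prog T (\<lambda>s'.
     same_except {''mid'', ''q'', ''v'', ''F'', ''i'', ''lo'', ''hi''} s s' \<and> ready X s' \<and>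
     is_lambda_hat d k \<Delta> (\<lambda>i. real_of_int (wt X i)) (s' ''hi'' 0) \<and>
     - R X - 1 \<le> s' ''hi'' 0 \<and> s' ''hi'' 0 \<le> R X) s"
proof -
  let ?A = "{''mid'', ''q'', ''v'', ''F'', ''i'', ''lo'', ''hi''}"
  \<comment> \<open>The length is at most \<open>2 ^ j\<close>, so \<open>j = 0\<close> falsifies
    the guard. The value rises after \<open>hi\<close> but not after \<open>lo\<close>; once
    \<open>lo = hi - 1\<close>, these are the premises of \<open>is_lambda_hatI\<close> for
    \<open>hi\<close>.\<close>
  define I where "I j t \<longleftrightarrow> same_except ?A s t \<and> ready X t \<and> t ''lo'' 0 < t ''hi'' 0 \<and>
    t ''hi'' 0 - t ''lo'' 0 \<le> 2 ^ j \<and> - R X - 1 \<le> t ''lo'' 0 \<and> t ''hi'' 0 \<le> R X \<and>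
    relaxed_value X (t ''hi'' 0) < relaxed_value X (t ''hi'' 0 + 1) \<and>
    \<not> relaxed_value X (t ''lo'' 0) < relaxed_value X (t ''lo'' 0 + 1)" for j :: nat and t
  note upd_apply [simp]
  have RM: "R X + 1 \<le> M" "1 \<le> R X"
    using R_bounds(1,2)[OF X] Q_power_double[of 7] Q_power_ge[of 7] Q_power_le_M[of 8] by simp_all
  show ?thesis
    unfolding search_prog_def
  proof (rule wp_bounded_assign_seq[where i = 0 and v = "R X"], goal_cases)
    case 5
    show ?case
    proof (rule wp_bounded_assign_seq[where i = 0 and v = "- 1 - R X"], goal_cases)
      case 5
      show ?case
      proof (rule wp_while[where I = I and j = search_steps and C = "10 * d + 18"], goal_cases)
        case (1 j t)
        define lo hi md where "lo = t ''lo'' 0" and "hi = t ''hi'' 0" and "md = (lo + hi) div 2"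
        have I: "same_except ?A s t" "ready X t" "hi - lo \<le> 2 * 2 ^ j" "- R X - 1 \<le> lo" "hi \<le> R X"
          "relaxed_value X hi < relaxed_value X (hi + 1)" "\<not> relaxed_value X lo < relaxed_value X (lo + 1)"
          using 1(1) by (auto simp: I_def lo_def hi_def)
        have lohi: "lo + 1 < hi" using 1(2) by (simp add: lo_def hi_def)
        have md: "lo < md" "md < hi" "md - lo \<le> 2 ^ j" "hi - md \<le> 2 ^ j"
          using lohi I(3) by (auto simp: md_def)
        show ?case
        proof (rule wp_mono[OF wp_search_body[OF X I(2) lo_def[symmetric] hi_def[symmetric] lohi I(4,5)]])
          fix s' assume *: "same_except ?A t s' \<and> ready X s' \<and>
            (if relaxed_value X ((lo + hi) div 2) < relaxed_value X ((lo + hi) div 2 + 1)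
             then s' ''lo'' 0 = lo \<and> s' ''hi'' 0 = (lo + hi) div 2
             else s' ''lo'' 0 = (lo + hi) div 2 \<and> s' ''hi'' 0 = hi)"
          have "same_except ?A s s'" using * by (intro same_except_trans[OF I(1)]) auto
          then show "I j s'"
            using * I(4-7) md unfolding md_def[symmetric] I_def
            by (cases "relaxed_value X md < relaxed_value X (md + 1)") auto
        qed simp
      next
        case (2 t)
        then show ?case by (auto simp: I_def)
      next
        case (3 j t)
        then have "t ''hi'' 0 = t ''lo'' 0 + 1" by (auto simp: I_def)
        then have lo: "t ''lo'' 0 = t ''hi'' 0 - 1" by simp
        have "is_lambda_hat d k \<Delta> (\<lambda>i. real_of_int (wt X i)) (t ''hi'' 0)"
          using 3(1) unfolding I_def lo by (intro is_lambda_hatI) simp_all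
        then show ?case using 3(1) by (simp add: I_def)
      next
        case 4
        let ?t = "upd (upd s ''hi'' 0 (R X)) ''lo'' 0 (- 1 - R X)"
        have "same_except ?A s ?t" by (intro same_except_upd same_except_refl) auto
        moreover have "ready X ?t" using s(1) by (intro ready_upd) auto
        ultimately show ?case
          using search_upper_end[OF X] search_lower_end[OF X] search_range[OF X] RM
          unfolding I_def by simp
      qed (use T in simp)
    qed (use s RM T in simp_all)
  qed (use s RM T in simp_all)
qed

section \<open>Backtracking\<close>

lemma wp_backtrack_prog:
  fixes w :: "nat \<Rightarrow> int"
  assumes s: "s ''d'' 0 = int d" "s ''Delta'' 0 = int e + 1" "\<And>j. j \<le> d \<Longrightarrow> s ''F'' (int j) = dp w e j"
    "\<And>i. i \<in> {1..d} \<Longrightarrow> s ''S'' (int i) = 0"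
    and T: "7 * d + 5 \<le> T"
  shows "wp (bounded_store M) backtrack_prog T (\<lambda>s'. same_except {''cnt'', ''i'', ''S''} s s' \<and>
     s' ''cnt'' 0 = int (card (backtrack w e d)) \<and>
     (\<forall>i\<in>{1..d}. s' ''S'' (int i) = (if i \<in> backtrack w e d then 1 else 0))) s"
proof -
  \<comment> \<open>\<open>A\<close> collects the indices already marked, all above the current one;
    the rest is \<open>backtrack\<close> of the remaining prefix. \<open>j\<close> merely bounds the
    index, since a taken index may skip several places at once.\<close>
  define I where "I j t \<longleftrightarrow> same_except {''cnt'', ''i'', ''S''} s t \<and> nat (t ''i'' 0) \<le> j \<and> j \<le> d \<and>
    (\<exists>A. A \<subseteq> {Suc (nat (t ''i'' 0))..d} \<and> A \<union> backtrack w e (nat (t ''i'' 0)) = backtrack w e d \<and>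
      t ''cnt'' 0 = int (card A) \<and> (\<forall>i\<in>{1..d}. t ''S'' (int i) = (if i \<in> A then 1 else 0)))"
    for j :: nat and t
  note upd_apply [simp]
  have M: "0 \<le> M" "1 \<le> M" using small_le_M(4) by auto
  show ?thesis
    unfolding backtrack_prog_def
  proof (rule wp_bounded_assign_seq[where i = 0 and v = 0], goal_cases)
    case 5
    show ?case
    proof (rule wp_bounded_assign_seq[where i = 0 and v = "int d"], goal_cases)
      case 5
      show ?case
      proof (rule wp_while[where I = I and j = d and C = 6], goal_cases)
        case (1 j t)
        define n where "n = nat (t ''i'' 0) - 1"
        have i: "t ''i'' 0 = int n + 1" "nat (t ''i'' 0) = Suc n" using 1(2) by (auto simp: n_def)
        obtain A where A: "A \<subseteq> {Suc (Suc n)..d}" "A \<union> backtrack w e (Suc n) = backtrack w e d"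
          "t ''cnt'' 0 = int (card A)" "\<forall>i\<in>{1..d}. t ''S'' (int i) = (if i \<in> A then 1 else 0)"
          and same: "same_except {''cnt'', ''i'', ''S''} s t" and j: "n \<le> j" "Suc j \<le> d"
          using 1(1) unfolding I_def i(2) by auto
        have n: "Suc n \<le> d" using j by simp
        have tv: "t ''F'' = s ''F''" "t ''Delta'' 0 = int e + 1"
          using same_exceptD[OF same] s(2) by simp_all
        have F: "s ''F'' (int n) = dp w e n" "s ''F'' (int n + 1) = dp w e (Suc n)"
          using s(3)[of n] s(3)[of "Suc n"] n by (simp_all add: add.commute)
        have finA: "finite A" using A(1) by (rule finite_subset) simp
        have "Suc n \<notin> A" using A(1) by auto
        show ?case
        proof (rule wp_if, goal_cases)
          case 2
          then have lt: "dp w e n < dp w e (Suc n)" using i F tv by simp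
          let ?u = "upd (upd (upd t ''S'' (int n + 1) 1) ''cnt'' 0 (int (card A) + 1)) ''i'' 0 (int n - int e)"
          have nat_eq: "nat (int n - int e) = n - e" by (simp add: nat_diff_distrib')
          have "A \<union> insert (Suc n) (backtrack w e (n - e)) = backtrack w e d"
            using A(2) lt by (simp add: backtrack.simps(2))
          then have "insert (Suc n) A \<union> backtrack w e (n - e) = backtrack w e d" by simp
          moreover have "insert (Suc n) A \<subseteq> {Suc (n - e)..d}"
          proof -
            have "{Suc (Suc n)..d} \<subseteq> {Suc (n - e)..d}" "Suc n \<in> {Suc (n - e)..d}" using n by auto
            then show ?thesis using A(1) by blast
          qed
          moreover have "?u ''cnt'' 0 = int (card (insert (Suc n) A))"
            using finA \<open>Suc n \<notin> A\<close> by simp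
          moreover have "?u ''S'' (int l) = (if l \<in> insert (Suc n) A then 1 else 0)" if "l \<in> {1..d}" for l
            using A(4) that by (cases "l = Suc n") auto
          ultimately have ex: "\<exists>B. B \<subseteq> {Suc (nat (int n - int e))..d} \<and>
              B \<union> backtrack w e (nat (int n - int e)) = backtrack w e d \<and>
              ?u ''cnt'' 0 = int (card B) \<and> (\<forall>i\<in>{1..d}. ?u ''S'' (int i) = (if i \<in> B then 1 else 0))"
            unfolding nat_eq by (intro exI[of _ "insert (Suc n) A"] conjI ballI)
          have "same_except {''cnt'', ''i'', ''S''} s ?u"
            using same by (intro same_except_upd) auto
          then have "I j ?u" using ex j unfolding I_def by simp
          have "card A + 1 \<le> d"
            using card_mono[of "{Suc (Suc n)..d}" A] A(1) n by simp
          then have cM: "\<bar>int (card A) + 1\<bar> \<le> M" using small_le_M(1) by simp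
          have iM: "\<bar>int n - int e\<bar> \<le> M" using n small_le_M(1,5) by simp
          show ?case
          proof (rule wp_bounded_assign_seq[where i = "int n + 1" and v = 1], goal_cases)
            case 5
            show ?case
            proof (rule wp_bounded_assign_seq[where i = 0 and v = "int (card A) + 1"], goal_cases)
              case 5
              show ?case
                using \<open>I j ?u\<close> iM i tv
                by (intro wp_bounded_assign[where i = 0 and v = "int n - int e"]) simp_all
            qed (use A cM in simp_all)
          qed (use i M in simp_all)
        next
          case 3
          then have "\<not> dp w e n < dp w e (Suc n)" using i F tv by simp
          then have "A \<union> backtrack w e n = backtrack w e d"
            using A(2) by (simp add: backtrack.simps(2))
          moreover have "A \<subseteq> {Suc n..d}" using A(1) by auto
          moreover have "same_except {''cnt'', ''i'', ''S''} s (upd t ''i'' 0 (int n))"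
            using same by (intro same_except_upd) auto
          ultimately have "I j (upd t ''i'' 0 (int n))"
            unfolding I_def using A(3,4) j by (intro conjI exI[of _ A]) simp_all
          then show ?case
            using i n small_le_M(1)
            by (intro wp_bounded_assign[where i = 0 and v = "int n"]) simp_all
        qed simp
      next
        case (2 t)
        then show ?case by (simp add: I_def)
      next
        case (3 j t)
        then have "nat (t ''i'' 0) = 0" by simp
        with 3(1) show ?case unfolding I_def by auto
      next
        case 4
        have "same_except {''cnt'', ''i'', ''S''} s (upd (upd s ''cnt'' 0 0) ''i'' 0 (int d))"
          by (intro same_except_upd same_except_refl) auto
        then show ?case unfolding I_def using s(4) by (intro conjI exI[of _ "{}"]) simp_all
      qed (use T in simp)
    qed (use s small_le_M T in simp_all)
  qed (use M T in simp_all)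
qed

end

section \<open>Sampling and repetition\<close>

definition sampled :: "nat \<Rightarrow> nat \<Rightarrow> store \<Rightarrow> (nat \<Rightarrow> int) \<Rightarrow> store" where
  "sampled d a s X = s(''i'' := (s ''i'')(0 := int d),
     ''X'' := (\<lambda>j. if int a < j \<and> j \<le> int d then X (nat j) else s ''X'' j))"

text \<open>Each iteration takes four steps whatever is drawn, so the whole loop is one phase of
  exact length. Successive uniform draws assemble to the product distribution by
  \<open>Pi_pmf_insert'\<close>.\<close>

lemma segment_sample_loop:
  assumes "a \<le> d" "s ''i'' 0 = int a" "s ''d'' 0 = int d" "bounded_store M s"
    and M: "int d \<le> M" "int d ^ 3 \<le> M" and d: "1 \<le> d"
  shows "segment (bounded_store M) (4 * (d - a) + 1) (sample_loop # K, s, h)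
    (map_pmf (\<lambda>X. (K, sampled d a s X, h @ map (\<lambda>i. (int d ^ 3, X i)) [Suc a..<Suc d]))
      (Pi_pmf {Suc a..d} 0 (\<lambda>_. pmf_of_set {0..<int d ^ 3})))"
  using assms(1-4)
proof (induction "d - a" arbitrary: a s h)
  case 0
  then have "a = d" by simp
  have "sampled d d s X = s" for X
    using 0 \<open>a = d\<close> by (auto simp: sampled_def fun_eq_iff)
  moreover have "segment (bounded_store M) 1 (sample_loop # K, s, h) (return_pmf (K, s, h))"
    using 0 \<open>a = d\<close> by (intro segment_step) (auto simp: sample_loop_def)
  ultimately show ?case using \<open>a = d\<close> by simp
next
  case (Suc n)
  then have "a < d" by simp
  note upd_apply [simp]
  let ?b = "''i'' ::= Plus (var ''i'') (N 1)"
  let ?r = "Rand ''X'' (var ''i'') (Times (var ''d'') (Times (var ''d'') (var ''d'')))"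
  let ?P = "pmf_of_set {0..<int d ^ 3}"
  define s1 where "s1 = upd s ''i'' 0 (int a + 1)"
  define s2 where "s2 v = upd s1 ''X'' (int a + 1) v" for v
  have cube: "int d * (int d * int d) = int d ^ 3" by (simp add: power3_eq_cube)
  have pos: "0 < int d ^ 3" using d by simp
  have W1: "bounded_store M s1"
    unfolding s1_def using Suc.prems(4) \<open>a < d\<close> M by (intro bounded_store_upd) auto
  have "segment (bounded_store M) 1 (sample_loop # K, s, h) (return_pmf (Seq ?b ?r # sample_loop # K, s, h))"
    using Suc.prems \<open>a < d\<close> by (intro segment_step) (auto simp: sample_loop_def)
  moreover have "segment (bounded_store M) 1 (Seq ?b ?r # sample_loop # K, s, h)
      (return_pmf (?b # ?r # sample_loop # K, s, h))"
    using Suc.prems by (intro segment_step) auto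
  moreover have "segment (bounded_store M) 1 (?b # ?r # sample_loop # K, s, h)
      (return_pmf (?r # sample_loop # K, s1, h))"
    using Suc.prems by (intro segment_step) (auto simp: s1_def)
  moreover have "segment (bounded_store M) 1 (?r # sample_loop # K, s1, h)
      (map_pmf (\<lambda>v. (sample_loop # K, s2 v, h @ [(int d ^ 3, v)])) ?P)"
    using Suc.prems W1 pos by (intro segment_step) (auto simp: s1_def s2_def cube)
  ultimately have 1: "segment (bounded_store M) (1 + (1 + (1 + 1))) (sample_loop # K, s, h)
      (map_pmf (\<lambda>v. (sample_loop # K, s2 v, h @ [(int d ^ 3, v)])) ?P)"
    by (meson segment_trans_det)
  let ?t = "4 * (d - Suc a) + 1"
  have 2: "segment (bounded_store M) ?t (sample_loop # K, s2 v, h @ [(int d ^ 3, v)])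
      (map_pmf (\<lambda>X. (K, sampled d (Suc a) (s2 v) X,
          (h @ [(int d ^ 3, v)]) @ map (\<lambda>i. (int d ^ 3, X i)) [Suc (Suc a)..<Suc d]))
        (Pi_pmf {Suc (Suc a)..d} 0 (\<lambda>_. ?P)))" if v: "v \<in> {0..<int d ^ 3}" for v
  proof (rule Suc.hyps)
    show "n = d - Suc a" "Suc a \<le> d" using Suc.hyps(2) \<open>a < d\<close> by auto
    show "s2 v ''i'' 0 = int (Suc a)" "s2 v ''d'' 0 = int d"
      using Suc.prems by (simp_all add: s2_def s1_def)
    show "bounded_store M (s2 v)"
      unfolding s2_def using W1 v M by (intro bounded_store_upd) auto
  qed
  \<comment> \<open>\<open>segment_trans\<close> takes the continuation as a function of the
    configuration, from which \<open>v\<close> is awkward to recover; \<open>run ?t\<close> itself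
    serves as this function.\<close>
  have 3: "segment (bounded_store M) ?t c (run ?t c)"
    if c: "c \<in> set_pmf (map_pmf (\<lambda>v. (sample_loop # K, s2 v, h @ [(int d ^ 3, v)])) ?P)" for c
  proof -
    obtain v where "v \<in> {0..<int d ^ 3}" "c = (sample_loop # K, s2 v, h @ [(int d ^ 3, v)])"
      using c pos by auto
    then show ?thesis using 2[of v] by (auto simp: segment_def)
  qed
  have store: "sampled d (Suc a) (s2 v) X = sampled d a s (X(Suc a := v))" for v X
    using \<open>a < d\<close> by (auto simp: sampled_def s2_def s1_def fun_eq_iff nat_eq_iff2)
  have hist: "(h @ [(int d ^ 3, v)]) @ map (\<lambda>i. (int d ^ 3, X i)) [Suc (Suc a)..<Suc d] =
      h @ map (\<lambda>i. (int d ^ 3, (X(Suc a := v)) i)) [Suc a..<Suc d]" for v X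
    using \<open>a < d\<close> by (simp add: upt_conv_Cons del: upt_Suc)
  have ins: "{Suc a..d} = insert (Suc a) {Suc (Suc a)..d}" using \<open>a < d\<close> by auto
  have "bind_pmf (map_pmf (\<lambda>v. (sample_loop # K, s2 v, h @ [(int d ^ 3, v)])) ?P) (run ?t)
      = bind_pmf ?P (\<lambda>v. run ?t (sample_loop # K, s2 v, h @ [(int d ^ 3, v)]))"
    by (simp add: bind_map_pmf)
  also have "\<dots> = bind_pmf ?P (\<lambda>v. map_pmf (\<lambda>X. (K, sampled d a s (X(Suc a := v)),
          h @ map (\<lambda>i. (int d ^ 3, (X(Suc a := v)) i)) [Suc a..<Suc d]))
        (Pi_pmf {Suc (Suc a)..d} 0 (\<lambda>_. ?P)))"
    using 2 pos unfolding store hist segment_def by (intro bind_pmf_cong) auto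
  also have "\<dots> = map_pmf (\<lambda>X. (K, sampled d a s X, h @ map (\<lambda>i. (int d ^ 3, X i)) [Suc a..<Suc d]))
      (Pi_pmf {Suc a..d} 0 (\<lambda>_. ?P))"
    unfolding ins by (subst Pi_pmf_insert') (auto simp: map_bind_pmf map_pmf_def bind_assoc_pmf bind_return_pmf)
  finally have eq: "bind_pmf (map_pmf (\<lambda>v. (sample_loop # K, s2 v, h @ [(int d ^ 3, v)])) ?P) (run ?t) =
    map_pmf (\<lambda>X. (K, sampled d a s X, h @ map (\<lambda>i. (int d ^ 3, X i)) [Suc a..<Suc d]))
      (Pi_pmf {Suc a..d} 0 (\<lambda>_. ?P))" .
  have time: "4 * (d - a) + 1 = 1 + (1 + (1 + 1)) + ?t" using \<open>a < d\<close> by simp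
  show ?case using segment_trans[OF 1 3] unfolding eq time .
qed

context lassp_input begin

lemma inputs_same:
  assumes "inputs s" "same_except A s s'" "A \<inter> {''d'', ''k'', ''Delta'', ''x'', ''F''} = {}"
  shows "inputs s'"
proof -
  have "s' y = s y" if "y \<in> {''d'', ''k'', ''Delta'', ''x'', ''F''}" for y
    using that assms by (auto intro!: same_exceptD)
  then show ?thesis using assms(1) unfolding inputs_def by (metis insertCI)
qed

section \<open>A complete evaluation and the output\<close>

text \<open>The exact values 0 and 1 matter because \<open>output_prog\<close> multiplies by them;
  \<open>output_set\<close> only asks for nonzero cells.\<close>

definition marks :: "store \<Rightarrow> nat set \<Rightarrow> bool" where
  "marks s S \<longleftrightarrow> S \<subseteq> {1..d} \<and> (\<forall>i\<in>{1..d}. s ''S'' (int i) = (if i \<in> S then 1 else 0))"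

lemma output_set_marks: "marks s S \<Longrightarrow> output_set d s = S"
  by (auto simp: marks_def output_set_def split: if_splits)

text \<open>Weights, final table and backtracking contribute 8, 5 and 7 steps per index; the middle
  term is the binary search.\<close>

definition eval_time :: nat where "eval_time = 20 * d + search_steps * (19 + 10 * d) + 23"

lemma perturb_wt: "perturb d c X = (\<lambda>i. real_of_int (wt X i))"
  by (simp add: perturb_def wt_def fun_eq_iff)

lemma wp_evaluate_prog:
  assumes X: "X \<in> samples" and s: "inputs s" "\<And>i. i \<in> {1..d} \<Longrightarrow> s ''X'' (int i) = X i"
  shows "wp (bounded_store M) evaluate_prog eval_time (\<lambda>s'. inputs s' \<and>
    (\<exists>S. lassp_round d k \<Delta> c X S \<and> s' ''cnt'' 0 = int (card S) \<and> marks s' S)) s"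
  unfolding evaluate_prog_def
proof (rule wp_seq[OF wp_weights_prog[OF X s, of "8 * d + 5"]], goal_cases)
  case (3 s1)
  note upd_apply [simp]
  have s1: "inputs s1" by (rule inputs_same[OF s(1)]) (use 3 in auto)
  then have r1: "ready X s1" using 3 by (simp add: ready_def)
  show ?case
  proof (rule wp_seq[OF wp_search_prog[OF X r1, of "search_steps * (19 + 10 * d) + 5"]], goal_cases)
    case (3 s2)
    define l where "l = s2 ''hi'' 0"
    define q where "q = (int d + 1) * l - 1"
    define w where "w i = (int d + 1) * wt X i - q" for i
    have r2: "ready X s2" and lam: "is_lambda_hat d k \<Delta> (\<lambda>i. real_of_int (wt X i)) l"
      and l: "- R X - 1 \<le> l" "l \<le> R X" using 3 by (auto simp: l_def)
    have "\<bar>(int d + 1) * l\<bar> < lim X" using l by (intro lim_ge[OF X]) auto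
    then have qb: "\<bar>q\<bar> \<le> lim X" by (simp add: q_def)
    have S2: "s2 ''S'' (int i) = 0" if "i \<in> {1..d}" for i
      using 3 \<open>same_except {''i'', ''R'', ''ct'', ''S''} s s1 \<and> _\<close> that
        same_exceptD[of "{''mid'', ''q'', ''v'', ''F'', ''i'', ''lo'', ''hi''}" s1 s2 "''S''"] by auto
    have r3: "ready X (upd s2 ''q'' 0 q)" using r2 by (intro ready_upd) auto
    have d2: "s2 ''d'' 0 = int d" using r2 by (simp add: ready_def inputs_def)
    show ?case
    proof (rule wp_bounded_assign_seq[where i = 0 and v = q], goal_cases)
      case 5
      show ?case
      proof (rule wp_seq[OF wp_dp_ready[OF X r3 _ qb, of "5 * d + 3"]], goal_cases)
        case (3 s3)
        have in3: "inputs s3" using 3 by (simp add: ready_def)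
        have F3: "s3 ''F'' (int j) = dp w e j" if "j \<le> d" for j
          using 3 that by (simp add: w_def[abs_def])
        have S3: "s3 ''S'' (int i) = 0" if "i \<in> {1..d}" for i
          using 3 S2[OF that] same_exceptD[of "{''F'', ''i''}" "upd s2 ''q'' 0 q" s3 "''S''"] by auto
        have "wp (bounded_store M) backtrack_prog (7 * d + 5) (\<lambda>s'. same_except {''cnt'', ''i'', ''S''} s3 s' \<and>
           s' ''cnt'' 0 = int (card (backtrack w e d)) \<and>
           (\<forall>i\<in>{1..d}. s' ''S'' (int i) = (if i \<in> backtrack w e d then 1 else 0))) s3"
          using in3 F3 S3 by (intro wp_backtrack_prog) (auto simp: inputs_def)
        then show ?case
        proof (rule wp_mono, goal_cases)
          case (2 s4)
          have "inputs s4" by (rule inputs_same[OF in3]) (use 2 in auto)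
          moreover have "marks s4 (backtrack w e d)"
            using 2 backtrack_separated[of w \<Delta> d] by (auto simp: marks_def e_def separated_iff)
          moreover have "lassp_round d k \<Delta> c X (backtrack w e d)"
          proof -
            \<comment> \<open>After scaling, the shift of the multiplier by
              \<open>1 / (d + 1)\<close> is the \<open>- 1\<close> in \<open>q\<close>.\<close>
            have "real_of_int q / (real d + 1) = real_of_int l - 1 / (real d + 1)"
              by (simp add: q_def field_simps)
            then have "backtrack w e d \<in> ProjLagr d k \<Delta> (real_of_int l - 1 / (real d + 1)) (perturb d c X)"
              using ProjLagr_dp(1)[of d w "wt X" q \<Delta> k] unfolding perturb_wt e_def by (simp add: w_def)
            then show ?thesis
              using X lam unfolding lassp_round_def perturb_wt samples_def by auto
          qed
          ultimately show ?case using 2 by blast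
        qed (simp add: eval_time_def)
      qed (simp_all add: eval_time_def)
    qed (use qb lim_le_M(3)[OF X] d2 in \<open>simp_all add: eval_time_def q_def l_def\<close>)
  qed (use 3 in \<open>simp_all add: eval_time_def\<close>)
qed (simp_all add: eval_time_def)

lemma wp_output_prog:
  assumes s: "inputs s" "marks s S" and T: "4 * d + 3 \<le> T"
  shows "wp (bounded_store M) output_prog T (\<lambda>s'. marks s' S \<and>
    (\<forall>i\<in>{1..d}. s' ''xhat'' (int i) = (if i \<in> S then m i else 0))) s"
proof -
  define I where "I j t \<longleftrightarrow> j \<le> d \<and> t ''i'' 0 = int d - int j \<and> same_except {''xhat'', ''i''} s t \<and>
    (\<forall>i\<in>{1..d - j}. t ''xhat'' (int i) = (if i \<in> S then m i else 0))" for j :: nat and t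
  note upd_apply [simp]
  have sd: "s ''d'' 0 = int d" using s by (simp add: inputs_def)
  show ?thesis
    unfolding output_prog_def
  proof (rule wp_bounded_assign_seq[where i = 0 and v = 0], goal_cases)
    case 5
    show ?case
    proof (rule wp_while[where I = I and j = d and C = 3], goal_cases)
      case (1 j t)
      then have I: "Suc j \<le> d" "t ''i'' 0 = int d - int (Suc j)" "same_except {''xhat'', ''i''} s t"
        "\<forall>i\<in>{1..d - Suc j}. t ''xhat'' (int i) = (if i \<in> S then m i else 0)"
        by (auto simp: I_def)
      define n where "n = d - Suc j"
      have n: "int d - int j = int n + 1" "n < d" "d - j = Suc n" "int d - int (Suc j) = int n"
        using I(1) by (auto simp: n_def)
      have tv: "t ''x'' = s ''x''" "t ''S'' = s ''S''" using same_exceptD[OF I(3)] by simp_all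
      have x: "s ''x'' (int n + 1) = m (Suc n)" "s ''S'' (int n + 1) = (if Suc n \<in> S then 1 else 0)"
        using s n(2) unfolding inputs_def marks_def
        by (auto dest!: bspec[of _ _ "Suc n"] simp: add.commute)
      define v where "v = (if Suc n \<in> S then m (Suc n) else 0)"
      have v: "\<bar>v\<bar> \<le> M" using m_less[of "Suc n"] n(2) small_le_M(3,4) by (auto simp: v_def)
      let ?u = "upd (upd t ''i'' 0 (int n + 1)) ''xhat'' (int n + 1) v"
      have "?u ''xhat'' (int i) = (if i \<in> S then m i else 0)" if "i \<in> {1..Suc n}" for i
      proof (cases "i = Suc n")
        case False
        then have "i \<in> {1..n}" using that by auto
        then show ?thesis using I(4) False unfolding n_def[symmetric] by simp
      qed (simp add: v_def)
      moreover have "same_except {''xhat'', ''i''} s ?u"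
        using I(3) by (intro same_except_upd) auto
      ultimately have "I j ?u" unfolding I_def n(1,3) using I(1) by simp
      show ?case
      proof (rule wp_bounded_assign_seq[where i = 0 and v = "int n + 1"], goal_cases)
        case 5
        show ?case
          using \<open>I j ?u\<close> v tv x
          by (intro wp_bounded_assign[where i = "int n + 1" and v = v]) (simp_all add: v_def)
      qed (use I(2) n small_le_M(1) in simp_all)
    next
      case (2 t)
      then show ?case using sd same_exceptD[of _ s t "''d''"] by (auto simp: I_def)
    next
      case (3 j t)
      have "t ''d'' = s ''d''" "t ''S'' = s ''S''"
        using 3(1) same_exceptD[of "{''xhat'', ''i''}" s t] by (simp_all add: I_def)
      then show ?case using 3 sd s(2) by (auto simp: I_def marks_def)
    next
      case 4
      show ?case by (auto simp: I_def same_except_upd same_except_refl)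
    qed (use T in simp)
  qed (use small_le_M T in simp_all)
qed

end

text \<open>Fixing the shape of the invariant avoids higher-order unification with the premise \<open>W s\<close>.\<close>

lemmas bounded_segment_step = segment_step[where W = "bounded_store M" for M]
lemmas bounded_wpD = wpD[where W = "bounded_store M" for M]

lemma lassp_history_snoc:
  "lassp_history d (Xs @ [X]) = lassp_history d Xs @ map (\<lambda>i. (int d ^ 3, X i)) [1..<Suc d]"
  by (simp add: lassp_history_def)

context lassp_input begin

section \<open>Runs of LASSP along the main loop\<close>

text \<open>Only the existence of a rejected set matters, since \<open>lassp_run\<close> leaves the
  choice among the maximizers open.\<close>

definition failed :: "(nat \<Rightarrow> int) \<Rightarrow> bool" where
  "failed X \<longleftrightarrow> (\<exists>S. lassp_round d k \<Delta> c X S \<and> card S \<noteq> k)"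

text \<open>\<open>lassp_run\<close> grows at the front, while the program appends new samples at
  the end of its history; this adds the accepted round at the end.\<close>

lemma lassp_run_append:
  assumes "\<forall>X\<in>set Xs. failed X" "lassp_round d k \<Delta> c X S" "card S = k"
  shows "lassp_run d k \<Delta> c (Xs @ [X]) S"
  using assms(1)
proof (induction Xs)
  case Nil
  then show ?case using assms by (auto intro: accept)
next
  case (Cons Y Xs)
  then obtain S' where "lassp_round d k \<Delta> c Y S'" "card S' \<noteq> k" by (auto simp: failed_def)
  then show ?case using Cons by (auto intro: retry)
qed

text \<open>Describes the head of the main loop without an accepted set. Before the first round it
  holds with no samples, thanks to \<open>cnt = 0\<close>.\<close>

definition searching :: "store \<Rightarrow> (int \<times> int) list \<Rightarrow> bool" where
  "searching s h \<longleftrightarrow> inputs s \<and> s ''cnt'' 0 \<noteq> int k \<and>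
     (\<exists>Xs. h = lassp_history d Xs \<and> (\<forall>X\<in>set Xs. failed X))"

definition found :: "store \<Rightarrow> (int \<times> int) list \<Rightarrow> bool" where
  "found s h \<longleftrightarrow> inputs s \<and> s ''cnt'' 0 = int k \<and>
     (\<exists>Xs S. h = lassp_history d Xs \<and> lassp_run d k \<Delta> c Xs S \<and> marks s S)"

definition final :: "store \<Rightarrow> (int \<times> int) list \<Rightarrow> bool" where
  "final s h \<longleftrightarrow> (\<exists>Xs. h = lassp_history d Xs \<and> lassp_run d k \<Delta> c Xs (output_set d s)) \<and>
     (\<forall>i\<in>{1..d}. output_vec s i = (if i \<in> output_set d s then m i else 0))"

lemma found_finishes:
  assumes "found s h" "bounded_store M s"
  obtains n s' where "n \<le> 4 * d + 4"
    "segment (bounded_store M) n ([main_loop, output_prog], s, h) (return_pmf ([], s', h))"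
    "bounded_store M s'" "final s' h"
proof -
  obtain Xs S where *: "inputs s" "s ''cnt'' 0 = int k" "h = lassp_history d Xs"
    "lassp_run d k \<Delta> c Xs S" "marks s S" using assms(1) unfolding found_def by blast
  have "s ''k'' 0 = int k" using *(1) by (simp add: inputs_def)
  with *(2) have "\<not> bval size_mismatch s" by (simp add: bval_size_mismatch)
  then have "step ([main_loop, output_prog], s, h) = return_pmf ([output_prog], s, h)"
    unfolding main_loop_def step.simps by (simp only: if_False)
  then have 1: "segment (bounded_store M) 1 ([main_loop, output_prog], s, h) (return_pmf ([output_prog], s, h))"
    using assms(2) by (rule bounded_segment_step)
  obtain n s' where 2: "n \<le> 4 * d + 3"
    "segment (bounded_store M) n ([output_prog], s, h) (return_pmf ([], s', h))"
    "bounded_store M s'" "marks s' S"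
    "\<forall>i\<in>{1..d}. s' ''xhat'' (int i) = (if i \<in> S then m i else 0)"
    using bounded_wpD[OF wp_output_prog[OF *(1,5) order_refl] assms(2), of "[]" h]
    by (elim exE conjE) (rule that)
  have out: "output_set d s' = S" using 2(4) by (rule output_set_marks)
  have "final s' h"
    unfolding final_def output_vec_def out using *(3,4) 2(5)
    by (intro conjI exI[of _ Xs])
  show ?thesis
  proof (rule that[OF _ segment_trans_det[OF 1 2(2)]])
    show "1 + n \<le> 4 * d + 4" using 2(1) by simp
  qed fact+
qed

section \<open>Failure probability of a round\<close>

text \<open>An event on the samples alone; it covers failure independently of which maximizer a
  round chooses.\<close>

definition tie :: "(nat \<Rightarrow> int) set" where
  "tie = {X. \<exists>A\<in>sparse_separated d k \<Delta>. \<exists>B\<in>sparse_separated d k \<Delta>. A \<noteq> B \<and>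
      (\<forall>S\<in>sparse_separated d k \<Delta>. (\<Sum>j\<in>S. int d ^ 4 * c j + X j) \<le> (\<Sum>j\<in>A. int d ^ 4 * c j + X j)) \<and>
      (\<Sum>j\<in>A. int d ^ 4 * c j + X j) = (\<Sum>j\<in>B. int d ^ 4 * c j + X j)}"

lemma failed_round_tie:
  assumes "lassp_round d k \<Delta> c X S" "card S \<noteq> k"
  shows "X \<in> tie"
proof -
  obtain l where l: "is_lambda_hat d k \<Delta> (\<lambda>i. real_of_int (wt X i)) l"
    "S \<in> ProjLagr d k \<Delta> (real_of_int l - 1 / (real d + 1)) (\<lambda>i. real_of_int (wt X i))"
    using assms(1) unfolding lassp_round_def perturb_wt by blast
  obtain A B where AB: "A \<in> sparse_separated d k \<Delta>" "B \<in> sparse_separated d k \<Delta>" "A \<noteq> B"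
    "sum (wt X) A = best d \<Delta> (wt X) k" "sum (wt X) B = best d \<Delta> (wt X) k"
    by (rule round_failure_tie[OF k feasible l assms(2)])
  then have "sum (wt X) A = sum (wt X) B" "\<forall>S\<in>sparse_separated d k \<Delta>. sum (wt X) S \<le> sum (wt X) A"
    by (auto intro: best_ge)
  then show ?thesis using AB(1-3) unfolding tie_def wt_def[abs_def] by blast
qed

text \<open>The first bound serves the running time. It is vacuous for \<open>d = 1\<close>, so
  convergence rests on the second: for \<open>d = 1\<close> the only candidate is \<open>{1}\<close>
  and no tie exists.\<close>

lemma prob_tie:
  shows "measure_pmf.prob (sample_pmf d) tie \<le> 1 / (real d)\<^sup>2"
    and "measure_pmf.prob (sample_pmf d) tie \<le> 1 / 4"
proof -
  show *: "measure_pmf.prob (sample_pmf d) tie \<le> 1 / (real d)\<^sup>2"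
    unfolding tie_def using d_ge(2)
    by (intro prob_isolation_failure) (auto simp: sparse_separated_def separated_iff)
  show "measure_pmf.prob (sample_pmf d) tie \<le> 1 / 4"
  proof (cases "d = 1")
    case True
    then have "k = 1" using k d_ge by simp
    have "S = {1}" if "S \<in> sparse_separated d k \<Delta>" for S
    proof -
      have "S \<subseteq> {1}" "card S = 1"
        using that True \<open>k = 1\<close> by (auto simp: sparse_separated_def separated_iff)
      then show ?thesis by (metis card.empty subset_singletonD zero_neq_one)
    qed
    then have "tie = {}" unfolding tie_def by blast
    then show ?thesis by simp
  next
    case False
    then have "2 \<le> real d" using d_ge by simp
    then have "2\<^sup>2 \<le> (real d)\<^sup>2" by (intro power_mono) auto
    then have "1 / (real d)\<^sup>2 \<le> 1 / 4" using d_ge by (simp add: divide_simps)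
    then show ?thesis using * by simp
  qed
qed

lemma set_sample_pmf: "X \<in> set_pmf (sample_pmf d) \<Longrightarrow> X \<in> samples"
proof -
  assume X: "X \<in> set_pmf (sample_pmf d)"
  have "{0..<int d ^ 3} \<noteq> {}" using d_ge by simp
  then have "set_pmf (pmf_of_set {0..<int d ^ 3}) = {0..<int d ^ 3}" by (intro set_pmf_of_set) auto
  then show "X \<in> samples"
    using X unfolding sample_pmf_def by (auto simp: set_Pi_pmf PiE_dflt_def samples_def)
qed

lemma inputs_sampled: "inputs s \<Longrightarrow> inputs (sampled d a s X)"
  by (simp add: inputs_def sampled_def)

definition after_sampling :: "store \<Rightarrow> (int \<times> int) list \<Rightarrow> (nat \<Rightarrow> int) \<Rightarrow> config" where
  "after_sampling s h X = ([evaluate_prog, main_loop, output_prog], sampled d 0 (upd s ''i'' 0 0) X,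
     h @ map (\<lambda>i. (int d ^ 3, X i)) [1..<Suc d])"

lemma segment_sampling:
  assumes s: "searching s h" "bounded_store M s"
  shows "segment (bounded_store M) (4 * d + 5) ([main_loop, output_prog], s, h)
    (map_pmf (after_sampling s h) (sample_pmf d))"
proof -
  have inp: "s ''d'' 0 = int d" "bval size_mismatch s"
    using s unfolding searching_def inputs_def bval_size_mismatch by simp_all
  let ?b = "Seq reset_prog (Seq sample_loop evaluate_prog)"
  let ?K = "[main_loop, output_prog]"
  have W: "bounded_store M (upd s ''i'' 0 0)"
    using s(2) small_le_M(4) by (intro bounded_store_upd) auto
  have "step (?K, s, h) = return_pmf (?b # ?K, s, h)"
    unfolding main_loop_def step.simps using inp(2) by (simp only: if_True)
  then have "segment (bounded_store M) 1 (?K, s, h) (return_pmf (?b # ?K, s, h))"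
    using s(2) by (rule bounded_segment_step)
  moreover have "segment (bounded_store M) 1 (?b # ?K, s, h)
      (return_pmf (reset_prog # Seq sample_loop evaluate_prog # ?K, s, h))"
    by (rule bounded_segment_step[OF step.simps(5) s(2)])
  moreover have "segment (bounded_store M) 1 (reset_prog # Seq sample_loop evaluate_prog # ?K, s, h)
      (return_pmf (Seq sample_loop evaluate_prog # ?K, upd s ''i'' 0 0, h))"
    by (rule bounded_segment_step[OF _ s(2)]) (simp only: reset_prog_def step.simps aval.simps)
  moreover have "segment (bounded_store M) 1 (Seq sample_loop evaluate_prog # ?K, upd s ''i'' 0 0, h)
      (return_pmf (sample_loop # evaluate_prog # ?K, upd s ''i'' 0 0, h))"
    by (rule bounded_segment_step[OF step.simps(5) W])
  moreover have "segment (bounded_store M) (4 * (d - 0) + 1) (sample_loop # evaluate_prog # ?K, upd s ''i'' 0 0, h)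
    (map_pmf (\<lambda>X. (evaluate_prog # ?K, sampled d 0 (upd s ''i'' 0 0) X, h @ map (\<lambda>i. (int d ^ 3, X i)) [Suc 0..<Suc d]))
      (Pi_pmf {Suc 0..d} 0 (\<lambda>_. pmf_of_set {0..<int d ^ 3})))"
    using W inp small_le_M d_ge by (intro segment_sample_loop) (auto simp: upd_apply)
  ultimately have "segment (bounded_store M) (1 + (1 + (1 + (1 + (4 * (d - 0) + 1))))) (?K, s, h)
    (map_pmf (\<lambda>X. (evaluate_prog # ?K, sampled d 0 (upd s ''i'' 0 0) X, h @ map (\<lambda>i. (int d ^ 3, X i)) [Suc 0..<Suc d]))
      (Pi_pmf {Suc 0..d} 0 (\<lambda>_. pmf_of_set {0..<int d ^ 3})))"
    by (meson segment_trans_det)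
  moreover have "1 + (1 + (1 + (1 + (4 * (d - 0) + 1)))) = 4 * d + 5" by simp
  ultimately show ?thesis
    unfolding sample_pmf_def after_sampling_def[abs_def] One_nat_def by metis
qed

text \<open>Once the samples are drawn, a round is deterministic, but its duration \<open>n\<close>
  depends on them. Outside \<open>tie\<close> it ends with an accepted set.\<close>

lemma round_result:
  assumes s: "searching s h" "bounded_store M s" and X: "X \<in> set_pmf (sample_pmf d)"
  obtains n s' h' where "n \<le> eval_time"
    "segment (bounded_store M) n (after_sampling s h X) (return_pmf ([main_loop, output_prog], s', h'))"
    "bounded_store M s'" "searching s' h' \<or> found s' h'" "X \<in> tie \<or> found s' h'"
proof -
  have Xs: "X \<in> samples" using X by (rule set_sample_pmf)
  let ?t = "sampled d 0 (upd s ''i'' 0 0) X"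
  let ?h = "h @ map (\<lambda>i. (int d ^ 3, X i)) [1..<Suc d]"
  have "inputs s" using s by (simp add: searching_def)
  then have inp: "inputs ?t" by (intro inputs_sampled) (simp add: inputs_def upd_apply)
  have tX: "?t ''X'' (int i) = X i" if "i \<in> {1..d}" for i using that by (simp add: sampled_def)
  have "\<bar>X (nat i)\<bar> \<le> M" if "0 < i" "i \<le> int d" for i
  proof -
    have "nat i \<in> {1..d}" using that by auto
    then have "0 \<le> X (nat i)" "X (nat i) < int d ^ 3" using Xs by (auto simp: samples_def)
    then show ?thesis using small_le_M(2) by simp
  qed
  then have "bounded_store M ?t"
    using s(2) small_le_M(1,4) by (auto simp: bounded_store_def sampled_def upd_apply)
  from bounded_wpD[OF wp_evaluate_prog[OF Xs inp tX] this, of "[main_loop, output_prog]" ?h]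
  obtain n s' where n: "n \<le> eval_time"
    "segment (bounded_store M) n (evaluate_prog # [main_loop, output_prog], ?t, ?h)
      (return_pmf ([main_loop, output_prog], s', ?h))" "bounded_store M s'"
    and S_ex: "inputs s'" "\<exists>S. lassp_round d k \<Delta> c X S \<and> s' ''cnt'' 0 = int (card S) \<and> marks s' S"
    by blast
  from S_ex obtain S where S: "lassp_round d k \<Delta> c X S" "s' ''cnt'' 0 = int (card S)" "marks s' S" "inputs s'"
    by blast
  obtain Xs where h: "h = lassp_history d Xs" "\<forall>X\<in>set Xs. failed X"
    using s(1) by (auto simp: searching_def)
  have h': "?h = lassp_history d (Xs @ [X])" using h by (simp only: lassp_history_snoc)
  have ok: "found s' ?h" if "card S = k"
    unfolding found_def h' using S lassp_run_append[OF h(2) S(1) that] that by auto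
  have bad: "searching s' ?h" if "card S \<noteq> k"
  proof -
    have "failed X" using S(1) that by (auto simp: failed_def)
    then show ?thesis unfolding searching_def h' using S h(2) that by (intro conjI exI[of _ "Xs @ [X]"]) auto
  qed
  show ?thesis
    using that[of n s' ?h] n ok bad failed_round_tie[OF S(1)] unfolding after_sampling_def by blast
qed

section \<open>Invariants of all reachable configurations\<close>

definition good_config :: "config \<Rightarrow> bool" where
  "good_config = (\<lambda>(K, s, h). bounded_store M s \<and> (K = [] \<longrightarrow> final s h))"

lemma good_running: "bounded_store M s \<Longrightarrow> K \<noteq> [] \<Longrightarrow> good_config (K, s, h)"
  by (simp add: good_config_def)

lemma safe_found:
  assumes "found s h" "bounded_store M s"
  shows "safe good_config n ([main_loop, output_prog], s, h)"
proof -
  obtain n' s' where "segment (bounded_store M) n' ([main_loop, output_prog], s, h) (return_pmf ([], s', h))"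
    "bounded_store M s'" "final s' h" using assms by (rule found_finishes)
  then show ?thesis
    by (intro safe_segment_det[OF _ safe_halted]) (auto simp: good_config_def)
qed

text \<open>The number of rounds is unbounded, but each takes at least one step, so induction on the
  time horizon \<open>n\<close> reaches every configuration.\<close>

lemma safe_searching:
  assumes "searching s h" "bounded_store M s"
  shows "safe good_config n ([main_loop, output_prog], s, h)"
  using assms
proof (induction n arbitrary: s h)
  case 0
  then show ?case by (simp add: safe_def good_config_def)
next
  case (Suc n)
  have "safe good_config (4 * d + 5 + n) ([main_loop, output_prog], s, h)"
  proof (rule safe_segment[OF segment_sampling[OF Suc.prems]])
    fix cfg assume "cfg \<in> set_pmf (map_pmf (after_sampling s h) (sample_pmf d))"
    then obtain X where X: "X \<in> set_pmf (sample_pmf d)" "cfg = after_sampling s h X" by auto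
    obtain n' s' h' where *: "segment (bounded_store M) n' (after_sampling s h X)
        (return_pmf ([main_loop, output_prog], s', h'))" "bounded_store M s'"
      "searching s' h' \<or> found s' h'"
      using Suc.prems X(1) by (rule round_result)
    have "safe good_config n ([main_loop, output_prog], s', h')"
      using *(2,3) Suc.IH safe_found by blast
    then show "safe good_config n cfg"
      unfolding X(2) by (rule safe_segment_det[OF *(1)]) (rule good_running)
  qed (rule good_running)
  then show ?case by (rule safe_mono) simp
qed

lemma halt_prob_found:
  assumes "found s h" "bounded_store M s" "4 * d + 4 \<le> n"
  shows "halt_prob n ([main_loop, output_prog], s, h) = 1"
proof -
  obtain n' s' where *: "n' \<le> 4 * d + 4"
    "segment (bounded_store M) n' ([main_loop, output_prog], s, h) (return_pmf ([], s', h))"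
    using assms(1,2) by (rule found_finishes)
  have "halt_prob (n' + (n - n')) ([main_loop, output_prog], s, h) = 1"
    using halt_prob_segment_det[OF *(2)] halt_prob_halted by simp
  then show ?thesis using * assms(3) by simp
qed

section \<open>Halting probability and running time\<close>

definition round_time :: nat where "round_time = 4 * d + 5 + eval_time"

text \<open>Rounds use fresh samples, so failure probabilities multiply. The extra
  \<open>4 * d + 4\<close> steps are for leaving the loop and writing the output.\<close>

lemma halt_prob_searching:
  assumes "searching s h" "bounded_store M s"
  shows "1 - measure_pmf.prob (sample_pmf d) tie ^ j
    \<le> halt_prob (j * round_time + (4 * d + 4)) ([main_loop, output_prog], s, h)"
  using assms
proof (induction j arbitrary: s h)
  case 0
  then show ?case by (simp add: halt_prob_nonneg)
next
  case (Suc j)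
  define p where "p = measure_pmf.prob (sample_pmf d) tie"
  let ?n = "eval_time + (j * round_time + (4 * d + 4))"
  have p: "0 \<le> p" "p ^ j \<le> 1" by (auto simp: p_def power_le_one)
  \<comment> \<open>Outside \<open>tie\<close> the run halts surely within the remaining time;
    inside it the induction hypothesis applies. Integrating this pointwise bound produces the next
    factor \<open>p\<close>.\<close>
  have lower: "1 - indicator tie X * p ^ j \<le> halt_prob ?n (after_sampling s h X)"
    if "X \<in> set_pmf (sample_pmf d)" for X
  proof -
    obtain n' s' h' where *: "n' \<le> eval_time" "segment (bounded_store M) n' (after_sampling s h X)
        (return_pmf ([main_loop, output_prog], s', h'))" "bounded_store M s'"
      "searching s' h' \<or> found s' h'" "X \<in> tie \<or> found s' h'"
      using Suc.prems \<open>X \<in> _\<close> by (rule round_result)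
    \<comment> \<open>A round that ends early leaves more time than the induction hypothesis asks
      for; \<open>halt_prob_mono\<close> absorbs the difference.\<close>
    let ?n' = "?n - n'"
    have n': "j * round_time + (4 * d + 4) \<le> ?n'" "n' + ?n' = ?n" using *(1) by auto
    have eq: "halt_prob ?n (after_sampling s h X) = halt_prob ?n' ([main_loop, output_prog], s', h')"
      using halt_prob_segment_det[OF *(2), of ?n'] n'(2) by simp
    show ?thesis
    proof (cases "found s' h'")
      case True
      then have "halt_prob ?n' ([main_loop, output_prog], s', h') = 1"
        using *(3) n'(1) by (intro halt_prob_found) auto
      then show ?thesis unfolding eq using p by (simp add: indicator_def)
    next
      case False
      then have "1 - p ^ j \<le> halt_prob (j * round_time + (4 * d + 4)) ([main_loop, output_prog], s', h')"
        unfolding p_def using *(3,4) by (intro Suc.IH) auto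
      also have "\<dots> \<le> halt_prob ?n' ([main_loop, output_prog], s', h')"
        using n'(1) by (rule halt_prob_mono)
      finally show ?thesis unfolding eq using *(5) False by (auto simp: indicator_def)
    qed
  qed
  have int: "integrable (measure_pmf (sample_pmf d)) (indicator tie :: _ \<Rightarrow> real)"
    by (rule measure_pmf.integrable_const_bound[where B = 1]) auto
  have "1 - p ^ Suc j = measure_pmf.expectation (sample_pmf d) (\<lambda>X. 1 - indicator tie X * p ^ j)"
    using int by (simp add: p_def)
  also have "\<dots> \<le> measure_pmf.expectation (sample_pmf d) (\<lambda>X. halt_prob ?n (after_sampling s h X))"
  proof (rule integral_mono_AE)
    show "integrable (measure_pmf (sample_pmf d)) (\<lambda>X. 1 - indicator tie X * p ^ j)"
      using int by simp
    show "integrable (measure_pmf (sample_pmf d)) (\<lambda>X. halt_prob ?n (after_sampling s h X))"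
      by (rule measure_pmf.integrable_const_bound[where B = 1])
        (auto simp: halt_prob_le_1 halt_prob_nonneg)
    show "AE X in measure_pmf (sample_pmf d). 1 - indicator tie X * p ^ j \<le> halt_prob ?n (after_sampling s h X)"
      using lower by (simp add: AE_measure_pmf_iff)
  qed
  also have "\<dots> = halt_prob (4 * d + 5 + ?n) ([main_loop, output_prog], s, h)"
    unfolding halt_prob_segment[OF segment_sampling[OF Suc.prems]] by simp
  also have "4 * d + 5 + ?n = Suc j * round_time + (4 * d + 4)" by (simp add: round_time_def)
  finally show ?case unfolding p_def .
qed

abbreviation start :: config where "start \<equiv> init_config lassp_prog d k \<Delta> m"

lemma startup:
  obtains n s where "n \<le> 4" "segment (bounded_store M) n start (return_pmf ([main_loop, output_prog], s, []))"
    "bounded_store M s" "searching s []"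
proof -
  let ?s = "init_store d k \<Delta> m"
  have "\<bar>?s v i\<bar> \<le> M" for v i
  proof -
    have "\<bar>m (nat i)\<bar> \<le> M" if "i \<in> {1..int d}"
    proof -
      have "nat i \<in> {1..d}" using that by auto
      then show ?thesis using m_less[of "nat i"] small_le_M(3) by simp
    qed
    then show ?thesis using small_le_M(1,4,6) d_ge(1) by (auto simp: init_store_def)
  qed
  then have W: "bounded_store M ?s" by (simp add: bounded_store_def)
  have init: "?s ''d'' 0 = int d" "?s ''k'' 0 = int k" "?s ''Delta'' 0 = int \<Delta>" "?s ''cnt'' 0 = 0"
    "\<forall>i\<in>{1..d}. ?s ''x'' (int i) = m i" "\<forall>j\<le>0. ?s ''F'' j = 0"
    by (simp_all add: init_store_def)
  have hist: "\<exists>Xs. [] = lassp_history d Xs \<and> (\<forall>X\<in>set Xs. failed X)"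
    by (rule exI[of _ "[]"]) (simp add: lassp_history_def)
  have wp: "wp (bounded_store M) init_prog 2 (\<lambda>s'. searching s' []) ?s"
    unfolding init_prog_def
  proof (rule wp_if, goal_cases)
    case 2
    then have "int \<Delta> = int e + 1" unfolding e_def using init(3) by simp
    then have "searching ?s []"
      unfolding searching_def inputs_def using init hist k by simp
    then show ?case by (intro wp_skip) simp_all
  next
    case 3
    then have e: "e = 0" unfolding e_def using init(3) by simp
    let ?u = "upd ?s ''Delta'' 0 1"
    have "?u ''d'' = ?s ''d''" "?u ''k'' = ?s ''k''" "?u ''cnt'' = ?s ''cnt''" "?u ''x'' = ?s ''x''"
      "?u ''F'' = ?s ''F''" "?u ''Delta'' 0 = 1"
      by (simp_all add: upd_apply)
    then have "searching ?u []"
      unfolding searching_def inputs_def e using init hist k by simp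
    then show ?case
      using small_le_M(4) by (intro wp_bounded_assign[where i = 0 and v = 1]) simp_all
  qed simp
  obtain n s where n: "n \<le> 2" "segment (bounded_store M) n (init_prog # [Seq main_loop output_prog], ?s, [])
      (return_pmf ([Seq main_loop output_prog], s, []))" "bounded_store M s" "searching s []"
    using bounded_wpD[OF wp W, of "[Seq main_loop output_prog]" "[]"] by (elim exE conjE) (rule that)
  have 1: "segment (bounded_store M) 1 start (return_pmf (init_prog # [Seq main_loop output_prog], ?s, []))"
    unfolding init_config_def lassp_prog_def by (rule bounded_segment_step[OF step.simps(5) W])
  have 2: "segment (bounded_store M) 1 ([Seq main_loop output_prog], s, [])
      (return_pmf ([main_loop, output_prog], s, []))"
    by (rule bounded_segment_step[OF step.simps(5) n(3)])
  have "segment (bounded_store M) (1 + (n + 1)) start (return_pmf ([main_loop, output_prog], s, []))"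
    by (rule segment_trans_det[OF 1 segment_trans_det[OF n(2) 2]])
  then show ?thesis by (rule that[rotated]) (use n in simp_all)
qed

lemma all_reachable_good:
  assumes "cfg \<in> set_pmf (run n start)"
  shows "good_config cfg"
proof -
  obtain n' s where s: "segment (bounded_store M) n' start (return_pmf ([main_loop, output_prog], s, []))"
    "bounded_store M s" "searching s []" by (rule startup)
  have "safe good_config n start"
    using safe_searching[OF s(3,2)] by (rule safe_segment_det[OF s(1)]) (rule good_running)
  then show ?thesis using assms unfolding safe_def by blast
qed

lemma halt_prob_start:
  assumes "4 + (j * round_time + (4 * d + 4)) \<le> n"
  shows "1 - measure_pmf.prob (sample_pmf d) tie ^ j \<le> halt_prob n start"
proof -
  obtain n' s where s: "n' \<le> 4" "segment (bounded_store M) n' start (return_pmf ([main_loop, output_prog], s, []))"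
    "bounded_store M s" "searching s []" by (rule startup)
  have "1 - measure_pmf.prob (sample_pmf d) tie ^ j
      \<le> halt_prob (j * round_time + (4 * d + 4)) ([main_loop, output_prog], s, [])"
    using s(4,3) by (rule halt_prob_searching)
  also have "\<dots> = halt_prob (n' + (j * round_time + (4 * d + 4))) start"
    by (rule halt_prob_segment_det[OF s(2), symmetric])
  also have "\<dots> \<le> halt_prob n start" using assms s(1) by (intro halt_prob_mono) simp
  finally show ?thesis .
qed

text \<open>The bound 1/4 on \<open>tie\<close> makes the failure of \<open>j\<close> rounds
  geometrically small for every \<open>d\<close>.\<close>

lemma halt_prob_tendsto: "(\<lambda>n. halt_prob n start) \<longlonglongrightarrow> 1"
proof (rule LIMSEQ_I)
  fix r :: real assume "0 < r"
  obtain j where j: "(1 / 4 :: real) ^ j < r"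
    using real_arch_pow_inv[OF \<open>0 < r\<close>, of "1 / 4"] by auto
  have "measure_pmf.prob (sample_pmf d) tie ^ j \<le> (1 / 4) ^ j"
    using prob_tie(2) by (intro power_mono) auto
  then have "norm (halt_prob n start - 1) < r" if "4 + (j * round_time + (4 * d + 4)) \<le> n" for n
    using halt_prob_start[OF that] halt_prob_le_1[of n start] j by simp
  then show "\<exists>n0. \<forall>n\<ge>n0. norm (halt_prob n start - 1) < r" by blast
qed

text \<open>Startup, a single round and the output fit into the claimed time.
  \<open>\<gamma> \<ge> 1\<close> absorbs the rounding of the logarithm at the price of 18 instead
  of 9; then \<open>64 + 18 * 29 = 586\<close>, rounded up to 600.\<close>

lemma time_bound:
  "4 + (1 * round_time + (4 * d + 4)) \<le> nat \<lfloor>600 * (real d * (real \<gamma> + log 2 (real d)))\<rfloor>"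
proof -
  define L where "L = nat \<lceil>log 2 (real d)\<rceil>"
  define t where "t = real \<gamma> + log 2 (real d)"
  have d: "1 \<le> real d" using d_ge by simp
  then have log: "0 \<le> log 2 (real d)" by simp
  have t: "1 \<le> t" using gamma_ge log by (simp add: t_def)
  have "real L \<le> log 2 (real d) + 1" unfolding L_def using log by linarith
  then have "real search_steps \<le> 18 * t"
    using gamma_ge log unfolding search_steps_def t_def L_def[symmetric] by simp
  then have J: "real search_steps * (19 + 10 * real d) \<le> 18 * t * (29 * real d)"
    using d t by (intro mult_mono) auto
  have "real (4 + (1 * round_time + (4 * d + 4))) = 28 * real d + 36 + real search_steps * (19 + 10 * real d)"
    by (simp add: round_time_def eval_time_def)
  also have "\<dots> \<le> 64 * (real d * 1) + 18 * t * (29 * real d)" using J d by simp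
  also have "\<dots> \<le> 64 * (real d * t) + 18 * t * (29 * real d)"
    using t d by (intro add_right_mono mult_left_mono) auto
  also have "\<dots> = 586 * (real d * t)" by simp
  also have "\<dots> \<le> 600 * (real d * t)" using t d by (intro mult_right_mono) auto
  finally show ?thesis unfolding t_def by (simp only: le_nat_floor)
qed

text \<open>The quantum multiplies all sums of squares by \<open>\<delta>\<^sup>2\<close>, so
  optimality for the integers \<open>c\<close> carries over to \<open>x\<close>.\<close>

lemma final_solves:
  assumes x: "\<And>i. i \<in> {1..d} \<Longrightarrow> x i = \<delta> * real_of_int (m i)" and fin: "final s h"
  shows "solves_projection d k \<Delta> x (output_set d s) (\<lambda>i. \<delta> * real_of_int (output_vec s i))"
proof -
  let ?S = "output_set d s"
  obtain Xs where run: "lassp_run d k \<Delta> c Xs ?S" using fin by (auto simp: final_def)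
  have S: "?S \<in> sparse_separated d k \<Delta>" by (rule lassp_run_max[OF run d_ge(2)])
  have sq: "(\<Sum>i\<in>T. (x i)\<^sup>2) = \<delta>\<^sup>2 * real_of_int (sum c T)" if "T \<in> sparse_separated d k \<Delta>" for T
  proof -
    have "T \<subseteq> {1..d}" using that by (simp add: sparse_separated_def separated_iff)
    then have "(\<Sum>i\<in>T. (x i)\<^sup>2) = (\<Sum>i\<in>T. \<delta>\<^sup>2 * real_of_int (c i))"
      using x by (intro sum.cong) (auto simp: c_def power_mult_distrib)
    then show ?thesis by (simp add: sum_distrib_left)
  qed
  show ?thesis
  proof (rule solves_projectionI[OF S])
    fix T assume T: "T \<in> sparse_separated d k \<Delta>"
    have "sum c T \<le> sum c ?S" using lassp_run_max(2)[OF run d_ge(2) T] .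
    then have "real_of_int (sum c T) \<le> real_of_int (sum c ?S)" by (rule of_int_le_iff[THEN iffD2])
    then show "(\<Sum>i\<in>T. (x i)\<^sup>2) \<le> (\<Sum>i\<in>?S. (x i)\<^sup>2)"
      unfolding sq[OF T] sq[OF S] by (intro mult_left_mono) auto
  next
    fix i assume "i \<in> {1..d}"
    then show "\<delta> * real_of_int (output_vec s i) = (if i \<in> ?S then x i else 0)"
      using fin x by (simp add: final_def)
  qed
qed

end

text \<open>The witnesses are \<open>lassp_prog\<close>, the constant 600 of
  \<open>time_bound\<close> and the exponent 15 of \<open>M\<close>.\<close>

theorem theorem1:
  "\<exists>(P::com) (C::real) (B::nat).
     \<forall>(d::nat) (k::nat) (\<Delta>::nat) (x::nat \<Rightarrow> real) (\<delta>::real) (m::nat \<Rightarrow> int) (\<gamma>::nat).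
       k \<ge> 1 \<longrightarrow> sparse_separated d k \<Delta> \<noteq> {} \<longrightarrow>
       \<delta> > 0 \<longrightarrow> (\<forall>i\<in>{1..d}. x i = \<delta> * real_of_int (m i)) \<longrightarrow> \<gamma> = bit_precision d m \<longrightarrow>
         implements_LASSP P d k \<Delta> m \<and>
         (\<forall>n K s h. (K, s, h) \<in> set_pmf (run n (init_config P d k \<Delta> m)) \<longrightarrow>
            word_bounded B d \<Delta> \<gamma> s) \<and>
         (\<forall>n s h. ([], s, h) \<in> set_pmf (run n (init_config P d k \<Delta> m)) \<longrightarrow>
            solves_projection d k \<Delta> x (output_set d s)
              (\<lambda>i. \<delta> * real_of_int (output_vec s i))) \<and>
         (\<lambda>n. measure_pmf.prob (run n (init_config P d k \<Delta> m)) halted) \<longlonglongrightarrow> 1 \<and>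
         measure_pmf.prob
           (run (nat \<lfloor>C * (real d * (real \<gamma> + log 2 (real d)))\<rfloor>) (init_config P d k \<Delta> m)) halted
           \<ge> 1 - 1 / real d"
proof (rule exI[of _ lassp_prog], rule exI[of _ 600], rule exI[of _ 15], intro allI impI)
  fix d k \<Delta> :: nat and x :: "nat \<Rightarrow> real" and \<delta> :: real and m :: "nat \<Rightarrow> int" and \<gamma> :: nat
  assume "1 \<le> k" "sparse_separated d k \<Delta> \<noteq> {}" "\<gamma> = bit_precision d m"
    and x: "\<forall>i\<in>{1..d}. x i = \<delta> * real_of_int (m i)"
  then interpret lassp_input d k \<Delta> m \<gamma> by unfold_locales
  have c: "c = (\<lambda>i. (m i)\<^sup>2)" by (simp add: c_def fun_eq_iff)
  have good: "bounded_store M s" "K = [] \<Longrightarrow> final s h"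
    if "(K, s, h) \<in> set_pmf (run n start)" for n K s h
    using all_reachable_good[OF that] by (auto simp: good_config_def)
  have "implements_LASSP lassp_prog d k \<Delta> m"
    unfolding implements_LASSP_def c[symmetric] using good(2) by (auto simp: final_def)
  moreover have "word_bounded 15 d \<Delta> \<gamma> s" if "(K, s, h) \<in> set_pmf (run n start)" for n K s h
    using good(1)[OF that] by (simp add: bounded_store_def word_bounded_def M_def Q_def)
  moreover have "solves_projection d k \<Delta> x (output_set d s) (\<lambda>i. \<delta> * real_of_int (output_vec s i))"
    if "([], s, h) \<in> set_pmf (run n start)" for n s h
    using x good(2)[OF that] by (intro final_solves) auto
  moreover have "(\<lambda>n. measure_pmf.prob (run n start) halted) \<longlonglongrightarrow> 1"
    using halt_prob_tendsto by (simp add: halt_prob_def)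
  moreover have "1 - 1 / real d \<le> measure_pmf.prob
      (run (nat \<lfloor>600 * (real d * (real \<gamma> + log 2 (real d)))\<rfloor>) start) halted"
  proof -
    \<comment> \<open>One round is enough: its failure probability is already at most
      \<open>1 / d\<close>.\<close>
    have "1 / (real d)\<^sup>2 \<le> 1 / real d"
      using d_ge(2) by (simp add: divide_simps power2_eq_square)
    then have "1 - 1 / real d \<le> 1 - measure_pmf.prob (sample_pmf d) tie ^ 1"
      using prob_tie(1) by simp
    also have "\<dots> \<le> halt_prob (nat \<lfloor>600 * (real d * (real \<gamma> + log 2 (real d)))\<rfloor>) start"
      using time_bound by (rule halt_prob_start)
    finally show ?thesis by (simp add: halt_prob_def)
  qed
  ultimately show "implements_LASSP lassp_prog d k \<Delta> m \<and>
      (\<forall>n K s h. (K, s, h) \<in> set_pmf (run n start) \<longrightarrow> word_bounded 15 d \<Delta> \<gamma> s) \<and>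
      (\<forall>n s h. ([], s, h) \<in> set_pmf (run n start) \<longrightarrow>
        solves_projection d k \<Delta> x (output_set d s) (\<lambda>i. \<delta> * real_of_int (output_vec s i))) \<and>
      (\<lambda>n. measure_pmf.prob (run n start) halted) \<longlonglongrightarrow> 1 \<and>
      1 - 1 / real d \<le> measure_pmf.prob
        (run (nat \<lfloor>600 * (real d * (real \<gamma> + log 2 (real d)))\<rfloor>) start) halted"
    by blast
qed

end
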